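(* If $(X,g)$ is a strongly causal non-refocusing space-time, then the map $f:X\to SKY(X)$, $x\mapsto O_x$, is a homeomorphism.
   Context: All manifolds are smooth ($C^\infty$). A space-time $(X,g)$ is a connected, time-oriented smooth Lorentz manifold (signature $(+,\dots,+,-)$) of dimension at least $2$; its points are called events. A nonzero tangent vector $v$ is timelike, null or nonspacelike if $g(v,v)<0$, $g(v,v)=0$ or $g(v,v)\le 0$, respectively. A nonspacelike curve is a piecewise-smooth curve whose velocity vectors are nonspacelike and all future-directed (or all past-directed). An open set $U\subset X$ is causally convex if no nonspacelike curve in $X$ intersects $U$ in a disconnected set. $(X,g)$ is strongly causal if for every event $p$ every open neighborhood of $p$ contains a causally convex open neighborhood of $p$. Null-geodesics are geodesics with null velocity and are taken to be inextendible in $X$; a null-geodesic enters a set $U$ if its image meets $U$. A strongly causal space-time $(X,g)$ is refocusing at $x\in X$ if one (equivalently, all) of the following conditions holds. (i) There is an open neighborhood $V$ of $x$ such that for all open $U$ with $x\in U\subset V$ there is an event $y\notin U$ such that all null-geodesics through $y$ enter $U$. (ii) There is an open neighborhood $V$ of $x$ such that for all open $U$ with $x\in U\subset V$ there is an event $y\notin V$ such that all null-geodesics through $y$ enter $U$. (iii) There are an open neighborhood $V$ of $x$ and a sequence $\{y_n\}_{n=1}^\infty$ in $X\setminus V$ such that for all open $U$ with $x\in U\subset V$ there is $K\in\mathbb{N}$ such that for all $n\ge K$ all null-geodesics through $y_n$ enter $U$. It is refocusing if it is refocusing at some event, and non-refocusing otherwise. Let $FNX\subset TX$ be the subspace of future-directed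 null vectors, $SNX=FNX/\mathbb{R}^+$ its quotient by positive scalar multiplication (the space of future null directions), and $\mathcal{N}$ the quotient space of $SNX$ identifying two null directions if they are tangent to a common null-geodesic; $\mathcal{N}$ (with the quotient topology) is the space of future-directed null-geodesics in $X$ modulo orientation-preserving affine reparametrization. The sky of $x\in X$ is the subspace $O_x\subset\mathcal{N}$ of all null-geodesics passing through $x$. The sky space $SKY(X)=\{O_x: x\in X\}$ is topologized by taking as neighborhood base at $O_x$ the sets $B_W=\{O_y : O_y\subset W\}$, where $W$ ranges over the open subsets of $\mathcal{N}$ containing $O_x$. *)

theory Defs
  imports "HOL-Analysis.Analysis"
begin

section \<open>Smooth maps and smooth manifolds\<close>

text \<open>\<open>Ck_on k S f\<close> and \<open>smooth_on S f\<close> are only ever used for open \<open>S\<close>.\<close>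

fun Ck_on :: "nat \<Rightarrow> 'e::real_normed_vector set \<Rightarrow> ('e \<Rightarrow> 'f::real_normed_vector) \<Rightarrow> bool" where
  "Ck_on 0 S f \<longleftrightarrow> continuous_on S f"
| "Ck_on (Suc k) S f \<longleftrightarrow>
     f differentiable_on S \<and> (\<forall>v. Ck_on k S (\<lambda>x. frechet_derivative f (at x) v))"

definition smooth_on :: "'e::real_normed_vector set \<Rightarrow> ('e \<Rightarrow> 'f::real_normed_vector) \<Rightarrow> bool" where
  "smooth_on S f \<longleftrightarrow> (\<forall>k. Ck_on k S f)"

text \<open>
  The underlying space of a manifold is a whole type \<open>'a\<close>; it is modelled on the Euclidean space
  \<open>'e\<close>, so its dimension is \<open>DIM('e)\<close>.  A chart is a pair of a domain and a coordinate map;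
  values of the coordinate map off the domain are irrelevant.
\<close>

type_synonym ('a, 'e) chart = "'a set \<times> ('a \<Rightarrow> 'e)"

definition chart_inv :: "('a, 'e) chart \<Rightarrow> 'e \<Rightarrow> 'a" where
  "chart_inv c = inv_into (fst c) (snd c)"

definition is_chart :: "('a::topological_space, 'e::euclidean_space) chart \<Rightarrow> bool" where
  "is_chart c \<longleftrightarrow> open (fst c) \<and> open (snd c ` fst c) \<and>
     homeomorphism (fst c) (snd c ` fst c) (snd c) (chart_inv c)"

definition smooth_atlas :: "('a::topological_space, 'e::euclidean_space) chart set \<Rightarrow> bool" where
  "smooth_atlas A \<longleftrightarrow> (\<forall>c\<in>A. is_chart c) \<and> (\<Union>c\<in>A. fst c) = UNIV \<and>
     (\<forall>c\<in>A. \<forall>d\<in>A. smooth_on (snd c ` (fst c \<inter> fst d)) (snd d \<circ> chart_inv c))"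


section \<open>Tangent vectors and the tangent bundle\<close>

text \<open>
  A tangent vector at \<open>p\<close> is the family of its components in all charts of the atlas around \<open>p\<close>,
  subject to the transformation law under change of charts (and \<open>0\<close> for all other charts).
\<close>

type_synonym ('a, 'e) tvec = "('a, 'e) chart \<Rightarrow> 'e"

definition transition_deriv ::
  "('a, 'e::euclidean_space) chart \<Rightarrow> ('a, 'e) chart \<Rightarrow> 'a \<Rightarrow> 'e \<Rightarrow> 'e" where
  "transition_deriv c d p = frechet_derivative (snd d \<circ> chart_inv c) (at (snd c p))"

definition tangent_space :: "('a, 'e::euclidean_space) chart set \<Rightarrow> 'a \<Rightarrow> ('a, 'e) tvec set" where
  "tangent_space A p =
     {v. (\<forall>c\<in>A. \<forall>d\<in>A. p \<in> fst c \<longrightarrow> p \<in> fst d \<longrightarrow> v d = transition_deriv c d p (v c)) \<and>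
         (\<forall>c. \<not> (c \<in> A \<and> p \<in> fst c) \<longrightarrow> v c = 0)}"

definition tv_lin :: "real \<Rightarrow> ('a, 'e::euclidean_space) tvec \<Rightarrow> real \<Rightarrow> ('a, 'e) tvec \<Rightarrow> ('a, 'e) tvec" where
  "tv_lin a v b w = (\<lambda>c. a *\<^sub>R v c + b *\<^sub>R w c)"

definition tv_scale :: "real \<Rightarrow> ('a, 'e::euclidean_space) tvec \<Rightarrow> ('a, 'e) tvec" where
  "tv_scale a v = (\<lambda>c. a *\<^sub>R v c)"

text \<open>The tangent vector at \<open>p\<close> whose components in the chart \<open>c\<close> are \<open>a\<close>.\<close>

definition tv_of_coord ::
  "('a, 'e::euclidean_space) chart set \<Rightarrow> ('a, 'e) chart \<Rightarrow> 'a \<Rightarrow> 'e \<Rightarrow> ('a, 'e) tvec" where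
  "tv_of_coord A c p a =
     (\<lambda>d. if d \<in> A \<and> p \<in> fst d then transition_deriv c d p a else 0)"

definition tangent_bundle :: "('a, 'e::euclidean_space) chart set \<Rightarrow> ('a \<times> ('a, 'e) tvec) set" where
  "tangent_bundle A = {(p, v). v \<in> tangent_space A p}"

text \<open>
  The topology of \<open>TX\<close> for which the bundle charts \<open>(p, v) \<mapsto> (c p, v c)\<close> over the chart domains
  are homeomorphisms onto open subsets of \<open>'e \<times> 'e\<close>.
\<close>

definition tangent_topology ::
  "('a, 'e::euclidean_space) chart set \<Rightarrow> ('a \<times> ('a, 'e) tvec) topology" where
  "tangent_topology A = topology_generated_by
     {{(p, v). (p, v) \<in> tangent_bundle A \<and> p \<in> fst c \<and> (snd c p, v c) \<in> O'} | c O'.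
        c \<in> A \<and> open O'}"


section \<open>Space-times\<close>

text \<open>
  \<open>tfield\<close> is a continuous timelike vector field; it represents the time orientation.
\<close>

record ('a, 'e) st =
  atlas :: "('a, 'e) chart set"
  metric :: "'a \<Rightarrow> ('a, 'e) tvec \<Rightarrow> ('a, 'e) tvec \<Rightarrow> real"
  tfield :: "'a \<Rightarrow> ('a, 'e) tvec"

definition metric_coord ::
  "('a, 'e::euclidean_space) st \<Rightarrow> ('a, 'e) chart \<Rightarrow> 'e \<Rightarrow> 'e \<Rightarrow> 'e \<Rightarrow> real" where
  "metric_coord M c x a b =
     (let p = chart_inv c x in
      metric M p (tv_of_coord (atlas M) c p a) (tv_of_coord (atlas M) c p b))"

text \<open>
  The signature \<open>(+,...,+,-)\<close> is expressed by the existence of an orthonormal frame \<open>E\<close>, indexed by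
  the standard basis of \<open>'e\<close>, in which exactly one vector has square \<open>-1\<close>.
\<close>

definition lorentz_metric :: "('a, 'e::euclidean_space) st \<Rightarrow> bool" where
  "lorentz_metric M \<longleftrightarrow>
     (\<forall>p. \<forall>u\<in>tangent_space (atlas M) p. \<forall>v\<in>tangent_space (atlas M) p.
        metric M p u v = metric M p v u) \<and>
     (\<forall>p. \<forall>u\<in>tangent_space (atlas M) p. \<forall>v\<in>tangent_space (atlas M) p.
        \<forall>w\<in>tangent_space (atlas M) p. \<forall>a b.
        metric M p (tv_lin a u b v) w = a * metric M p u w + b * metric M p v w) \<and>
     (\<forall>p. \<exists>E. \<exists>b0\<in>Basis. (\<forall>b\<in>(Basis::'e set). E b \<in> tangent_space (atlas M) p) \<and>
        (\<forall>b\<in>Basis. \<forall>b'\<in>Basis.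
           metric M p (E b) (E b') = (if b \<noteq> b' then 0 else if b = b0 then -1 else 1))) \<and>
     (\<forall>c\<in>atlas M. \<forall>a b. smooth_on (snd c ` fst c) (\<lambda>x. metric_coord M c x a b))"

definition time_orientation :: "('a::topological_space, 'e::euclidean_space) st \<Rightarrow> bool" where
  "time_orientation M \<longleftrightarrow>
     (\<forall>p. tfield M p \<in> tangent_space (atlas M) p \<and> metric M p (tfield M p) (tfield M p) < 0) \<and>
     (\<forall>c\<in>atlas M. continuous_on (fst c) (\<lambda>p. tfield M p c))"

definition spacetime ::
  "('a::{t2_space, second_countable_topology}, 'e::euclidean_space) st \<Rightarrow> bool" where
  "spacetime M \<longleftrightarrow> smooth_atlas (atlas M) \<and> lorentz_metric M \<and> time_orientation M \<and>
     connected (UNIV :: 'a set) \<and> DIM('e) \<ge> 2"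

text \<open>In the following, \<open>(p, v)\<close> stands for the tangent vector \<open>v\<close> at \<open>p\<close>.\<close>

definition nonzero_vec :: "('a, 'e::euclidean_space) st \<Rightarrow> 'a \<times> ('a, 'e) tvec \<Rightarrow> bool" where
  "nonzero_vec M = (\<lambda>(p, v). v \<in> tangent_space (atlas M) p \<and> v \<noteq> (\<lambda>_. 0))"

definition null_vec :: "('a, 'e::euclidean_space) st \<Rightarrow> 'a \<times> ('a, 'e) tvec \<Rightarrow> bool" where
  "null_vec M = (\<lambda>(p, v). nonzero_vec M (p, v) \<and> metric M p v v = 0)"

definition nonspacelike_vec :: "('a, 'e::euclidean_space) st \<Rightarrow> 'a \<times> ('a, 'e) tvec \<Rightarrow> bool" where
  "nonspacelike_vec M = (\<lambda>(p, v). nonzero_vec M (p, v) \<and> metric M p v v \<le> 0)"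

text \<open>Applied to nonspacelike vectors: those in the same half-cone as (opposite to) \<open>tfield\<close>.\<close>

definition future_directed :: "('a, 'e::euclidean_space) st \<Rightarrow> 'a \<times> ('a, 'e) tvec \<Rightarrow> bool" where
  "future_directed M = (\<lambda>(p, v). metric M p v (tfield M p) < 0)"

definition past_directed :: "('a, 'e::euclidean_space) st \<Rightarrow> 'a \<times> ('a, 'e) tvec \<Rightarrow> bool" where
  "past_directed M = (\<lambda>(p, v). metric M p v (tfield M p) > 0)"


section \<open>Curves, causal convexity, strong causality\<close>

definition smooth_curve ::
  "('a::topological_space, 'e::euclidean_space) st \<Rightarrow> real set \<Rightarrow> (real \<Rightarrow> 'a) \<Rightarrow> bool" where
  "smooth_curve M J \<gamma> \<longleftrightarrow> open J \<and> is_interval J \<and> J \<noteq> {} \<and> continuous_on J \<gamma> \<and>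
     (\<forall>c\<in>atlas M. smooth_on {t\<in>J. \<gamma> t \<in> fst c} (snd c \<circ> \<gamma>))"

definition velocity ::
  "('a, 'e::euclidean_space) st \<Rightarrow> (real \<Rightarrow> 'a) \<Rightarrow> real \<Rightarrow> 'a \<times> ('a, 'e) tvec" where
  "velocity M \<gamma> t =
     (\<gamma> t, \<lambda>c. if c \<in> atlas M \<and> \<gamma> t \<in> fst c then vector_derivative (snd c \<circ> \<gamma>) (at t) else 0)"

text \<open>
  A smooth piece on a closed interval \<open>[s, t]\<close> is a curve that extends smoothly to an open
  interval; at break points the velocities of both adjacent pieces are constrained.
\<close>

definition nonspacelike_piece ::
  "('a::topological_space, 'e::euclidean_space) st \<Rightarrow> ('a \<times> ('a, 'e) tvec \<Rightarrow> bool) \<Rightarrow>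
   real \<Rightarrow> real \<Rightarrow> (real \<Rightarrow> 'a) \<Rightarrow> bool" where
  "nonspacelike_piece M dir s t \<gamma> \<longleftrightarrow> s < t \<and>
     (\<exists>J \<sigma>. smooth_curve M J \<sigma> \<and> {s..t} \<subseteq> J \<and> (\<forall>r\<in>{s..t}. \<sigma> r = \<gamma> r) \<and>
        (\<forall>r\<in>{s..t}. nonspacelike_vec M (velocity M \<sigma> r) \<and> dir (velocity M \<sigma> r)))"

definition nonspacelike_curve ::
  "('a::topological_space, 'e::euclidean_space) st \<Rightarrow> real \<Rightarrow> real \<Rightarrow> (real \<Rightarrow> 'a) \<Rightarrow> bool" where
  "nonspacelike_curve M a b \<gamma> \<longleftrightarrow>
     (\<exists>dir\<in>{future_directed M, past_directed M}. \<exists>(n::nat) \<tau>. n > 0 \<and> \<tau> 0 = a \<and> \<tau> n = b \<and>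
        (\<forall>i<n. nonspacelike_piece M dir (\<tau> i) (\<tau> (Suc i)) \<gamma>))"

definition causally_convex ::
  "('a::topological_space, 'e::euclidean_space) st \<Rightarrow> 'a set \<Rightarrow> bool" where
  "causally_convex M U \<longleftrightarrow>
     (\<forall>a b \<gamma>. nonspacelike_curve M a b \<gamma> \<longrightarrow> connected (\<gamma> ` {a..b} \<inter> U))"

definition strongly_causal :: "('a::topological_space, 'e::euclidean_space) st \<Rightarrow> bool" where
  "strongly_causal M \<longleftrightarrow>
     (\<forall>p U. open U \<and> p \<in> U \<longrightarrow> (\<exists>V. open V \<and> p \<in> V \<and> V \<subseteq> U \<and> causally_convex M V))"


section \<open>Null-geodesics and refocusing\<close>

text \<open>
  Christoffel symbols \<open>\<Gamma>\<^sub>x(a, b)\<close> of the Levi-Civita connection in the chart \<open>c\<close>, given by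
  the Koszul formula
  \<open>2 g(\<Gamma>(a, b), w) = D\<^sub>a g(b, w) + D\<^sub>b g(a, w) - D\<^sub>w g(a, b)\<close>.
\<close>

definition christoffel ::
  "('a, 'e::euclidean_space) st \<Rightarrow> ('a, 'e) chart \<Rightarrow> 'e \<Rightarrow> 'e \<Rightarrow> 'e \<Rightarrow> 'e" where
  "christoffel M c x a b = (THE z. \<forall>w. 2 * metric_coord M c x z w =
       frechet_derivative (\<lambda>y. metric_coord M c y b w) (at x) a
     + frechet_derivative (\<lambda>y. metric_coord M c y a w) (at x) b
     - frechet_derivative (\<lambda>y. metric_coord M c y a b) (at x) w)"

definition geodesic ::
  "('a::topological_space, 'e::euclidean_space) st \<Rightarrow> real set \<Rightarrow> (real \<Rightarrow> 'a) \<Rightarrow> bool" where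
  "geodesic M J \<gamma> \<longleftrightarrow> smooth_curve M J \<gamma> \<and>
     (\<forall>c\<in>atlas M. \<forall>t\<in>J. \<gamma> t \<in> fst c \<longrightarrow>
        (let x = snd c \<circ> \<gamma>; x' = (\<lambda>s. vector_derivative x (at s)) in
         vector_derivative x' (at t) + christoffel M c (x t) (x' t) (x' t) = 0))"

text \<open>Null-geodesics are inextendible, i.e. defined on a maximal open interval.\<close>

definition null_geodesic ::
  "('a::topological_space, 'e::euclidean_space) st \<Rightarrow> real set \<Rightarrow> (real \<Rightarrow> 'a) \<Rightarrow> bool" where
  "null_geodesic M J \<gamma> \<longleftrightarrow> geodesic M J \<gamma> \<and> (\<forall>t\<in>J. null_vec M (velocity M \<gamma> t)) \<and>
     (\<forall>J' \<gamma>'. geodesic M J' \<gamma>' \<and> J \<subseteq> J' \<and> (\<forall>t\<in>J. \<gamma>' t = \<gamma> t) \<longrightarrow> J' = J)"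

definition all_null_geodesics_enter ::
  "('a::topological_space, 'e::euclidean_space) st \<Rightarrow> 'a \<Rightarrow> 'a set \<Rightarrow> bool" where
  "all_null_geodesics_enter M y U \<longleftrightarrow>
     (\<forall>J \<gamma>. null_geodesic M J \<gamma> \<and> y \<in> \<gamma> ` J \<longrightarrow> \<gamma> ` J \<inter> U \<noteq> {})"

text \<open>
  Of the equivalent conditions defining refocusing we take the one with \<open>y \<notin> V\<close>.  It immediately
  implies the variant with \<open>y \<notin> U\<close>, and it is equivalent to the sequential variant because \<open>X\<close> is
  first countable.  Hence non-refocusing in the sense of any of the variants
  gives non-refocusing in the present sense.
\<close>

definition refocusing_at ::
  "('a::topological_space, 'e::euclidean_space) st \<Rightarrow> 'a \<Rightarrow> bool" where
  "refocusing_at M x \<longleftrightarrow>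
     (\<exists>V. open V \<and> x \<in> V \<and>
        (\<forall>U. open U \<and> x \<in> U \<and> U \<subseteq> V \<longrightarrow> (\<exists>y. y \<notin> V \<and> all_null_geodesics_enter M y U)))"

definition refocusing :: "('a::topological_space, 'e::euclidean_space) st \<Rightarrow> bool" where
  "refocusing M \<longleftrightarrow> (\<exists>x. refocusing_at M x)"


section \<open>Quotient topologies\<close>

definition quotient_topology :: "'b topology \<Rightarrow> ('b \<times> 'b) set \<Rightarrow> 'b set topology" where
  "quotient_topology T R =
     topology (\<lambda>U. U \<subseteq> topspace T // R \<and> openin T {x \<in> topspace T. R `` {x} \<in> U})"

lemma istopology_quotient_topology:
  "istopology (\<lambda>U. U \<subseteq> topspace T // R \<and> openin T {x \<in> topspace T. R `` {x} \<in> U})"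
proof -
  have 1: "{x \<in> topspace T. R `` {x} \<in> S \<inter> S'} =
      {x \<in> topspace T. R `` {x} \<in> S} \<inter> {x \<in> topspace T. R `` {x} \<in> S'}" for S S'
    by blast
  have 2: "{x \<in> topspace T. R `` {x} \<in> \<Union>\<K>} = \<Union>((\<lambda>S. {x \<in> topspace T. R `` {x} \<in> S}) ` \<K>)" for \<K>
    by blast
  show ?thesis
    unfolding istopology_def
  proof (intro conjI allI impI, goal_cases)
    case (1 S S') then show ?case by blast
  next
    case (2 S S') then show ?case unfolding 1 by (intro openin_Int) blast+
  next
    case (3 \<K>) then show ?case by blast
  next
    case (4 \<K>) then show ?case unfolding 2 by (intro openin_Union) blast
  qed
qed

lemma openin_quotient_topology:
  "openin (quotient_topology T R) U \<longleftrightarrow>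
     U \<subseteq> topspace T // R \<and> openin T {x \<in> topspace T. R `` {x} \<in> U}"
  unfolding quotient_topology_def topology_inverse'[OF istopology_quotient_topology] ..


section \<open>The space of null-geodesics and the sky space\<close>

definition future_null_topology ::
  "('a, 'e::euclidean_space) st \<Rightarrow> ('a \<times> ('a, 'e) tvec) topology" where
  "future_null_topology M =
     subtopology (tangent_topology (atlas M)) {X. null_vec M X \<and> future_directed M X}"

definition ray_rel ::
  "('a, 'e::euclidean_space) st \<Rightarrow> (('a \<times> ('a, 'e) tvec) \<times> ('a \<times> ('a, 'e) tvec)) set" where
  "ray_rel M = {(X, Y). X \<in> topspace (future_null_topology M) \<and>
     Y \<in> topspace (future_null_topology M) \<and> (\<exists>a>0. Y = (fst X, tv_scale a (snd X)))}"

text \<open>The space \<open>SNX\<close> of future null directions; its points are rays of null vectors.\<close>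

definition null_direction_topology ::
  "('a, 'e::euclidean_space) st \<Rightarrow> ('a \<times> ('a, 'e) tvec) set topology" where
  "null_direction_topology M = quotient_topology (future_null_topology M) (ray_rel M)"

definition tangent_to ::
  "('a, 'e::euclidean_space) st \<Rightarrow> ('a \<times> ('a, 'e) tvec) set \<Rightarrow> real set \<Rightarrow> (real \<Rightarrow> 'a) \<Rightarrow> bool" where
  "tangent_to M d J \<gamma> \<longleftrightarrow> (\<exists>t\<in>J. velocity M \<gamma> t \<in> d)"

definition common_geodesic_rel ::
  "('a::topological_space, 'e::euclidean_space) st \<Rightarrow>
   (('a \<times> ('a, 'e) tvec) set \<times> ('a \<times> ('a, 'e) tvec) set) set" where
  "common_geodesic_rel M = {(d, e). d \<in> topspace (null_direction_topology M) \<and>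
     e \<in> topspace (null_direction_topology M) \<and>
     (\<exists>J \<gamma>. null_geodesic M J \<gamma> \<and> tangent_to M d J \<gamma> \<and> tangent_to M e J \<gamma>)}"

text \<open>
  The space of null-geodesics: a geodesic, up to orientation-preserving affine
  reparametrization, is the set of all future null directions tangent to it.
\<close>

definition null_geodesic_topology ::
  "('a::topological_space, 'e::euclidean_space) st \<Rightarrow> ('a \<times> ('a, 'e) tvec) set set topology" where
  "null_geodesic_topology M =
     quotient_topology (null_direction_topology M) (common_geodesic_rel M)"

definition sky ::
  "('a::topological_space, 'e::euclidean_space) st \<Rightarrow> 'a \<Rightarrow> ('a \<times> ('a, 'e) tvec) set set set" where
  "sky M x = {n \<in> topspace (null_geodesic_topology M).
     \<exists>J \<gamma>. null_geodesic M J \<gamma> \<and> (\<exists>d\<in>n. tangent_to M d J \<gamma>) \<and> x \<in> \<gamma> ` J}"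

text \<open>
  The sets \<open>{sky M y | y. sky M y \<subseteq> W}\<close> with \<open>W\<close> open and \<open>sky M x \<subseteq> W\<close> form a
  neighbourhood base at \<open>sky M x\<close>.
\<close>

definition sky_open ::
  "('a::topological_space, 'e::euclidean_space) st \<Rightarrow> ('a \<times> ('a, 'e) tvec) set set set set \<Rightarrow> bool" where
  "sky_open M \<U> \<longleftrightarrow> \<U> \<subseteq> range (sky M) \<and>
     (\<forall>S\<in>\<U>. \<exists>W. openin (null_geodesic_topology M) W \<and> S \<subseteq> W \<and> {sky M y | y. sky M y \<subseteq> W} \<subseteq> \<U>)"

definition sky_topology ::
  "('a::topological_space, 'e::euclidean_space) st \<Rightarrow> ('a \<times> ('a, 'e) tvec) set set set topology" where
  "sky_topology M = topology (sky_open M)"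

lemma istopology_sky_open: "istopology (sky_open M)"
  unfolding istopology_def
proof (intro conjI allI impI)
  fix S T assume S: "sky_open M S" and T: "sky_open M T"
  show "sky_open M (S \<inter> T)"
    unfolding sky_open_def
  proof (intro conjI ballI)
    show "S \<inter> T \<subseteq> range (sky M)"
      using S unfolding sky_open_def by (meson inf.coboundedI1)
    fix P assume P: "P \<in> S \<inter> T"
    obtain V where V: "openin (null_geodesic_topology M) V" "P \<subseteq> V"
        "{sky M y | y. sky M y \<subseteq> V} \<subseteq> S"
      using S P unfolding sky_open_def by (meson IntD1)
    obtain W where W: "openin (null_geodesic_topology M) W" "P \<subseteq> W"
        "{sky M y | y. sky M y \<subseteq> W} \<subseteq> T"
      using T P unfolding sky_open_def by (meson IntD2)
    show "\<exists>W. openin (null_geodesic_topology M) W \<and> P \<subseteq> W \<and>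
        {sky M y | y. sky M y \<subseteq> W} \<subseteq> S \<inter> T"
    proof (intro exI[of _ "V \<inter> W"] conjI)
      show "openin (null_geodesic_topology M) (V \<inter> W)"
        using V(1) W(1) by (rule openin_Int)
      show "P \<subseteq> V \<inter> W"
        using V(2) W(2) by (rule Int_greatest)
      show "{sky M y | y. sky M y \<subseteq> V \<inter> W} \<subseteq> S \<inter> T"
        using V(3) W(3) by blast
    qed
  qed
next
  fix \<K> assume K: "\<forall>S\<in>\<K>. sky_open M S"
  show "sky_open M (\<Union>\<K>)"
    unfolding sky_open_def
  proof (intro conjI ballI)
    show "\<Union>\<K> \<subseteq> range (sky M)"
      using K unfolding sky_open_def by (meson Sup_least)
    fix P assume "P \<in> \<Union>\<K>"
    then obtain S where S: "S \<in> \<K>" "P \<in> S" by (rule UnionE)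
    then obtain W where W: "openin (null_geodesic_topology M) W" "P \<subseteq> W"
        "{sky M y | y. sky M y \<subseteq> W} \<subseteq> S"
      using K unfolding sky_open_def by meson
    from W(3) S(1) have "{sky M y | y. sky M y \<subseteq> W} \<subseteq> \<Union>\<K>"
      by (rule subset_trans[OF _ Union_upper])
    with W(1,2) show "\<exists>W. openin (null_geodesic_topology M) W \<and> P \<subseteq> W \<and>
        {sky M y | y. sky M y \<subseteq> W} \<subseteq> \<Union>\<K>"
      by (intro exI[of _ W] conjI)
  qed
qed

lemma openin_sky_topology: "openin (sky_topology M) \<U> \<longleftrightarrow> sky_open M \<U>"
  unfolding sky_topology_def topology_inverse'[OF istopology_sky_open] ..

end

theory Submission
  imports Defs
begin

text \<open>
  Two null-geodesics that share a null direction agree up to an affine reparametrization, so the sky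
  of \<open>x\<close> consists of the geodesics of the future null directions at \<open>x\<close>.  Since the null directions
  over a neighbourhood of \<open>x\<close> are relatively compact, skies of points near \<open>x\<close> lie in any given
  neighbourhood of the sky of \<open>x\<close>, which is continuity.  For an open \<open>V\<close> containing \<open>x\<close>,
  non-refocusing at \<open>x\<close> provides an open \<open>U \<subseteq> V\<close> containing \<open>x\<close> such that through every \<open>y \<notin> V\<close>
  there is a null-geodesic missing \<open>U\<close>.  The null-geodesics entering \<open>U\<close> form an open set \<open>W\<close>,
  because geodesics depend continuously on their initial velocity, and \<open>W\<close> contains the sky of \<open>x\<close>
  but no sky of a point outside \<open>V\<close>.  This gives openness and, as \<open>X\<close> is Hausdorff, injectivity.
\<close>

section \<open>Calculus of smooth maps\<close>

text \<open>A null-geodesic may leave every chart, while the flow of the geodesic equation is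
  constructed only for short times inside one chart. Statements about a whole geodesic are therefore
  obtained by showing that a property is locally constant in the parameter and using connectedness
  of the interval; uniqueness of geodesics and openness of \<open>entering U\<close> both have this
  form. The geodesic equation is required in all charts at once, and the Christoffel symbols are
  given by a definite description. Their existence, smoothness and transformation law must therefore
  be established before the solution of an ODE in one chart yields a geodesic. Computations take
  place on the coordinate pair \<open>tcoord c (vel \<gamma> t)\<close> of position and velocity,
  which solves an autonomous first-order equation.\<close>

abbreviation "fderiv f x \<equiv> frechet_derivative f (at x)"
abbreviation "vderiv f x \<equiv> vector_derivative f (at x)"

text \<open>\<open>frechet_derivative\<close> selects a witness of \<open>has_derivative\<close>,
  and this predicate is the same for \<open>f\<close> and \<open>g\<close> at \<open>x\<close>;
  hence the equality holds even where no derivative exists.\<close>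

lemma frechet_derivative_cong:
  assumes "open S" "x \<in> S" "\<And>y. y \<in> S \<Longrightarrow> f y = g y"
  shows "fderiv f x = fderiv g x"
proof -
  have "(f has_derivative D) (at x) \<longleftrightarrow> (g has_derivative D) (at x)" for D
    using assms by (metis has_derivative_transform_within_open)
  then show ?thesis unfolding frechet_derivative_def by simp
qed

lemma vector_derivative_cong_open:
  assumes "open S" "x \<in> S" "\<And>y. y \<in> S \<Longrightarrow> f y = g y"
  shows "vderiv f x = vderiv g x"
proof -
  have "(f has_vector_derivative D) (at x) \<longleftrightarrow> (g has_vector_derivative D) (at x)" for D
    unfolding has_vector_derivative_def
    using assms by (metis has_derivative_transform_within_open)
  then show ?thesis unfolding vector_derivative_def by simp
qed

lemma Ck_on_cong:
  assumes "open S" "\<And>x. x \<in> S \<Longrightarrow> f x = g x" "Ck_on k S f"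
  shows "Ck_on k S g"
  using assms(2,3)
proof (induction k arbitrary: f g)
  case 0
  then show ?case using continuous_on_cong by (metis Ck_on.simps(1))
next
  case (Suc k)
  have "g differentiable_on S"
    using Suc.prems unfolding differentiable_on_def differentiable_def Ck_on.simps
    by (metis has_derivative_transform)
  moreover have "fderiv f x v = fderiv g x v" if "x \<in> S" for x v
    using frechet_derivative_cong[OF assms(1) that Suc.prems(1)] by simp
  then have "Ck_on k S (\<lambda>x. fderiv g x v)" for v
    using Suc.prems(2) by (rule_tac Suc.IH[of "\<lambda>x. fderiv f x v"]) auto
  ultimately show ?case by simp
qed

lemma Ck_on_subset: "Ck_on k S f \<Longrightarrow> T \<subseteq> S \<Longrightarrow> Ck_on k T f"
  by (induction k arbitrary: f) (auto intro: continuous_on_subset differentiable_on_subset)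

lemma Ck_on_continuous: "open S \<Longrightarrow> Ck_on k S f \<Longrightarrow> continuous_on S f"
  by (cases k) (auto intro: differentiable_imp_continuous_on)

lemma Ck_on_has_derivative:
  assumes "open S" "Ck_on (Suc k) S f" "x \<in> S"
  shows "(f has_derivative fderiv f x) (at x)"
proof -
  have "f differentiable at x"
    using assms(2,3) differentiable_on_eq_differentiable_at[OF assms(1), of f] by simp
  then show ?thesis using frechet_derivative_works by blast
qed

text \<open>Frees the induction step from the selected \<open>frechet_derivative\<close>: any
  explicit formula \<open>f'\<close> will do, since derivatives at a point are unique. The closure
  rules below feed it the usual differentiation formulas.\<close>

lemma Ck_on_SucI:
  assumes "open S" "\<And>x. x \<in> S \<Longrightarrow> (f has_derivative f' x) (at x)" "\<And>v. Ck_on k S (\<lambda>x. f' x v)"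
  shows "Ck_on (Suc k) S f"
proof -
  have "f differentiable_on S"
    using assms(2) unfolding differentiable_on_def differentiable_def
    by (meson has_derivative_at_withinI)
  moreover have eq: "f' x v = fderiv f x v" if "x \<in> S" for x v
    using frechet_derivative_at[OF assms(2)[OF that]] by simp
  have "Ck_on k S (\<lambda>x. fderiv f x v)" for v
    by (rule Ck_on_cong[OF assms(1) eq assms(3)])
  ultimately show ?thesis by simp
qed

lemma Ck_on_SucD: "open S \<Longrightarrow> Ck_on (Suc k) S f \<Longrightarrow> Ck_on k S f"
proof (induction k arbitrary: f)
  case 0 then show ?case by (auto intro: differentiable_imp_continuous_on)
next
  case (Suc k) then show ?case by (metis Ck_on.simps(2))
qed

lemma Ck_on_local:
  assumes "open S" "\<And>x. x \<in> S \<Longrightarrow> \<exists>T. open T \<and> x \<in> T \<and> Ck_on k (T \<inter> S) f"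
  shows "Ck_on k S f"
  using assms(2)
proof (induction k arbitrary: f)
  case 0
  have "continuous (at x) f" if "x \<in> S" for x
    using 0[OF that] assms(1) that
    by (metis Ck_on.simps(1) IntI continuous_on_eq_continuous_at open_Int)
  then show ?case by (simp add: continuous_at_imp_continuous_on)
next
  case (Suc k)
  have "f differentiable (at x)" if x: "x \<in> S" for x
  proof -
    obtain T where T: "open T" "x \<in> T" "Ck_on (Suc k) (T \<inter> S) f" using Suc.prems[OF x] by blast
    then show ?thesis
      using Ck_on_has_derivative[OF _ T(3)] assms(1) x unfolding differentiable_def by blast
  qed
  then have "f differentiable_on S" by (simp add: differentiable_at_imp_differentiable_on)
  moreover have "Ck_on k S (\<lambda>x. fderiv f x v)" for v
    using Suc.prems by (rule_tac Suc.IH) (metis Ck_on.simps(2))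
  ultimately show ?case by simp
qed

lemma Ck_on_const: "open S \<Longrightarrow> Ck_on k S (\<lambda>_. c)"
proof (induction k arbitrary: c)
  case (Suc k)
  show ?case by (rule Ck_on_SucI[where f'="\<lambda>_ _. 0"]) (use Suc in auto)
qed simp

lemma Ck_on_add: "open S \<Longrightarrow> Ck_on k S f \<Longrightarrow> Ck_on k S g \<Longrightarrow> Ck_on k S (\<lambda>x. f x + g x)"
proof (induction k arbitrary: f g)
  case (Suc k)
  show ?case
    by (rule Ck_on_SucI[where f'="\<lambda>x v. fderiv f x v + fderiv g x v"])
      (use Suc in \<open>auto intro!: has_derivative_add Ck_on_has_derivative[OF _ Suc.prems(2)]
         Ck_on_has_derivative[OF _ Suc.prems(3)]\<close>)
qed (auto intro: continuous_intros)

lemma Ck_on_bounded_linear: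
  assumes "bounded_linear L"
  shows "open S \<Longrightarrow> Ck_on k S f \<Longrightarrow> Ck_on k S (\<lambda>x. L (f x))"
proof (induction k arbitrary: f)
  case 0 then show ?case by (auto intro: bounded_linear.continuous_on[OF assms])
next
  case (Suc k)
  show ?case
    by (rule Ck_on_SucI[where f'="\<lambda>x v. L (fderiv f x v)"])
      (use Suc in \<open>auto intro!: bounded_linear.has_derivative[OF assms] Ck_on_has_derivative[OF _ Suc.prems(2)]\<close>)
qed

lemma Ck_on_bounded_bilinear:
  assumes "bounded_bilinear B"
  shows "open S \<Longrightarrow> Ck_on k S f \<Longrightarrow> Ck_on k S g \<Longrightarrow> Ck_on k S (\<lambda>x. B (f x) (g x))"
proof (induction k arbitrary: f g)
  case 0 then show ?case by (auto intro: bounded_bilinear.continuous_on[OF assms])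
next
  case (Suc k)
  have "Ck_on k S f" "Ck_on k S g" using Suc.prems Ck_on_SucD by blast+
  then show ?case
    by (intro Ck_on_SucI[where f'="\<lambda>x v. B (f x) (fderiv g x v) + B (fderiv f x v) (g x)"])
      (use Suc in \<open>auto intro!: bounded_bilinear.FDERIV[OF assms] Ck_on_add Ck_on_has_derivative[OF _ Suc.prems(2)]
         Ck_on_has_derivative[OF _ Suc.prems(3)]\<close>)
qed

lemmas Ck_on_scaleR = Ck_on_bounded_bilinear[OF bounded_bilinear_scaleR]
lemmas Ck_on_mult = Ck_on_bounded_bilinear[OF bounded_bilinear_mult]
lemmas Ck_on_inner_left = Ck_on_bounded_linear[OF bounded_linear_inner_left]

lemma Ck_on_minus: "open S \<Longrightarrow> Ck_on k S f \<Longrightarrow> Ck_on k S (\<lambda>x. - f x)"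
  using Ck_on_bounded_linear[OF bounded_linear_minus[OF bounded_linear_ident]] .

lemma Ck_on_diff: "open S \<Longrightarrow> Ck_on k S f \<Longrightarrow> Ck_on k S g \<Longrightarrow> Ck_on k S (\<lambda>x. f x - g x)"
  using Ck_on_add[OF _ _ Ck_on_minus] by fastforce

lemma Ck_on_sum: "open S \<Longrightarrow> (\<And>i. i \<in> I \<Longrightarrow> Ck_on k S (f i)) \<Longrightarrow> Ck_on k S (\<lambda>x. \<Sum>i\<in>I. f i x)"
  by (induction I rule: infinite_finite_induct) (auto intro: Ck_on_const Ck_on_add)

lemma Ck_on_linear:
  assumes "bounded_linear L" "open S"
  shows "Ck_on k S L"
proof (cases k)
  case 0 then show ?thesis using assms linear_continuous_on by auto
next
  case (Suc j)
  show ?thesis unfolding Suc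
    by (rule Ck_on_SucI[where f'="\<lambda>x. L"]) (auto intro: assms Ck_on_const bounded_linear_imp_has_derivative)
qed

lemma Ck_on_Pair:
  assumes "open S" "Ck_on k S f" "Ck_on k S g"
  shows "Ck_on k S (\<lambda>x. (f x, g x))"
  using assms(2,3)
proof (induction k arbitrary: f g)
  case (Suc k)
  show ?case
    by (rule Ck_on_SucI[where f'="\<lambda>x v. (fderiv f x v, fderiv g x v)"])
      (use Suc assms(1) in \<open>auto intro!: has_derivative_Pair Ck_on_has_derivative[OF _ Suc.prems(1)]
         Ck_on_has_derivative[OF _ Suc.prems(2)]\<close>)
qed (auto intro: continuous_intros)

lemma linear_basis_sum:
  fixes L :: "'e::euclidean_space \<Rightarrow> 'f::real_vector"
  assumes "linear L"
  shows "L v = (\<Sum>b\<in>Basis. (v \<bullet> b) *\<^sub>R L b)"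
  by (subst (1) euclidean_representation[symmetric])
    (simp add: linear_sum[OF assms] linear_cmul[OF assms])

text \<open>\<open>Ck_on\<close> only knows directional derivatives along fixed vectors, whereas the
  chain rule applies \<open>fderiv g (f x)\<close> to a vector that moves with \<open>x\<close>.
  Expanding that vector in the basis leaves sums of products of \<open>C^k\<close> functions, and
  the induction hypothesis applies to \<open>\<lambda>y. fderiv g y b\<close>.\<close>

lemma Ck_on_compose:
  fixes f :: "'e::real_normed_vector \<Rightarrow> 'f::euclidean_space" and g :: "'f \<Rightarrow> 'g::real_normed_vector"
  assumes "open S" "open T" "f ` S \<subseteq> T"
  shows "Ck_on k S f \<Longrightarrow> Ck_on k T g \<Longrightarrow> Ck_on k S (g \<circ> f)"
proof (induction k arbitrary: g)
  case 0 then show ?case using assms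
    by (metis Ck_on.simps(1) continuous_on_compose continuous_on_subset)
next
  case (Suc k)
  let ?D = "\<lambda>x v. \<Sum>b\<in>Basis. (fderiv f x v \<bullet> b) *\<^sub>R fderiv g (f x) b"
  have D: "(g \<circ> f has_derivative ?D x) (at x)" if "x \<in> S" for x
  proof -
    have g: "(g has_derivative fderiv g (f x)) (at (f x))"
      using assms that Ck_on_has_derivative[OF _ Suc.prems(2)] by blast
    have "(g \<circ> f has_derivative fderiv g (f x) \<circ> fderiv f x) (at x)"
      by (rule diff_chain_at[OF Ck_on_has_derivative[OF assms(1) Suc.prems(1) that] g])
    moreover have "fderiv g (f x) \<circ> fderiv f x = ?D x"
      unfolding o_def by (rule ext) (rule linear_basis_sum[OF has_derivative_linear[OF g]])
    ultimately show ?thesis by metis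
  qed
  have "Ck_on k S f" using Suc.prems assms Ck_on_SucD by blast
  then have "Ck_on k S ((\<lambda>y. fderiv g y b) \<circ> f)" for b
    using Suc.prems by (rule_tac Suc.IH) auto
  then show ?case
    using Suc.prems assms(1)
    by (intro Ck_on_SucI[OF _ D]) (auto intro!: Ck_on_sum Ck_on_scaleR Ck_on_inner_left simp: o_def)
qed

lemma smooth_onD: "smooth_on S f \<Longrightarrow> Ck_on k S f" by (simp add: smooth_on_def)

lemma smooth_on_compose:
  fixes f :: "'e::real_normed_vector \<Rightarrow> 'f::euclidean_space" and g :: "'f \<Rightarrow> 'g::real_normed_vector"
  assumes "open S" "open T" "f ` S \<subseteq> T" "smooth_on S f" "smooth_on T g"
  shows "smooth_on S (g \<circ> f)"
  unfolding smooth_on_def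
  by (intro allI Ck_on_compose[OF assms(1-3)] smooth_onD[OF assms(4)] smooth_onD[OF assms(5)])

lemma smooth_on_subset: "smooth_on S f \<Longrightarrow> T \<subseteq> S \<Longrightarrow> smooth_on T f"
  by (auto simp: smooth_on_def intro: Ck_on_subset)

lemma smooth_on_cong: "open S \<Longrightarrow> (\<And>x. x \<in> S \<Longrightarrow> f x = g x) \<Longrightarrow> smooth_on S f \<Longrightarrow> smooth_on S g"
  unfolding smooth_on_def using Ck_on_cong by blast

lemma smooth_on_local:
  assumes "open S" "\<And>x. x \<in> S \<Longrightarrow> \<exists>T. open T \<and> x \<in> T \<and> smooth_on (T \<inter> S) f"
  shows "smooth_on S f"
  using assms Ck_on_local[OF assms(1)] unfolding smooth_on_def by meson

lemma smooth_on_has_derivative: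
  "open S \<Longrightarrow> smooth_on S f \<Longrightarrow> x \<in> S \<Longrightarrow> (f has_derivative fderiv f x) (at x)"
  unfolding smooth_on_def using Ck_on_has_derivative by blast

lemma smooth_on_frechet: "smooth_on S f \<Longrightarrow> smooth_on S (\<lambda>x. fderiv f x v)"
  unfolding smooth_on_def by (metis Ck_on.simps(2))

lemma smooth_on_continuous: "smooth_on S f \<Longrightarrow> continuous_on S f"
  unfolding smooth_on_def by (metis Ck_on.simps(1))

lemma Ck_on_vector_derivative:
  assumes "open J" "\<And>t. t \<in> J \<Longrightarrow> (u has_vector_derivative u' t) (at t)" "Ck_on k J u'"
  shows "Ck_on (Suc k) J u"
  by (rule Ck_on_SucI[where f'="\<lambda>t v. v *\<^sub>R u' t"])
    (use assms in \<open>auto simp: has_vector_derivative_def intro!: Ck_on_scaleR Ck_on_const\<close>)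

lemma smooth_on_vector_derivative:
  assumes "open J" "smooth_on J u"
  shows "t \<in> J \<Longrightarrow> (u has_vector_derivative vderiv u t) (at t)"
    and "smooth_on J (\<lambda>t. vderiv u t)"
proof -
  have 1: "(u has_vector_derivative vderiv u t) (at t)" if "t \<in> J" for t
    using smooth_on_has_derivative[OF assms that] differentiableI vector_derivative_works by blast
  then show "t \<in> J \<Longrightarrow> (u has_vector_derivative vderiv u t) (at t)" .
  have 2: "fderiv u t 1 = vderiv u t" if "t \<in> J" for t
    using frechet_derivative_at[OF 1[OF that, unfolded has_vector_derivative_def]] by (metis scaleR_one)
  show "smooth_on J (\<lambda>t. vderiv u t)"
    by (rule smooth_on_cong[OF assms(1) 2 smooth_on_frechet[OF assms(2), of 1]])
qed

section \<open>Symmetry of second derivatives\<close>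

text \<open>Both mixed partial derivatives are limits of the same second difference quotient.\<close>

lemma second_difference_mean_value:
  fixes f :: "'e::real_normed_vector \<Rightarrow> real"
  assumes S: "open S" and f: "Ck_on (Suc (Suc 0)) S f"
    and s: "0 < s" and in_S: "\<And>p q. 0 \<le> p \<Longrightarrow> p \<le> s \<Longrightarrow> 0 \<le> q \<Longrightarrow> q \<le> s \<Longrightarrow> x + p *\<^sub>R a + q *\<^sub>R b \<in> S"
  shows "\<exists>p q. 0 < p \<and> p < s \<and> 0 < q \<and> q < s \<and>
    f (x + s *\<^sub>R a + s *\<^sub>R b) - f (x + s *\<^sub>R a) - f (x + s *\<^sub>R b) + f x =
    s\<^sup>2 * fderiv (\<lambda>y. fderiv f y a) (x + p *\<^sub>R a + q *\<^sub>R b) b"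
proof -
  let ?A = "\<lambda>y. fderiv f y a"
  have A: "Ck_on (Suc 0) S ?A" using f by simp
  \<comment> \<open>The second difference is \<open>h s - h 0\<close>; the mean value theorem in the
    direction \<open>a\<close>, then in the direction \<open>b\<close>, produces \<open>p\<close>
    and \<open>q\<close>.\<close>
  define h where "h p = f (x + p *\<^sub>R a + s *\<^sub>R b) - f (x + p *\<^sub>R a)" for p
  have h': "(h has_real_derivative ?A (x + p *\<^sub>R a + s *\<^sub>R b) - ?A (x + p *\<^sub>R a)) (at p)"
    if "0 \<le> p" "p \<le> s" for p
  proof -
    have 1: "x + p *\<^sub>R a + s *\<^sub>R b \<in> S" "x + p *\<^sub>R a \<in> S"
      using in_S[of p s] in_S[of p 0] that s by auto
    have d: "((\<lambda>p. f (x + p *\<^sub>R a + c)) has_derivative (\<lambda>h. fderiv f (x + p *\<^sub>R a + c) (h *\<^sub>R a))) (at p)"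
      if "x + p *\<^sub>R a + c \<in> S" for c
      by (rule has_derivative_compose[where f="\<lambda>p. x + p *\<^sub>R a + c" and g=f, OF _ Ck_on_has_derivative[OF S f that]])
        (auto intro!: derivative_eq_intros)
    have l: "fderiv f z (r *\<^sub>R a) = ?A z * r" if "z \<in> S" for z r
      using linear_cmul[OF has_derivative_linear[OF Ck_on_has_derivative[OF S f that]]] by simp
    show ?thesis unfolding has_field_derivative_def h_def
      by (rule has_derivative_eq_rhs, rule has_derivative_diff[OF d[OF 1(1)] d[of 0, simplified]])
        (use 1 in \<open>auto simp: l left_diff_distrib\<close>)
  qed
  obtain p where p: "0 < p" "p < s" "h s - h 0 = (s - 0) * (?A (x + p *\<^sub>R a + s *\<^sub>R b) - ?A (x + p *\<^sub>R a))"
    using MVT2[OF s, of h "\<lambda>p. ?A (x + p *\<^sub>R a + s *\<^sub>R b) - ?A (x + p *\<^sub>R a)", OF h'] by auto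
  define k where "k q = ?A (x + p *\<^sub>R a + q *\<^sub>R b)" for q
  have k': "(k has_real_derivative fderiv ?A (x + p *\<^sub>R a + q *\<^sub>R b) b) (at q)"
    if "0 \<le> q" "q \<le> s" for q
  proof -
    have 1: "x + p *\<^sub>R a + q *\<^sub>R b \<in> S" using in_S that p by auto
    have d: "(k has_derivative (\<lambda>h. fderiv ?A (x + p *\<^sub>R a + q *\<^sub>R b) (h *\<^sub>R b))) (at q)"
      unfolding k_def by (rule has_derivative_compose[where f="\<lambda>q. x + p *\<^sub>R a + q *\<^sub>R b" and g="?A", OF _ Ck_on_has_derivative[OF S A 1]])
        (auto intro!: derivative_eq_intros)
    have "fderiv ?A (x + p *\<^sub>R a + q *\<^sub>R b) (r *\<^sub>R b) = fderiv ?A (x + p *\<^sub>R a + q *\<^sub>R b) b * r" for r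
      using linear_cmul[OF has_derivative_linear[OF Ck_on_has_derivative[OF S A 1]]] by simp
    then show ?thesis using d unfolding has_field_derivative_def by simp
  qed
  obtain q where q: "0 < q" "q < s" "k s - k 0 = (s - 0) * fderiv ?A (x + p *\<^sub>R a + q *\<^sub>R b) b"
    using MVT2[OF s, of k "\<lambda>q. fderiv ?A (x + p *\<^sub>R a + q *\<^sub>R b) b", OF k'] by auto
  show ?thesis
    using p q by (intro exI[of _ p] exI[of _ q]) (auto simp: h_def k_def power2_eq_square algebra_simps)
qed

lemma mixed_derivatives_commute_real:
  fixes f :: "'e::real_normed_vector \<Rightarrow> real"
  assumes S: "open S" and f: "Ck_on (Suc (Suc 0)) S f" and x: "x \<in> S"
  shows "fderiv (\<lambda>y. fderiv f y a) x b =
    fderiv (\<lambda>y. fderiv f y b) x a"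
proof -
  let ?D = "\<lambda>a b y. fderiv (\<lambda>y. fderiv f y a) y b"
  have cont: "isCont (?D a b) x" for a b
    using f S x continuous_on_eq_continuous_at by (metis Ck_on.simps)
  have close: "\<exists>r>0. \<forall>p q. \<bar>p\<bar> < r \<longrightarrow> \<bar>q\<bar> < r \<longrightarrow> x + p *\<^sub>R a + q *\<^sub>R b \<in> S \<and>
      \<bar>?D a b (x + p *\<^sub>R a + q *\<^sub>R b) - ?D a b x\<bar> < e" if e: "e > 0" for a b and e :: real
  proof -
    obtain d where d: "d > 0" "\<And>y. dist y x < d \<Longrightarrow> \<bar>?D a b y - ?D a b x\<bar> < e"
      using cont[of a b, unfolded continuous_at_eps_delta dist_real_def] e by meson
    obtain d' where d': "d' > 0" "ball x d' \<subseteq> S" using S x openE by blast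
    define m where "m = min d d'"
    \<comment> \<open>Gives \<open>\<bar>p\<bar> * norm a + \<bar>q\<bar> * norm b < m\<close>; the
      summand 1 keeps the denominator positive when \<open>a\<close> and \<open>b\<close>
      vanish.\<close>
    define r where "r = m / (norm a + norm b + 1)"
    have n: "norm a + norm b + 1 > 0" by (smt (verit) norm_ge_zero)
    have m: "m > 0" using d d' by (simp add: m_def)
    have "dist (x + p *\<^sub>R a + q *\<^sub>R b) x < m" if "\<bar>p\<bar> < r" "\<bar>q\<bar> < r" for p q
    proof -
      have "dist (x + p *\<^sub>R a + q *\<^sub>R b) x \<le> \<bar>p\<bar> * norm a + \<bar>q\<bar> * norm b"
        unfolding dist_norm using norm_triangle_ineq[of "p *\<^sub>R a" "q *\<^sub>R b"] by (simp add: algebra_simps)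
      also have "\<dots> \<le> r * norm a + r * norm b"
        using that by (intro add_mono mult_right_mono) auto
      also have "\<dots> < r * (norm a + norm b + 1)"
        using that by (simp add: algebra_simps)
      also have "\<dots> = m" using n by (simp add: r_def)
      finally show ?thesis .
    qed
    moreover have "r > 0" using m n by (simp add: r_def)
    ultimately show ?thesis using d(2) d'(2)
      by (intro exI[of _ r]) (auto simp: m_def dist_commute subset_eq)
  qed
  have "\<bar>?D a b x - ?D b a x\<bar> < 2 * e" if e: "e > 0" for e
  proof -
    obtain r1 where r1: "r1 > 0" "\<And>p q. \<bar>p\<bar> < r1 \<Longrightarrow> \<bar>q\<bar> < r1 \<Longrightarrow> x + p *\<^sub>R a + q *\<^sub>R b \<in> S \<and>
      \<bar>?D a b (x + p *\<^sub>R a + q *\<^sub>R b) - ?D a b x\<bar> < e" using close[OF e, of a b] by blast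
    obtain r2 where r2: "r2 > 0" "\<And>p q. \<bar>p\<bar> < r2 \<Longrightarrow> \<bar>q\<bar> < r2 \<Longrightarrow> x + p *\<^sub>R b + q *\<^sub>R a \<in> S \<and>
      \<bar>?D b a (x + p *\<^sub>R b + q *\<^sub>R a) - ?D b a x\<bar> < e" using close[OF e, of b a] by blast
    \<comment> \<open>Half the minimum, so that even the corner \<open>p = q = s\<close> lies
      strictly inside both neighbourhoods.\<close>
    define s where "s = min r1 r2 / 2"
    have s: "s > 0" "s < r1" "s < r2" using r1(1) r2(1) by (auto simp: s_def min_def)
    obtain p q where pq: "0 < p" "p < s" "0 < q" "q < s" "f (x + s *\<^sub>R a + s *\<^sub>R b) - f (x + s *\<^sub>R a) - f (x + s *\<^sub>R b) + f x =
      s\<^sup>2 * ?D a b (x + p *\<^sub>R a + q *\<^sub>R b)"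
      using second_difference_mean_value[OF S f s(1), of x a b] r1(2) s by auto
    obtain p' q' where pq': "0 < p'" "p' < s" "0 < q'" "q' < s" "f (x + s *\<^sub>R b + s *\<^sub>R a) - f (x + s *\<^sub>R b) - f (x + s *\<^sub>R a) + f x =
      s\<^sup>2 * ?D b a (x + p' *\<^sub>R b + q' *\<^sub>R a)"
      using second_difference_mean_value[OF S f s(1), of x b a] r2(2) s by auto
    have "x + s *\<^sub>R b + s *\<^sub>R a = x + s *\<^sub>R a + s *\<^sub>R b" by simp
    with pq(5) pq'(5) have "s\<^sup>2 * ?D a b (x + p *\<^sub>R a + q *\<^sub>R b) = s\<^sup>2 * ?D b a (x + p' *\<^sub>R b + q' *\<^sub>R a)"
      by (simp add: algebra_simps)
    then have "?D a b (x + p *\<^sub>R a + q *\<^sub>R b) = ?D b a (x + p' *\<^sub>R b + q' *\<^sub>R a)" using s(1) by simp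
    moreover have "\<bar>?D a b (x + p *\<^sub>R a + q *\<^sub>R b) - ?D a b x\<bar> < e" using r1(2)[of p q] pq s by simp
    moreover have "\<bar>?D b a (x + p' *\<^sub>R b + q' *\<^sub>R a) - ?D b a x\<bar> < e" using r2(2)[of p' q'] pq' s by simp
    ultimately show ?thesis by linarith
  qed
  from this[of "\<bar>?D a b x - ?D b a x\<bar> / 2"] show ?thesis by fastforce
qed

lemma mixed_derivatives_commute:
  fixes f :: "'e::real_normed_vector \<Rightarrow> 'f::euclidean_space"
  assumes S: "open S" and f: "Ck_on (Suc (Suc 0)) S f" and x: "x \<in> S"
  shows "fderiv (\<lambda>y. fderiv f y a) x b =
    fderiv (\<lambda>y. fderiv f y b) x a"
proof (rule euclidean_eqI)
  fix i :: 'f assume "i \<in> Basis"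
  have inner: "fderiv (\<lambda>y. g y \<bullet> i) y v = fderiv g y v \<bullet> i"
    if "Ck_on (Suc 0) S g" "y \<in> S" for g :: "'e \<Rightarrow> 'f" and y v
    using frechet_derivative_at[OF bounded_linear.has_derivative[OF bounded_linear_inner_left
        Ck_on_has_derivative[OF S that]], of i] by metis
  have f1: "Ck_on (Suc 0) S f" using f S Ck_on_SucD by blast
  have 2: "fderiv (\<lambda>y. fderiv (\<lambda>y. f y \<bullet> i) y a) x b
      = fderiv (\<lambda>y. fderiv f y a) x b \<bullet> i" for a b
  proof -
    have "fderiv (\<lambda>y. fderiv (\<lambda>y. f y \<bullet> i) y a) x
      = fderiv (\<lambda>y. fderiv f y a \<bullet> i) x"
      by (rule frechet_derivative_cong[OF S x]) (simp add: inner[OF f1])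
    then show ?thesis using inner[OF _ x, of "\<lambda>y. fderiv f y a"] f by simp
  qed
  show "fderiv (\<lambda>y. fderiv f y a) x b \<bullet> i =
    fderiv (\<lambda>y. fderiv f y b) x a \<bullet> i"
    using mixed_derivatives_commute_real[OF S Ck_on_inner_left[OF S f] x, of i a b] unfolding 2 .
qed

section \<open>Linear systems with coefficients depending on a parameter\<close>

lemma linear_family_diff_bound:
  fixes G H :: "'e::euclidean_space \<Rightarrow> 'f::real_normed_vector"
  assumes "linear G" "linear H"
  shows "norm (G a - H a) \<le> norm a * (\<Sum>b\<in>Basis. norm (G b - H b))"
proof -
  have "G a - H a = (\<Sum>b\<in>Basis. (a \<bullet> b) *\<^sub>R (G b - H b))"
    by (subst linear_basis_sum[OF linear_compose_sub[OF assms], of a]) simp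
  also have "norm \<dots> \<le> (\<Sum>b\<in>Basis. norm a * norm (G b - H b))"
    by (rule sum_norm_le) (auto intro!: mult_right_mono simp: Basis_le_norm)
  finally show ?thesis by (simp add: sum_distrib_left)
qed

text \<open>An injective linear map satisfies \<open>B * norm a \<le> norm (G x a)\<close> with
  \<open>B > 0\<close>; a perturbation that changes the basis values by less than
  \<open>B / 2\<close> in total leaves the constant \<open>B / 2\<close>. This takes the place of
  continuity of the inverse matrix.\<close>

lemma eventually_bounded_below:
  fixes G :: "'x::real_normed_vector \<Rightarrow> 'e::euclidean_space \<Rightarrow> 'e"
  assumes S: "open S" and lin: "\<And>x. x \<in> S \<Longrightarrow> linear (G x)" and inj: "\<And>x. x \<in> S \<Longrightarrow> inj (G x)"
    and cont: "\<And>b. b \<in> Basis \<Longrightarrow> continuous_on S (\<lambda>x. G x b)" and x: "x \<in> S"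
  shows "\<exists>m>0. \<exists>d>0. \<forall>y. dist y x < d \<longrightarrow> y \<in> S \<and> (\<forall>a. m * norm a \<le> norm (G y a))"
proof -
  obtain B where B: "B > 0" "\<And>a. B * norm a \<le> norm (G x a)"
    using linear_inj_bounded_below_pos[OF lin[OF x] inj[OF x]] by blast
  have c: "isCont (\<lambda>y. G y b) x" if "b \<in> Basis" for b
    using cont[OF that] S x continuous_on_eq_continuous_at by blast
  have "((\<lambda>y. \<Sum>b\<in>Basis. norm (G y b - G x b)) \<longlongrightarrow> (\<Sum>b\<in>Basis. norm (G x b - G x b))) (at x)"
    using c by (intro tendsto_intros) (auto simp: isCont_def)
  then have "\<forall>\<^sub>F y in at x. (\<Sum>b\<in>Basis. norm (G y b - G x b)) < B / 2"
    using B(1) by (intro order_tendstoD) auto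
  then obtain d where d: "d > 0" "\<And>y. y \<noteq> x \<Longrightarrow> dist y x < d \<Longrightarrow> (\<Sum>b\<in>Basis. norm (G y b - G x b)) < B / 2"
    unfolding eventually_at by auto
  obtain e where e: "e > 0" "ball x e \<subseteq> S" using S x openE by blast
  have "B / 2 * norm a \<le> norm (G y a)" if y: "dist y x < min d e" for y a
  proof -
    have "y \<in> S" using y e(2) by (auto simp: dist_commute subset_eq)
    then have "norm (G y a - G x a) \<le> norm a * (\<Sum>b\<in>Basis. norm (G y b - G x b))"
      using linear_family_diff_bound lin x by blast
    also have "\<dots> \<le> norm a * (B / 2)"
    proof (rule mult_left_mono)
      show "(\<Sum>b\<in>Basis. norm (G y b - G x b)) \<le> B / 2"
        using d(2)[of y] y B(1) by (cases "y = x") auto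
    qed simp
    finally show ?thesis using B(2)[of a] norm_triangle_ineq2[of "G x a" "G y a"]
      by (simp add: norm_minus_commute field_simps)
  qed
  then show ?thesis using B(1) d(1) e
    by (intro exI[of _ "B/2"] conjI exI[of _ "min d e"]) (auto simp: dist_commute subset_eq)
qed

text \<open>By linearity \<open>G y (z y - z x) = r y - G y (z x)\<close>, and the right-hand side
  tends to 0 as \<open>y\<close> tends to \<open>x\<close>; the uniform lower bound on
  \<open>G y\<close> passes this on to \<open>z y - z x\<close>.\<close>

lemma continuous_on_linear_solve:
  fixes G :: "'x::real_normed_vector \<Rightarrow> 'e::euclidean_space \<Rightarrow> 'e"
  assumes S: "open S" and lin: "\<And>x. x \<in> S \<Longrightarrow> linear (G x)" and inj: "\<And>x. x \<in> S \<Longrightarrow> inj (G x)"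
    and cont: "\<And>b. b \<in> Basis \<Longrightarrow> continuous_on S (\<lambda>x. G x b)" and r: "continuous_on S r"
    and z: "\<And>x. x \<in> S \<Longrightarrow> G x (z x) = r x"
  shows "continuous_on S z"
proof (rule continuous_at_imp_continuous_on, rule ballI)
  fix x assume x: "x \<in> S"
  obtain m d where m: "m > 0" "d > 0" "\<And>y. dist y x < d \<Longrightarrow> y \<in> S"
      "\<And>y a. dist y x < d \<Longrightarrow> m * norm a \<le> norm (G y a)"
    using eventually_bounded_below[OF S lin inj cont x] by blast
  \<comment> \<open>Expanded in the basis because continuity of \<open>G\<close> is assumed only for
    its values on basis vectors.\<close>
  define h where "h y = r y - (\<Sum>b\<in>Basis. (z x \<bullet> b) *\<^sub>R G y b)" for y
  have h: "h y = r y - G y (z x)" if "y \<in> S" for y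
    using linear_basis_sum[OF lin[OF that], of "z x"] by (simp add: h_def)
  have "isCont (\<lambda>y. G y b) x" if "b \<in> Basis" for b
    using cont that S x continuous_on_eq_continuous_at by blast
  moreover have "isCont r x" using r S x continuous_on_eq_continuous_at by blast
  ultimately have "isCont h x" unfolding h_def by (intro continuous_intros) auto
  then have h0: "(h \<longlongrightarrow> 0) (at x)" using h[OF x] z[OF x] by (simp add: isCont_def)
  have "((\<lambda>y. z y - z x) \<longlongrightarrow> 0) (at x)"
  proof (rule Lim_null_comparison[where g="\<lambda>y. norm (h y) / m"])
    show "((\<lambda>y. norm (h y) / m) \<longlongrightarrow> 0) (at x)"
      using tendsto_divide[OF tendsto_norm[OF h0] tendsto_const[of m]] m(1) by simp
    show "\<forall>\<^sub>F y in at x. norm (z y - z x) \<le> norm (h y) / m"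
      unfolding eventually_at
    proof (intro exI[of _ d] conjI ballI impI)
      fix y assume y: "y \<noteq> x \<and> dist y x < d"
      then have yS: "y \<in> S" using m(3) by blast
      have "m * norm (z y - z x) \<le> norm (G y (z y - z x))" using m(4) y by blast
      also have "G y (z y - z x) = h y" using h[OF yS] z[OF yS] linear_diff[OF lin[OF yS]] by simp
      finally show "norm (z y - z x) \<le> norm (h y) / m" using m(1) by (simp add: field_simps)
    qed (use m in auto)
  qed
  then show "isCont z x" unfolding isCont_def using LIM_zero_iff by blast
qed

text \<open>
  Implicit differentiation: a solution of a linear system with \<open>C\<^sup>k\<close> coefficients satisfies, for its
  directional derivatives, a system with the same matrix.
\<close>

lemma linear_solve_has_derivative:
  fixes G :: "'x::euclidean_space \<Rightarrow> 'e::euclidean_space \<Rightarrow> 'e"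
  assumes S: "open S" and lin: "\<And>x. x \<in> S \<Longrightarrow> linear (G x)" and inj: "\<And>x. x \<in> S \<Longrightarrow> inj (G x)"
    and G': "\<And>b. b \<in> Basis \<Longrightarrow> ((\<lambda>x. G x b) has_derivative G' b) (at x)"
    and r': "(r has_derivative r') (at x)"
    and cont: "\<And>b. b \<in> Basis \<Longrightarrow> continuous_on S (\<lambda>x. G x b)"
    and z: "\<And>x. x \<in> S \<Longrightarrow> G x (z x) = r x" and x: "x \<in> S"
    and z': "\<And>v. G x (z' v) = r' v - (\<Sum>b\<in>Basis. (z x \<bullet> b) *\<^sub>R G' b v)"
  shows "(z has_derivative z') (at x)"
proof -
  obtain m d where m: "m > 0" "d > 0" "\<And>y. dist y x < d \<Longrightarrow> y \<in> S"
      "\<And>y a. dist y x < d \<Longrightarrow> m * norm a \<le> norm (G y a)"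
    using eventually_bounded_below[OF S lin inj cont x] by blast
  define q where "q y = r y - (\<Sum>b\<in>Basis. (z x \<bullet> b) *\<^sub>R G y b)" for y
  have q: "q y = r y - G y (z x)" if "y \<in> S" for y
    using linear_basis_sum[OF lin[OF that], of "z x"] by (simp add: q_def)
  have q': "(q has_derivative (\<lambda>v. G x (z' v))) (at x)"
    unfolding q_def z' by (intro derivative_intros r' G')
  have q'lin: "linear (\<lambda>v. G x (z' v))" using has_derivative_linear[OF q'] .
  have "linear z'"
  proof (rule linearI)
    show "z' (u + v) = z' u + z' v" for u v
      using inj[OF x] linear_add[OF q'lin] linear_add[OF lin[OF x]] by (metis injD)
    show "z' (c *\<^sub>R v) = c *\<^sub>R z' v" for c v
      using inj[OF x] linear_cmul[OF q'lin] linear_cmul[OF lin[OF x]] by (metis injD)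
  qed
  then have bl: "bounded_linear z'" by (simp add: linear_conv_bounded_linear)
  then obtain C where C: "C > 0" "\<And>v. norm (z' v) \<le> norm v * C" using bounded_linear.pos_bounded by blast
  \<comment> \<open>The two summands are the differentiability error of \<open>q\<close>, small
    compared with \<open>norm (y - x)\<close>, and the effect of replacing \<open>G x\<close> by
    \<open>G y\<close> on \<open>z' (y - x)\<close>.\<close>
  define H where "H y = (norm (q y - q x - G x (z' (y - x))) / norm (y - x) +
      C * (\<Sum>b\<in>Basis. norm (G y b - G x b))) / m" for y
  show ?thesis
  proof (rule has_derivativeI_sandwich[OF m(2) bl, where H=H])
    fix y assume y: "y \<noteq> x" "dist y x < d"
    then have yS: "y \<in> S" using m(3) by blast
    let ?h = "y - x"
    have "m * norm (z y - z x - z' ?h) \<le> norm (G y (z y - z x - z' ?h))" using m(4) y by blast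
    also have "G y (z y - z x - z' ?h) = (q y - q x - G x (z' ?h)) - (G y (z' ?h) - G x (z' ?h))"
      using q[OF yS] q[OF x] z[OF yS] z[OF x] linear_diff[OF lin[OF yS]] by simp
    also have "norm \<dots> \<le> norm (q y - q x - G x (z' ?h)) + norm (G y (z' ?h) - G x (z' ?h))"
      by (rule norm_triangle_ineq4)
    also have "norm (G y (z' ?h) - G x (z' ?h)) \<le> norm (z' ?h) * (\<Sum>b\<in>Basis. norm (G y b - G x b))"
      using linear_family_diff_bound[OF lin[OF yS] lin[OF x]] .
    also have "\<dots> \<le> (norm ?h * C) * (\<Sum>b\<in>Basis. norm (G y b - G x b))"
      by (intro mult_right_mono C sum_nonneg) auto
    finally have "m * norm (z y - z x - z' ?h) \<le> norm (q y - q x - G x (z' ?h)) +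
       (norm ?h * C) * (\<Sum>b\<in>Basis. norm (G y b - G x b))" by simp
    then have "norm (z y - z x - z' ?h) \<le> (norm (q y - q x - G x (z' ?h)) +
       (norm ?h * C) * (\<Sum>b\<in>Basis. norm (G y b - G x b))) / m"
      using m(1) by (simp add: field_simps)
    then have "norm (z y - z x - z' ?h) / norm ?h \<le> (norm (q y - q x - G x (z' ?h)) +
       (norm ?h * C) * (\<Sum>b\<in>Basis. norm (G y b - G x b))) / m / norm ?h"
      by (rule divide_right_mono) simp
    also have "\<dots> = H y" using y(1) m(1) by (simp add: H_def field_simps)
    finally show "norm (z y - z x - z' ?h) / norm ?h \<le> H y" .
  next
    have "isCont (\<lambda>y. G y b) x" if "b \<in> Basis" for b
      using cont[OF that] S x continuous_on_eq_continuous_at by blast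
    then have "((\<lambda>y. \<Sum>b\<in>Basis. norm (G y b - G x b)) \<longlongrightarrow> (\<Sum>b\<in>Basis. norm (G x b - G x b))) (at x)"
      by (intro tendsto_intros) (auto simp: isCont_def)
    note tendsto_mult[OF tendsto_const[of C] this]
    moreover have "((\<lambda>y. norm (q y - q x - G x (z' (y - x))) / norm (y - x)) \<longlongrightarrow> 0) (at x)"
      using q' unfolding has_derivative_iff_norm by blast
    ultimately have "(H \<longlongrightarrow> (0 + C * (\<Sum>b\<in>Basis. norm (G x b - G x b))) / m) (at x)"
      unfolding H_def using m(1) by (intro tendsto_divide tendsto_add tendsto_const) auto
    then show "(H \<longlongrightarrow> 0) (at x)" by simp
  qed
qed

text \<open>Induction on \<open>k\<close> with \<open>r\<close> and \<open>z\<close> arbitrary. The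
  right-hand side for the derivative contains \<open>z\<close> itself, so the induction hypothesis
  is used twice: for the given system, to see that \<open>z\<close> is \<open>C^k\<close>, and for
  the differentiated one.\<close>

lemma Ck_on_linear_solve:
  fixes G :: "'x::euclidean_space \<Rightarrow> 'e::euclidean_space \<Rightarrow> 'e"
  assumes S: "open S" and lin: "\<And>x. x \<in> S \<Longrightarrow> linear (G x)" and inj: "\<And>x. x \<in> S \<Longrightarrow> inj (G x)"
  shows "(\<And>b. b \<in> Basis \<Longrightarrow> Ck_on k S (\<lambda>x. G x b)) \<Longrightarrow> Ck_on k S r \<Longrightarrow>
    (\<And>x. x \<in> S \<Longrightarrow> G x (z x) = r x) \<Longrightarrow> Ck_on k S z"
proof (induction k arbitrary: r z)
  case 0
  then show ?case using continuous_on_linear_solve[OF S lin inj] by simp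
next
  case (Suc k)
  let ?G' = "\<lambda>x b. fderiv (\<lambda>y. G y b) x"
  let ?r' = "\<lambda>x v. fderiv r x v - (\<Sum>b\<in>Basis. (z x \<bullet> b) *\<^sub>R ?G' x b v)"
  \<comment> \<open>An injective endomorphism in finite dimension is onto, so
    \<open>inv (G x)\<close> solves the differentiated system.\<close>
  define z' where "z' x v = inv (G x) (?r' x v)" for x v
  have z': "G x (z' x v) = ?r' x v" if "x \<in> S" for x v
    unfolding z'_def using linear_inj_imp_surj[OF lin[OF that] inj[OF that]]
    by (auto simp: surj_f_inv_f)
  have G0: "Ck_on k S (\<lambda>x. G x b)" if "b \<in> Basis" for b
    using Ck_on_SucD[OF S Suc.prems(1)[OF that]] .
  have z0: "Ck_on k S z" by (rule Suc.IH[OF G0 Ck_on_SucD[OF S Suc.prems(2)] Suc.prems(3)])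
  show ?case
  proof (rule Ck_on_SucI[OF S])
    show "(z has_derivative z' x) (at x)" if x: "x \<in> S" for x
      by (rule linear_solve_has_derivative[where G=G and r=r and z=z and z'="z' x", OF S lin inj _ _ _ Suc.prems(3) x z'[OF x]])
        (auto intro!: Ck_on_has_derivative[OF S _ x] Suc.prems(2) Suc.prems(1) Ck_on_continuous[OF S])
    show "Ck_on k S (\<lambda>x. z' x v)" for v
    proof (rule Suc.IH[OF G0, of "\<lambda>x. ?r' x v"])
      show "Ck_on k S (\<lambda>x. ?r' x v)"
        using Suc.prems(1,2) z0
        by (intro Ck_on_diff Ck_on_sum Ck_on_scaleR Ck_on_inner_left S) auto
    qed (use z' in auto)
  qed
qed

section \<open>Ordinary differential equations\<close>

text \<open>On a compact ball the finitely many \<open>fderiv F y b\<close> are bounded, and the sum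
  of their bounds bounds the operator norm of the derivative; the mean value inequality on the
  convex ball does the rest.\<close>

lemma C1_locally_lipschitz:
  fixes F :: "'v::euclidean_space \<Rightarrow> 'w::real_normed_vector"
  assumes S: "open S" and F: "Ck_on (Suc 0) S F" and x: "x \<in> S"
  shows "\<exists>r>0. \<exists>L\<ge>0. cball x r \<subseteq> S \<and> (\<forall>y\<in>cball x r. \<forall>z\<in>cball x r. norm (F y - F z) \<le> L * norm (y - z))"
proof -
  obtain r where r: "r > 0" "cball x r \<subseteq> S" using S x open_contains_cball by blast
  have "\<exists>B. \<forall>y\<in>cball x r. norm (fderiv F y b) \<le> B" for b
  proof -
    have "continuous_on (cball x r) (\<lambda>y. fderiv F y b)"
      by (rule continuous_on_subset[OF _ r(2)]) (use F in simp)
    then have "bounded ((\<lambda>y. fderiv F y b) ` cball x r)"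
      using compact_continuous_image compact_imp_bounded compact_cball by blast
    then show ?thesis unfolding bounded_iff by blast
  qed
  then obtain B where B: "\<And>b y. y \<in> cball x r \<Longrightarrow> norm (fderiv F y b) \<le> B b" by metis
  define L where "L = (\<Sum>b\<in>Basis. B b)"
  have D: "(F has_derivative fderiv F y) (at y)" if "y \<in> cball x r" for y
    using Ck_on_has_derivative[OF S F] r that by blast
  have on: "onorm (fderiv F y) \<le> L" if y: "y \<in> cball x r" for y
  proof (rule onorm_le)
    fix v
    have "fderiv F y v = (\<Sum>b\<in>Basis. (v \<bullet> b) *\<^sub>R fderiv F y b)"
      by (rule linear_basis_sum[OF has_derivative_linear[OF D[OF y]]])
    also have "norm \<dots> \<le> (\<Sum>b\<in>Basis. B b * norm v)"
    proof (rule sum_norm_le)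
      fix b :: 'v assume "b \<in> Basis"
      then have "\<bar>v \<bullet> b\<bar> * norm (fderiv F y b) \<le> norm v * B b"
        using B[OF y, of b] Basis_le_norm by (intro mult_mono) auto
      then show "norm ((v \<bullet> b) *\<^sub>R fderiv F y b) \<le> B b * norm v"
        by (simp add: mult.commute)
    qed
    finally show "norm (fderiv F y v) \<le> L * norm v"
      by (simp add: L_def sum_distrib_right)
  qed
  have "0 \<le> L" using on[of x] r(1) D[of x] onorm_pos_le[of "fderiv F x"]
    by (simp add: has_derivative_bounded_linear)
  moreover have "norm (F y - F z) \<le> L * norm (y - z)" if "y \<in> cball x r" "z \<in> cball x r" for y z
    by (rule differentiable_bound[OF convex_cball _ on that]) (rule has_derivative_at_withinI[OF D])
  ultimately show ?thesis using r by blast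
qed

lemma vector_derivative_bound:
  fixes h :: "real \<Rightarrow> 'v::real_normed_vector"
  assumes "convex I" "\<And>s. s \<in> I \<Longrightarrow> (h has_vector_derivative h' s) (at s within I)"
    and "\<And>s. s \<in> I \<Longrightarrow> norm (h' s) \<le> B" and "s \<in> I" "t \<in> I"
  shows "norm (h s - h t) \<le> B * \<bar>s - t\<bar>"
proof -
  have "norm (h s - h t) \<le> B * norm (s - t)"
    by (rule differentiable_bound[OF assms(1) assms(2)[unfolded has_vector_derivative_def] _ assms(4,5)])
      (auto intro!: onorm_le simp: mult.commute[of B] assms(3) mult_left_mono)
  then show ?thesis by simp
qed

text \<open>A Gronwall estimate for short times: where the distance attains its maximum
  \<open>?M\<close>, the mean value inequality gives
  \<open>?M \<le> norm (u t0 - w t0) + ?M / 2\<close>.\<close>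

lemma solutions_lipschitz:
  fixes F :: "'v::real_normed_vector \<Rightarrow> 'v"
  assumes L: "\<And>x y. x \<in> K \<Longrightarrow> y \<in> K \<Longrightarrow> norm (F x - F y) \<le> L * norm (x - y)" "0 \<le> L"
    and u: "\<And>s. s \<in> closed_segment t0 t \<Longrightarrow> (u has_vector_derivative F (u s)) (at s) \<and> u s \<in> K"
    and w: "\<And>s. s \<in> closed_segment t0 t \<Longrightarrow> (w has_vector_derivative F (w s)) (at s) \<and> w s \<in> K"
    and t: "L * \<bar>t - t0\<bar> \<le> 1/2"
  shows "norm (u t - w t) \<le> 2 * norm (u t0 - w t0)"
proof -
  let ?I = "closed_segment t0 t"
  let ?h = "\<lambda>s. u s - w s"
  have der: "(?h has_vector_derivative F (u s) - F (w s)) (at s)" if "s \<in> ?I" for s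
    using u[OF that] w[OF that] by (auto intro: has_vector_derivative_diff)
  have "continuous_on ?I (\<lambda>s. norm (?h s))"
    by (intro continuous_on_norm continuous_at_imp_continuous_on ballI)
      (use der has_vector_derivative_continuous in blast)
  then obtain s where s: "s \<in> ?I" "\<And>r. r \<in> ?I \<Longrightarrow> norm (?h r) \<le> norm (?h s)"
    using continuous_attains_sup[of ?I] compact_segment by fastforce
  let ?M = "norm (?h s)"
  have b: "norm (F (u r) - F (w r)) \<le> L * ?M" if "r \<in> ?I" for r
    using L(1)[of "u r" "w r"] u[OF that] w[OF that] mult_left_mono[OF s(2)[OF that] L(2)] by force
  have "norm (?h s - ?h t0) \<le> (L * ?M) * \<bar>s - t0\<bar>"
    by (rule vector_derivative_bound[OF convex_closed_segment _ b s(1)])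
      (auto intro: has_vector_derivative_at_within der)
  also have "\<dots> = ?M * (L * \<bar>s - t0\<bar>)" by simp
  also have "\<dots> \<le> ?M * (1/2)"
  proof (rule mult_left_mono)
    have "\<bar>s - t0\<bar> \<le> \<bar>t - t0\<bar>" using s(1) by (auto simp: closed_segment_eq_real_ivl split: if_splits)
    then show "L * \<bar>s - t0\<bar> \<le> 1/2" using mult_left_mono[OF _ L(2)] t by fastforce
  qed simp
  finally have "?M \<le> 2 * norm (?h t0)" using norm_triangle_ineq2[of "?h s" "?h t0"] by simp
  then show ?thesis using s(2)[of t] by simp
qed

lemma ode_unique_local:
  fixes F :: "'v::euclidean_space \<Rightarrow> 'v"
  assumes "open \<Omega>" "Ck_on (Suc 0) \<Omega> F" "open J" "t0 \<in> J"
    and u: "\<And>s. s \<in> J \<Longrightarrow> (u has_vector_derivative F (u s)) (at s)"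
    and w: "\<And>s. s \<in> J \<Longrightarrow> (w has_vector_derivative F (w s)) (at s)"
    and eq: "u t0 = w t0" and mem: "u t0 \<in> \<Omega>"
  shows "\<exists>e>0. \<forall>t. \<bar>t - t0\<bar> < e \<longrightarrow> u t = w t"
proof -
  obtain r L where r: "r > 0" "L \<ge> 0" and
      L: "\<And>x y. x \<in> cball (u t0) r \<Longrightarrow> y \<in> cball (u t0) r \<Longrightarrow> norm (F x - F y) \<le> L * norm (x - y)"
    using C1_locally_lipschitz[OF assms(1,2) mem] by meson
  have cont: "isCont u t0" "isCont w t0" using u w assms(4) has_vector_derivative_continuous by blast+
  obtain d1 where d1: "d1 > 0" "\<forall>s. dist s t0 < d1 \<longrightarrow> dist (u s) (u t0) < r"
    using cont(1) r(1) unfolding continuous_at_eps_delta by blast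
  obtain d2 where d2: "d2 > 0" "\<forall>s. dist s t0 < d2 \<longrightarrow> dist (w s) (w t0) < r"
    using cont(2) r(1) unfolding continuous_at_eps_delta by blast
  have d: "d1 > 0" "\<And>s. \<bar>s - t0\<bar> < d1 \<Longrightarrow> u s \<in> cball (u t0) r"
      "d2 > 0" "\<And>s. \<bar>s - t0\<bar> < d2 \<Longrightarrow> w s \<in> cball (u t0) r"
    using d1 d2 eq by (auto simp: dist_real_def dist_commute[of "w t0"] intro!: less_imp_le)
  obtain d3 where d3: "d3 > 0" "\<And>s. \<bar>s - t0\<bar> < d3 \<Longrightarrow> s \<in> J"
    using assms(3,4) unfolding open_dist dist_real_def by blast
  \<comment> \<open>The last entry makes \<open>L * e \<le> 1/2\<close>, with \<open>L + 1\<close>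
    in place of \<open>L\<close> to allow \<open>L = 0\<close>.\<close>
  define e where "e = Min {d1, d2, d3, 1 / (2 * (L + 1))}"
  have e: "e > 0" "e \<le> d1" "e \<le> d2" "e \<le> d3" "e \<le> 1 / (2 * (L + 1))"
    using d(1,3) d3(1) r(2) unfolding e_def by auto
  have "u t = w t" if t: "\<bar>t - t0\<bar> < e" for t
  proof -
    have seg: "\<bar>s - t0\<bar> < e" if "s \<in> closed_segment t0 t" for s
      using that t by (auto simp: closed_segment_eq_real_ivl split: if_splits)
    have "L * \<bar>t - t0\<bar> \<le> L * (1 / (2 * (L + 1)))" using t e r(2) by (intro mult_left_mono) auto
    also have "\<dots> \<le> 1/2" using r(2) by (simp add: field_simps)
    finally have "norm (u t - w t) \<le> 2 * norm (u t0 - w t0)"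
      using seg d d3 e eq
      by (intro solutions_lipschitz[where K="cball (u t0) r" and F=F and L=L] L r(2) conjI u w)
        (use eq in \<open>force+\<close>)
    then show ?thesis using eq by simp
  qed
  then show ?thesis using e(1) by blast
qed

text \<open>The solution is the fixed point of the integral operator \<open>P\<close> on the
  complete space of bounded continuous functions; \<open>L * d \<le> 1/2\<close> makes
  \<open>P\<close> a contraction with factor \<open>1/2\<close>.\<close>

lemma picard_lindelof_global:
  fixes F :: "'v::banach \<Rightarrow> 'v"
  assumes L: "\<And>x y. norm (F x - F y) \<le> L * norm (x - y)" "0 \<le> L" and d: "d > 0" "L * d \<le> 1/2"
  shows "\<exists>u. u 0 = w \<and> (\<forall>t. \<bar>t\<bar> < d \<longrightarrow> (u has_vector_derivative F (u t)) (at t))"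
proof -
  have Fc: "continuous_on UNIV F"
    by (rule lipschitz_on_continuous_on[of L]) (use L in \<open>auto intro!: lipschitz_onI simp: dist_norm\<close>)
  \<comment> \<open>The lower limit \<open>-d\<close> instead of 0 keeps the integral unoriented;
    negative times are handled by subtracting \<open>I f 0\<close>.\<close>
  define I where "I f t = integral {-d..t} (\<lambda>s. F (apply_bcontfun f s))" for f :: "real \<Rightarrow>\<^sub>C 'v" and t
  \<comment> \<open>Times are clamped to the interval from \<open>-d\<close> to \<open>d\<close>, so
    that \<open>P f\<close> is bounded and continuous on the whole line.\<close>
  define c where "c t = max (-d) (min d t)" for t
  have c: "c t \<in> {-d..d}" for t using d by (auto simp: c_def)
  have cI: "continuous_on {-d..d} (\<lambda>s. F (apply_bcontfun f s))" for f :: "real \<Rightarrow>\<^sub>C 'v"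
    by (rule continuous_on_compose2[OF Fc]) auto
  have Ider: "(I f has_vector_derivative F (f t)) (at t within {-d..d})" if "t \<in> {-d..d}" for f t
    unfolding I_def using integral_has_vector_derivative[OF cI that] .
  have Icont: "continuous_on {-d..d} (I f)" for f
    using Ider has_vector_derivative_continuous continuous_on_eq_continuous_within by blast
  define P where "P f = Bcontfun (\<lambda>t. w + I f (c t) - I f 0)" for f
  have "(\<lambda>t. w + I f (c t) - I f 0) \<in> bcontfun" for f
    unfolding bcontfun_def
  proof (intro CollectI conjI)
    have "continuous_on UNIV (\<lambda>t. I f (c t))"
      by (rule continuous_on_compose2[OF Icont]) (use c in \<open>auto simp: c_def intro!: continuous_intros\<close>)
    then show "continuous_on UNIV (\<lambda>t. w + I f (c t) - I f 0)" by (intro continuous_intros)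
    have "bounded ((\<lambda>s. w + I f s - I f 0) ` {-d..d})"
      by (intro compact_imp_bounded compact_continuous_image continuous_intros Icont) auto
    then show "bounded (range (\<lambda>t. w + I f (c t) - I f 0))"
      by (rule bounded_subset) (use c in auto)
  qed
  then have P: "P f t = w + I f (c t) - I f 0" for f t
    unfolding P_def by (simp add: Bcontfun_inverse)
  have "dist (P f) (P g) \<le> 1/2 * dist f g" for f g
  proof (rule dist_bound)
    fix t
    have "norm ((I f (c t) - I g (c t)) - (I f 0 - I g 0)) \<le> (L * dist f g) * \<bar>c t - 0\<bar>"
    proof (rule vector_derivative_bound[where I="{-d..d}"])
      show "norm (F (f s) - F (g s)) \<le> L * dist f g" for s
        using L(1)[of "f s" "g s"] mult_left_mono[OF dist_bounded L(2), of f s g]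
        by (simp add: dist_norm)
    qed (use c d in \<open>auto intro!: has_vector_derivative_diff Ider\<close>)
    also have "\<dots> = dist f g * (L * \<bar>c t\<bar>)" by simp
    also have "\<dots> \<le> dist f g * (1/2)"
    proof (rule mult_left_mono)
      have "L * \<bar>c t\<bar> \<le> L * d" using c[of t] L(2) by (intro mult_left_mono) auto
      then show "L * \<bar>c t\<bar> \<le> 1/2" using d by simp
    qed simp
    finally show "dist (P f t) (P g t) \<le> 1/2 * dist f g"
      unfolding P dist_norm by (simp add: algebra_simps)
  qed
  then obtain u where u: "P u = u" using banach_fix_type[of "1/2" P] by auto
  have u_eq: "u t = w + I u (c t) - I u 0" for t using P[of u t] u by simp
  have "(apply_bcontfun u has_vector_derivative F (u t)) (at t)" if t: "\<bar>t\<bar> < d" for t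
  proof -
    have "(I u has_vector_derivative F (u t)) (at t)"
      using Ider[of t u] t at_within_Icc_at[of "-d" t d] by (simp add: abs_less_iff)
    then have 1: "((\<lambda>t. w + I u t - I u 0) has_vector_derivative F (u t)) (at t)"
      by (auto intro!: derivative_eq_intros)
    have 2: "w + I u s - I u 0 = u s" if "s \<in> {-d<..<d}" for s
      using that by (simp add: u_eq[of s] c_def)
    show ?thesis
      by (rule has_vector_derivative_transform_within_open[where S="{-d<..<d}", OF 1 _ _ 2]) (use t in auto)
  qed
  moreover have "u 0 = w" using u_eq[of 0] d by (simp add: c_def)
  ultimately show ?thesis by blast
qed

text \<open>Composing \<open>F\<close> with the projection onto a small ball makes it globally Lipschitz.\<close>

lemma flow_box:
  fixes F :: "'v::euclidean_space \<Rightarrow> 'v"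
  assumes \<Omega>: "open \<Omega>" and F: "Ck_on (Suc 0) \<Omega> F" and u0: "u0 \<in> \<Omega>"
  obtains d \<rho> \<phi> where "d > 0" "\<rho> > 0"
    "\<And>w. w \<in> ball u0 \<rho> \<Longrightarrow> \<phi> w 0 = w"
    "\<And>w t. w \<in> ball u0 \<rho> \<Longrightarrow> \<bar>t\<bar> < d \<Longrightarrow> (\<phi> w has_vector_derivative F (\<phi> w t)) (at t)"
    "\<And>w t. w \<in> ball u0 \<rho> \<Longrightarrow> \<bar>t\<bar> < d \<Longrightarrow> \<phi> w t \<in> \<Omega>"
    "\<And>w w' t. w \<in> ball u0 \<rho> \<Longrightarrow> w' \<in> ball u0 \<rho> \<Longrightarrow> \<bar>t\<bar> < d \<Longrightarrow>
      norm (\<phi> w t - \<phi> w' t) \<le> 2 * norm (w - w')"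
proof -
  obtain r L where r: "r > 0" and Lp: "L \<ge> 0" and sub: "cball u0 r \<subseteq> \<Omega>" and
      L: "\<And>x y. x \<in> cball u0 r \<Longrightarrow> y \<in> cball u0 r \<Longrightarrow> norm (F x - F y) \<le> L * norm (x - y)"
    using C1_locally_lipschitz[OF \<Omega> F u0] by meson
  let ?p = "closest_point (cball u0 r)"
  have p: "?p x \<in> cball u0 r" for x using r by (intro closest_point_in_set) auto
  have p_lip: "norm (?p x - ?p y) \<le> norm (x - y)" for x y
    using closest_point_lipschitz[of "cball u0 r" x y] r by (simp add: dist_norm)
  have p_id: "?p x = x" if "x \<in> cball u0 r" for x using that closest_point_self by blast
  have "continuous_on (cball u0 r) F"
    using Ck_on_continuous[OF \<Omega> F] sub continuous_on_subset by blast
  then have "bounded (F ` cball u0 r)"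
    using compact_continuous_image compact_imp_bounded compact_cball by blast
  then obtain B where B: "B > 0" "\<And>x. x \<in> cball u0 r \<Longrightarrow> norm (F x) \<le> B"
    unfolding bounded_pos by auto
  \<comment> \<open>The first bound gives \<open>L * d \<le> 1/2\<close> for the contraction; the
    second limits the displacement to \<open>B * d \<le> r / 4\<close>, so a trajectory starting
    within \<open>r / 2\<close> of \<open>u0\<close> stays within \<open>r\<close>.\<close>
  define d where "d = min (1 / (2 * (L + 1))) (r / (4 * B))"
  have d: "d > 0" "d \<le> 1 / (2 * (L + 1))" "d \<le> r / (4 * B)"
    using Lp r B by (auto simp: d_def)
  have "L * d \<le> L * (1 / (2 * (L + 1)))" by (intro mult_left_mono d Lp)
  also have "\<dots> \<le> 1/2" using Lp by (simp add: field_simps)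
  finally have Ld: "L * d \<le> 1/2" .
  have FL: "norm (F (?p x) - F (?p y)) \<le> L * norm (x - y)" for x y
    using L[OF p p, of x y] mult_left_mono[OF p_lip Lp, of x y] by linarith
  have "\<exists>u. u 0 = w \<and> (\<forall>t. \<bar>t\<bar> < d \<longrightarrow> (u has_vector_derivative F (?p (u t))) (at t))" for w
    using picard_lindelof_global[of "\<lambda>x. F (?p x)" L d w, OF FL Lp d(1) Ld] .
  then obtain \<phi> where \<phi>0: "\<And>w. \<phi> w 0 = w" and
      \<phi>': "\<And>w t. \<bar>t\<bar> < d \<Longrightarrow> (\<phi> w has_vector_derivative F (?p (\<phi> w t))) (at t)" by metis
  \<comment> \<open>This removes the projection: on \<open>cball u0 r\<close> it is the identity, so
    \<open>\<phi> w\<close> solves the equation for \<open>F\<close> itself.\<close>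
  have stay: "\<phi> w t \<in> cball u0 r" if w: "w \<in> ball u0 (r/2)" and t: "\<bar>t\<bar> < d" for w t
  proof -
    have "norm (\<phi> w t - \<phi> w 0) \<le> B * \<bar>t - 0\<bar>"
      by (rule vector_derivative_bound[where I="{-d<..<d}" and h'="\<lambda>s. F (?p (\<phi> w s))"])
        (use t d(1) B(2)[OF p] in \<open>auto intro!: has_vector_derivative_at_within \<phi>'\<close>)
    also have "\<dots> \<le> B * (r / (4 * B))" using t d B by (intro mult_left_mono) auto
    also have "\<dots> = r / 4" using B by simp
    finally have "dist (\<phi> w t) w \<le> r / 4" by (simp add: \<phi>0 dist_norm)
    moreover have "dist u0 w < r / 2" using w by simp
    ultimately show ?thesis using dist_triangle[of u0 "\<phi> w t" w] r
      unfolding mem_cball dist_commute[of w] by linarith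
  qed
  have seg: "\<bar>s\<bar> < d" if "s \<in> closed_segment 0 t" "\<bar>t\<bar> < d" for s t :: real
    using that by (auto simp: closed_segment_eq_real_ivl split: if_splits)
  have sol: "(\<phi> w has_vector_derivative F (\<phi> w t)) (at t)" if "w \<in> ball u0 (r/2)" "\<bar>t\<bar> < d" for w t
    using \<phi>'[OF that(2), of w] p_id[OF stay[OF that]] by simp
  show thesis
  proof (rule that[of d "r/2" \<phi>])
    fix w w' t assume w: "w \<in> ball u0 (r/2)" "w' \<in> ball u0 (r/2)" and t: "\<bar>t\<bar> < d"
    have "L * \<bar>t - 0\<bar> \<le> L * d" using t Lp by (intro mult_left_mono) auto
    then have "norm (\<phi> w t - \<phi> w' t) \<le> 2 * norm (\<phi> w 0 - \<phi> w' 0)"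
      using Ld seg[OF _ t] w
      by (intro solutions_lipschitz[where K="cball u0 r" and F=F and L=L] L Lp)
        (auto intro!: sol stay[unfolded mem_cball] )
    then show "norm (\<phi> w t - \<phi> w' t) \<le> 2 * norm (w - w')" by (simp add: \<phi>0)
  qed (use d(1) r \<phi>0 sol stay sub in auto)
qed

text \<open>Bootstrapping: if \<open>u\<close> is \<open>C^k\<close>, so is
  \<open>F \<circ> u\<close>, which is the derivative of \<open>u\<close>.\<close>

lemma ode_solution_smooth:
  fixes F :: "'v::euclidean_space \<Rightarrow> 'v"
  assumes \<Omega>: "open \<Omega>" and F: "smooth_on \<Omega> F" and J: "open J"
    and u: "\<And>s. s \<in> J \<Longrightarrow> (u has_vector_derivative F (u s)) (at s) \<and> u s \<in> \<Omega>"
  shows "smooth_on J u"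
  unfolding smooth_on_def
proof
  fix k show "Ck_on k J u"
  proof (induction k)
    case 0
    show ?case unfolding Ck_on.simps
      by (intro continuous_at_imp_continuous_on ballI) (use u has_vector_derivative_continuous in blast)
  next
    case (Suc k)
    have "Ck_on k J (F \<circ> u)"
      by (rule Ck_on_compose[OF J \<Omega> _ Suc smooth_onD[OF F]]) (use u in auto)
    then show ?case using u by (intro Ck_on_vector_derivative[OF J]) (auto simp: o_def)
  qed
qed

section \<open>Charts and the metric in coordinates\<close>

lemma bilinear_basis_sum:
  fixes B :: "'e::euclidean_space \<Rightarrow> 'e \<Rightarrow> real"
  assumes "bilinear B"
  shows "B a b = (\<Sum>i\<in>Basis. \<Sum>j\<in>Basis. (a \<bullet> i) * (b \<bullet> j) * B i j)"
proof -
  have "B a b = (\<Sum>i\<in>Basis. (a \<bullet> i) *\<^sub>R B i b)"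
    by (rule linear_basis_sum) (use assms in \<open>simp add: bilinear_def\<close>)
  also have "\<dots> = (\<Sum>i\<in>Basis. (a \<bullet> i) *\<^sub>R (\<Sum>j\<in>Basis. (b \<bullet> j) *\<^sub>R B i j))"
    by (intro sum.cong arg_cong2[where f=scaleR] linear_basis_sum refl)
      (use assms in \<open>simp add: bilinear_def\<close>)
  finally show ?thesis by (simp add: sum_distrib_left mult.assoc)
qed

lemma bilinear_family_frechet:
  fixes B :: "'x::real_normed_vector \<Rightarrow> 'e::euclidean_space \<Rightarrow> 'e \<Rightarrow> real"
  assumes S: "open S" and bil: "\<And>x. x \<in> S \<Longrightarrow> bilinear (B x)" and sm: "\<And>a b. smooth_on S (\<lambda>x. B x a b)"
    and x: "x \<in> S"
  shows "fderiv (\<lambda>y. B y a b) x v =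
    (\<Sum>i\<in>Basis. \<Sum>j\<in>Basis. (a \<bullet> i) * (b \<bullet> j) * fderiv (\<lambda>y. B y i j) x v)"
proof -
  have "fderiv (\<lambda>y. B y a b) x =
      fderiv (\<lambda>y. \<Sum>i\<in>Basis. \<Sum>j\<in>Basis. (a \<bullet> i) * (b \<bullet> j) * B y i j) x"
    by (rule frechet_derivative_cong[OF S x]) (rule bilinear_basis_sum[OF bil])
  also have "\<dots> = (\<lambda>v. \<Sum>i\<in>Basis. \<Sum>j\<in>Basis. (a \<bullet> i) * (b \<bullet> j) * fderiv (\<lambda>y. B y i j) x v)"
    by (rule frechet_derivative_at[symmetric])
      (intro has_derivative_sum has_derivative_mult_right smooth_on_has_derivative[OF S sm x])
  finally show ?thesis by simp
qed

lemma bilinear_family_frechet_bilinear: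
  fixes B :: "'x::real_normed_vector \<Rightarrow> 'e::euclidean_space \<Rightarrow> 'e \<Rightarrow> real"
  assumes S: "open S" and bil: "\<And>x. x \<in> S \<Longrightarrow> bilinear (B x)" and sm: "\<And>a b. smooth_on S (\<lambda>x. B x a b)"
    and x: "x \<in> S"
  shows "bilinear (\<lambda>a b. fderiv (\<lambda>y. B y a b) x v)"
proof -
  define D where "D i j = fderiv (\<lambda>y. B y i j) x v" for i j
  have key: "(\<lambda>a b. fderiv (\<lambda>y. B y a b) x v) =
      (\<lambda>a b. \<Sum>i\<in>Basis. \<Sum>j\<in>Basis. (a \<bullet> i) * (b \<bullet> j) * D i j)"
    unfolding D_def by (intro ext bilinear_family_frechet[OF assms])
  show ?thesis unfolding key bilinear_def
    by (auto intro!: linearI simp: inner_add algebra_simps sum.distrib sum_distrib_left)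
qed

text \<open>The product rule for three varying arguments. Smoothness is assumed only for fixed
  vector arguments, so the expression is first expanded in the basis into a finite sum of products
  of real functions.\<close>

lemma bilinear_family_has_derivative:
  fixes B :: "'x::real_normed_vector \<Rightarrow> 'e::euclidean_space \<Rightarrow> 'e \<Rightarrow> real"
  assumes S: "open S" and bil: "\<And>x. x \<in> S \<Longrightarrow> bilinear (B x)" and sm: "\<And>a b. smooth_on S (\<lambda>x. B x a b)"
    and p: "(p has_derivative p') (at t)" and a: "(a has_derivative a') (at t)" and b: "(b has_derivative b') (at t)"
    and S_t: "p t \<in> S"
  shows "((\<lambda>s. B (p s) (a s) (b s)) has_derivative
    (\<lambda>h. fderiv (\<lambda>y. B y (a t) (b t)) (p t) (p' h) + B (p t) (a' h) (b t) + B (p t) (a t) (b' h))) (at t)"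
proof -
  let ?D = "\<lambda>i j. fderiv (\<lambda>y. B y i j) (p t)"
  have Bp: "((\<lambda>s. B (p s) i j) has_derivative (\<lambda>h. ?D i j (p' h))) (at t)" for i j
    by (rule has_derivative_compose[where f=p and g="\<lambda>y. B y i j", OF p smooth_on_has_derivative[OF S sm S_t]])
  have "((\<lambda>s. \<Sum>i\<in>Basis. \<Sum>j\<in>Basis. (a s \<bullet> i) * (b s \<bullet> j) * B (p s) i j) has_derivative
     (\<lambda>h. \<Sum>i\<in>Basis. \<Sum>j\<in>Basis. (a t \<bullet> i) * (b t \<bullet> j) * ?D i j (p' h) +
       ((a t \<bullet> i) * (b' h \<bullet> j) + (a' h \<bullet> i) * (b t \<bullet> j)) * B (p t) i j)) (at t)"
    by (intro has_derivative_sum has_derivative_mult Bp has_derivative_inner_left a b)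
  moreover have "(\<Sum>i\<in>Basis. \<Sum>j\<in>Basis. (a t \<bullet> i) * (b t \<bullet> j) * ?D i j (p' h) +
       ((a t \<bullet> i) * (b' h \<bullet> j) + (a' h \<bullet> i) * (b t \<bullet> j)) * B (p t) i j) =
     fderiv (\<lambda>y. B y (a t) (b t)) (p t) (p' h) + B (p t) (a' h) (b t) + B (p t) (a t) (b' h)" for h
    using bilinear_family_frechet[OF S bil sm S_t, of "a t" "b t" "p' h"]
      bilinear_basis_sum[OF bil[OF S_t], of "a' h" "b t"] bilinear_basis_sum[OF bil[OF S_t], of "a t" "b' h"]
    by (simp add: sum.distrib distrib_right)
  ultimately have 1: "((\<lambda>s. \<Sum>i\<in>Basis. \<Sum>j\<in>Basis. (a s \<bullet> i) * (b s \<bullet> j) * B (p s) i j) has_derivative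
     (\<lambda>h. fderiv (\<lambda>y. B y (a t) (b t)) (p t) (p' h) + B (p t) (a' h) (b t) + B (p t) (a t) (b' h))) (at t)"
    by simp
  have "isCont p t" using p has_derivative_continuous by blast
  then obtain T where T: "open T" "t \<in> T" "\<And>s. s \<in> T \<Longrightarrow> p s \<in> S"
    using S S_t unfolding continuous_at_open by meson
  show ?thesis
    by (rule has_derivative_transform_within_open[OF 1 T(1,2)])
      (rule bilinear_basis_sum[OF bil[OF T(3)], symmetric])
qed

text \<open>Continuity for fixed arguments becomes joint continuity because a bilinear form is a
  polynomial in the components of its arguments, with coefficients \<open>B x i j\<close>.\<close>

lemma bilinear_family_continuous:
  fixes B :: "'x::real_normed_vector \<Rightarrow> 'e::euclidean_space \<Rightarrow> 'e \<Rightarrow> real"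
  assumes bil: "\<And>x. x \<in> S \<Longrightarrow> bilinear (B x)" and c: "\<And>a b. continuous_on S (\<lambda>x. B x a b)"
  shows "continuous_on (S \<times> UNIV) (\<lambda>(x, a, b). B x a b)"
proof -
  have "continuous_on (S \<times> UNIV) (\<lambda>z. B (fst z) i j)" for i j
    by (rule continuous_on_compose2[OF c]) (auto intro: continuous_intros)
  then have "continuous_on (S \<times> UNIV) (\<lambda>z. \<Sum>i\<in>Basis. \<Sum>j\<in>Basis.
      (fst (snd z) \<bullet> i) * (snd (snd z) \<bullet> j) * B (fst z) i j)"
    by (intro continuous_intros)
  then show ?thesis
    by (rule continuous_on_eq)
      (auto simp: case_prod_beta intro!: bilinear_basis_sum[symmetric] bil)
qed

lemma topspace_quotient_topology: "topspace (quotient_topology T R) = topspace T // R"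
proof
  show "topspace (quotient_topology T R) \<subseteq> topspace T // R"
    using openin_topspace[of "quotient_topology T R"] unfolding openin_quotient_topology by blast
  have "{x \<in> topspace T. R `` {x} \<in> topspace T // R} = topspace T" by (auto intro: quotientI)
  then have "openin (quotient_topology T R) (topspace T // R)"
    unfolding openin_quotient_topology by simp
  then show "topspace T // R \<subseteq> topspace (quotient_topology T R)" by (rule openin_subset)
qed

section \<open>Charts and transition maps of a space-time\<close>

locale space_time =
  fixes M :: "('a::{t2_space, second_countable_topology}, 'e::euclidean_space) st"
  assumes spacetime: "spacetime M"
begin

abbreviation "vel \<equiv> velocity M"
abbreviation "geo \<equiv> geodesic M"
abbreviation "tangent \<equiv> tangent_to M"
abbreviation "\<Gamma> \<equiv> christoffel M"
abbreviation "null_geo \<equiv> null_geodesic M"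

definition cdom :: "('a, 'e) chart \<Rightarrow> 'e set" where "cdom c = snd c ` fst c"

definition overlap :: "('a, 'e) chart \<Rightarrow> ('a, 'e) chart \<Rightarrow> 'e set" where
  "overlap c d = snd c ` (fst c \<inter> fst d)"

definition tmap :: "('a, 'e) chart \<Rightarrow> ('a, 'e) chart \<Rightarrow> 'e \<Rightarrow> 'e" where
  "tmap c d = snd d \<circ> chart_inv c"

definition dtrans :: "('a, 'e) chart \<Rightarrow> ('a, 'e) chart \<Rightarrow> 'e \<Rightarrow> 'e \<Rightarrow> 'e" where
  "dtrans c d x = fderiv (tmap c d) x"

lemma atlas_facts: "smooth_atlas (atlas M)" and lorentz: "lorentz_metric M" and orient: "time_orientation M"
  using spacetime by (auto simp: spacetime_def)

lemma chartE: obtains c where "c \<in> atlas M" "p \<in> fst c"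
  using atlas_facts unfolding smooth_atlas_def by blast

context
  fixes c assumes c: "c \<in> atlas M"
begin

lemma chart_homeo: "homeomorphism (fst c) (cdom c) (snd c) (chart_inv c)"
  and open_chart: "open (fst c)" and open_cdom: "open (cdom c)"
  using atlas_facts c by (auto simp: smooth_atlas_def is_chart_def cdom_def)

lemma chart_continuous: "continuous_on (fst c) (snd c)"
  and chart_inv_continuous: "continuous_on (cdom c) (chart_inv c)"
  using chart_homeo by (auto simp: homeomorphism_def)

lemma chart_inv_chart: "p \<in> fst c \<Longrightarrow> chart_inv c (snd c p) = p"
  and chart_chart_inv: "x \<in> cdom c \<Longrightarrow> snd c (chart_inv c x) = x"
  and chart_in: "p \<in> fst c \<Longrightarrow> snd c p \<in> cdom c"
  and chart_inv_in: "x \<in> cdom c \<Longrightarrow> chart_inv c x \<in> fst c"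
  using chart_homeo by (auto simp: homeomorphism_def cdom_def)

lemma overlap_iff: "x \<in> overlap c d \<longleftrightarrow> x \<in> cdom c \<and> chart_inv c x \<in> fst d"
  unfolding overlap_def cdom_def using chart_inv_chart by force

lemma chart_overlap: "p \<in> fst c \<Longrightarrow> p \<in> fst d \<Longrightarrow> snd c p \<in> overlap c d"
  unfolding overlap_def by blast

lemma overlap_self: "overlap c c = cdom c"
  by (simp add: overlap_def cdom_def)

lemma transition_chart: "p \<in> fst c \<Longrightarrow> tmap c d (snd c p) = snd d p"
  by (simp add: tmap_def chart_inv_chart)

end

context
  fixes c d assumes c: "c \<in> atlas M" and d: "d \<in> atlas M"
begin

lemma open_overlap: "open (overlap c d)"
proof -
  have "overlap c d = cdom c \<inter> chart_inv c -` fst d" using overlap_iff[OF c] by blast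
  then show ?thesis
    using continuous_open_preimage[OF chart_inv_continuous[OF c] open_cdom[OF c] open_chart[OF d]] by simp
qed

lemma transition_smooth: "smooth_on (overlap c d) (tmap c d)"
  using atlas_facts c d by (auto simp: smooth_atlas_def overlap_def tmap_def)

lemma transition_in: "x \<in> overlap c d \<Longrightarrow> tmap c d x \<in> overlap d c"
  by (auto simp: overlap_def tmap_def chart_inv_chart[OF c])

lemma transition_dom: "x \<in> overlap c d \<Longrightarrow> tmap c d x \<in> cdom d"
  using transition_in overlap_iff[OF d] by blast

lemma transition_inverse: "x \<in> overlap c d \<Longrightarrow> tmap d c (tmap c d x) = x"
  by (auto simp: overlap_def tmap_def chart_inv_chart[OF c] chart_inv_chart[OF d])

lemma transition_has_derivative: "x \<in> overlap c d \<Longrightarrow> (tmap c d has_derivative dtrans c d x) (at x)"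
  unfolding dtrans_def using smooth_on_has_derivative[OF open_overlap transition_smooth] .

lemma dtrans_linear: "x \<in> overlap c d \<Longrightarrow> linear (dtrans c d x)"
  using transition_has_derivative has_derivative_linear by blast

lemma dtrans_smooth: "smooth_on (overlap c d) (\<lambda>x. dtrans c d x a)"
  unfolding dtrans_def by (rule smooth_on_frechet[OF transition_smooth])

end

lemma dtrans_self: "c \<in> atlas M \<Longrightarrow> x \<in> cdom c \<Longrightarrow> dtrans c c x = (\<lambda>a. a)"
proof -
  assume c: "c \<in> atlas M" and x: "x \<in> cdom c"
  have "dtrans c c x = fderiv (\<lambda>x. x) x"
    unfolding dtrans_def
    by (rule frechet_derivative_cong[OF open_cdom[OF c] x]) (simp add: tmap_def chart_chart_inv[OF c])
  also have "\<dots> = (\<lambda>a. a)" by (rule frechet_derivative_at[symmetric]) (rule has_derivative_ident)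
  finally show ?thesis .
qed

lemma dtrans_chain:
  assumes c: "c \<in> atlas M" and d: "d \<in> atlas M" and e: "e \<in> atlas M"
    and x: "x \<in> overlap c d" "x \<in> overlap c e"
  shows "dtrans c e x a = dtrans d e (tmap c d x) (dtrans c d x a)"
proof -
  let ?S = "overlap c d \<inter> overlap c e"
  have S: "open ?S" "x \<in> ?S" using open_overlap[OF c d] open_overlap[OF c e] x by auto
  have y: "tmap c d x \<in> overlap d e"
    using x overlap_iff[OF c] chart_overlap[OF d] by (auto simp: tmap_def)
  have "dtrans c e x = fderiv (\<lambda>x. tmap d e (tmap c d x)) x"
    unfolding dtrans_def
    by (rule frechet_derivative_cong[OF S])
      (use overlap_iff[OF c] chart_inv_chart[OF d] in \<open>auto simp: tmap_def\<close>)
  also have "\<dots> = (\<lambda>a. dtrans d e (tmap c d x) (dtrans c d x a))"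
    by (rule frechet_derivative_at[symmetric], rule has_derivative_compose[where f="tmap c d"])
      (use transition_has_derivative c d e x y in auto)
  finally show ?thesis by simp
qed

lemma dtrans_inverse:
  assumes "c \<in> atlas M" "d \<in> atlas M" "x \<in> overlap c d"
  shows "dtrans d c (tmap c d x) (dtrans c d x a) = a"
    and "dtrans c d x (dtrans d c (tmap c d x) a) = a"
proof -
  have 1: "dtrans d c (tmap c d x) (dtrans c d x a) = a"
    if "c \<in> atlas M" "d \<in> atlas M" "x \<in> overlap c d" for c d x
  proof -
    have "x \<in> cdom c" using that(3) overlap_iff[OF that(1)] by blast
    then show ?thesis
      using dtrans_chain[OF that(1,2,1,3), of a] overlap_self[OF that(1)] dtrans_self[OF that(1)] by metis
  qed
  show "dtrans d c (tmap c d x) (dtrans c d x a) = a" by (rule 1[OF assms])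
  show "dtrans c d x (dtrans d c (tmap c d x) a) = a"
    using 1[OF assms(2,1) transition_in[OF assms]] unfolding transition_inverse[OF assms] .
qed

lemma transition_deriv_eq: "transition_deriv c d p = dtrans c d (snd c p)"
  by (simp add: transition_deriv_def dtrans_def tmap_def)

subsection \<open>Tangent vectors\<close>

abbreviation "tspace \<equiv> tangent_space (atlas M)"
abbreviation "tvec \<equiv> tv_of_coord (atlas M)"

lemma tspace_off: "v \<in> tspace p \<Longrightarrow> \<not> (d \<in> atlas M \<and> p \<in> fst d) \<Longrightarrow> v d = 0"
  unfolding tangent_space_def by blast

lemma tspace_transition:
  assumes "v \<in> tspace p" "c \<in> atlas M" "d \<in> atlas M" "p \<in> fst c" "p \<in> fst d"
  shows "v d = dtrans c d (snd c p) (v c)"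
  using assms unfolding tangent_space_def transition_deriv_eq by blast

context
  fixes c p assumes c: "c \<in> atlas M" and p: "p \<in> fst c"
begin

text \<open>The transformation law between two further charts \<open>d\<close> and \<open>e\<close>
  is the chain rule for the transition maps starting at \<open>c\<close>.\<close>

lemma tvec_in: "tvec c p a \<in> tspace p"
proof -
  have "tvec c p a e = dtrans d e (snd d p) (tvec c p a d)"
    if "d \<in> atlas M" "e \<in> atlas M" "p \<in> fst d" "p \<in> fst e" for d e
    using dtrans_chain[OF c that(1,2) chart_overlap[OF c p that(3)] chart_overlap[OF c p that(4)]] that
    by (simp add: tv_of_coord_def transition_deriv_eq transition_chart[OF c p])
  moreover have "tvec c p a e = 0" if "\<not> (e \<in> atlas M \<and> p \<in> fst e)" for e
    using that unfolding tv_of_coord_def by metis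
  ultimately show ?thesis unfolding tangent_space_def transition_deriv_eq by blast
qed

lemma tvec_self: "tvec c p a c = a"
  using c p dtrans_self[OF c chart_in[OF c p]] by (simp add: tv_of_coord_def transition_deriv_eq)

text \<open>A single component fixes the others through the transformation law; off the charts
  around \<open>p\<close> both vectors are 0 by convention.\<close>

lemma tspace_ext: "u \<in> tspace p \<Longrightarrow> v \<in> tspace p \<Longrightarrow> u c = v c \<Longrightarrow> u = v"
proof
  fix d assume *: "u \<in> tspace p" "v \<in> tspace p" "u c = v c"
  show "u d = v d"
    using * tspace_transition[OF *(1) c, of d] tspace_transition[OF *(2) c, of d] p
      tspace_off[OF *(1), of d] tspace_off[OF *(2), of d] by metis
qed

lemma tvec_component: "v \<in> tspace p \<Longrightarrow> tvec c p (v c) = v"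
  by (rule tspace_ext[OF tvec_in]) (auto simp: tvec_self)

lemma tvec_lin: "tvec c p (\<alpha> *\<^sub>R a + \<beta> *\<^sub>R b) = tv_lin \<alpha> (tvec c p a) \<beta> (tvec c p b)"
  using dtrans_linear[OF c _ chart_overlap[OF c p]]
  by (auto simp: tv_of_coord_def tv_lin_def transition_deriv_eq linear_add linear_cmul)

end

lemma tvec_transition:
  assumes "c \<in> atlas M" "d \<in> atlas M" "p \<in> fst c" "p \<in> fst d"
  shows "tvec d p (dtrans c d (snd c p) a) = tvec c p a"
  using tspace_transition[OF tvec_in[OF assms(1,3)] assms] tvec_component[OF assms(2,4) tvec_in[OF assms(1,3)]]
    tvec_self[OF assms(1,3)] by metis

lemma tv_scale_in: "v \<in> tspace p \<Longrightarrow> tv_scale a v \<in> tspace p"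
proof -
  assume v: "v \<in> tspace p"
  obtain c where c: "c \<in> atlas M" "p \<in> fst c" by (rule chartE)
  have "tv_scale a v = tvec c p (a *\<^sub>R v c)"
    using tvec_lin[OF c, of a "v c" 0 0] tvec_component[OF c v] by (simp add: tv_lin_def tv_scale_def)
  then show ?thesis using tvec_in[OF c] by simp
qed

lemma zero_in_tspace: "(\<lambda>_. 0) \<in> tspace p"
proof -
  obtain c where c: "c \<in> atlas M" "p \<in> fst c" by (rule chartE)
  have "tvec c p 0 \<in> tspace p" by (rule tvec_in[OF c])
  then have "tv_scale 0 (tvec c p 0) \<in> tspace p" by (rule tv_scale_in)
  then show ?thesis by (simp add: tv_scale_def)
qed

lemma component_zero_iff:
  assumes "c \<in> atlas M" "p \<in> fst c" "v \<in> tspace p"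
  shows "v c = 0 \<longleftrightarrow> v = (\<lambda>_. 0)"
  using tspace_ext[OF assms(1,2,3) zero_in_tspace] by auto

subsection \<open>The metric in coordinates\<close>

abbreviation "met c x a b \<equiv> metric_coord M c x a b"

lemma metric_linear_left:
  "u \<in> tspace p \<Longrightarrow> v \<in> tspace p \<Longrightarrow> w \<in> tspace p \<Longrightarrow>
    metric M p (tv_lin a u b v) w = a * metric M p u w + b * metric M p v w"
  using lorentz by (auto simp: lorentz_metric_def)

lemma metric_sym: "u \<in> tspace p \<Longrightarrow> v \<in> tspace p \<Longrightarrow> metric M p u v = metric M p v u"
  using lorentz by (auto simp: lorentz_metric_def)

context
  fixes c assumes c: "c \<in> atlas M"
begin

lemma metric_eq_met:
  assumes "p \<in> fst c" "u \<in> tspace p" "v \<in> tspace p"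
  shows "metric M p u v = met c (snd c p) (u c) (v c)"
  using tvec_component[OF c assms(1)] assms
  by (simp add: metric_coord_def chart_inv_chart[OF c])

lemma met_eq_metric: "p \<in> fst c \<Longrightarrow> met c (snd c p) a b = metric M p (tvec c p a) (tvec c p b)"
  by (simp add: metric_coord_def chart_inv_chart[OF c])

lemma met_smooth: "smooth_on (cdom c) (\<lambda>x. met c x a b)"
  using lorentz c by (auto simp: lorentz_metric_def cdom_def)

lemma met_sym: "x \<in> cdom c \<Longrightarrow> met c x a b = met c x b a"
  using metric_sym tvec_in[OF c chart_inv_in[OF c]] by (simp add: metric_coord_def)

lemma met_bilinear: "x \<in> cdom c \<Longrightarrow> bilinear (met c x)"
proof -
  assume x: "x \<in> cdom c"
  let ?p = "chart_inv c x"
  have p: "?p \<in> fst c" by (rule chart_inv_in[OF c x])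
  have lin: "met c x (\<alpha> *\<^sub>R a + \<beta> *\<^sub>R b) w = \<alpha> * met c x a w + \<beta> * met c x b w" for \<alpha> \<beta> a b w
    unfolding metric_coord_def Let_def tvec_lin[OF c p]
    by (rule metric_linear_left) (rule tvec_in[OF c p])+
  have "linear (\<lambda>a. met c x a w)" for w
    using lin[of 1 _ 1] lin[of _ _ 0] by (intro linearI) auto
  moreover have "met c x w = (\<lambda>a. met c x a w)" for w by (rule ext) (rule met_sym[OF x])
  ultimately show ?thesis unfolding bilinear_def by metis
qed

text \<open>\<open>L\<close> sends the standard basis to an orthonormal frame, so the metric becomes
  the inner product with the sign of the \<open>b0\<close>-component reversed. Nondegeneracy and the
  causal inequality are read off in this model.\<close>

lemma minkowski_frame:
  assumes x: "x \<in> cdom c"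
  shows "\<exists>L :: 'e \<Rightarrow> 'e. \<exists>b0\<in>Basis. linear L \<and> surj L \<and> (\<forall>a b. met c x (L a) (L b) = a \<bullet> b - 2 * (a \<bullet> b0) * (b \<bullet> b0))"
proof -
  let ?p = "chart_inv c x"
  have p: "?p \<in> fst c" by (rule chart_inv_in[OF c x])
  have "\<exists>E. \<exists>b0\<in>Basis. (\<forall>b\<in>(Basis::'e set). E b \<in> tspace ?p) \<and> (\<forall>b\<in>Basis. \<forall>b'\<in>Basis.
      metric M ?p (E b) (E b') = (if b \<noteq> b' then 0 else if b = b0 then -1 else 1))"
    using lorentz unfolding lorentz_metric_def by blast
  then obtain E b0 where b0: "b0 \<in> (Basis :: 'e set)" and E: "\<And>b. b \<in> (Basis :: 'e set) \<Longrightarrow> E b \<in> tspace ?p"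
      and EE: "\<And>b b'. b \<in> Basis \<Longrightarrow> b' \<in> Basis \<Longrightarrow> metric M ?p (E b) (E b') = (if b \<noteq> b' then 0 else if b = b0 then -1 else 1)"
    by blast
  define L where "L a = (\<Sum>b\<in>Basis. (a \<bullet> b) *\<^sub>R E b c)" for a :: 'e
  have L: "linear L" unfolding L_def by (auto intro!: linearI simp: inner_add algebra_simps sum.distrib scaleR_sum_right)
  have Lb: "L b = E b c" if "b \<in> Basis" for b
    unfolding L_def using that by (simp add: inner_Basis if_distrib[of "\<lambda>r. r *\<^sub>R _"] cong: if_cong)
  have bil: "bilinear (\<lambda>a b. met c x (L a) (L b))"
    using met_bilinear[OF x] L linear_compose[OF L] by (auto simp: bilinear_def o_def)
  have basis: "met c x (L i) (L j) = (if i \<noteq> j then 0 else if i = b0 then -1 else 1)" if "i \<in> Basis" "j \<in> Basis" for i j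
    using EE[OF that] metric_eq_met[OF p E[OF that(1)] E[OF that(2)]] that chart_chart_inv[OF c x] by (simp add: Lb)
  have form: "met c x (L a) (L b) = a \<bullet> b - 2 * (a \<bullet> b0) * (b \<bullet> b0)" for a b
  proof -
    have "met c x (L a) (L b) = (\<Sum>i\<in>Basis. \<Sum>j\<in>Basis. (a \<bullet> i) * (b \<bullet> j) * met c x (L i) (L j))"
      by (rule bilinear_basis_sum[OF bil])
    also have "\<dots> = (\<Sum>i\<in>Basis. \<Sum>j\<in>Basis. if i = j then (a \<bullet> i) * (b \<bullet> i) - (if i = b0 then 2 * (a \<bullet> b0) * (b \<bullet> b0) else 0) else 0)"
      by (intro sum.cong refl) (auto simp: basis)
    also have "\<dots> = (\<Sum>i\<in>Basis. (a \<bullet> i) * (b \<bullet> i) - (if i = b0 then 2 * (a \<bullet> b0) * (b \<bullet> b0) else 0))"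
      by (intro sum.cong refl) simp
    also have "\<dots> = a \<bullet> b - 2 * (a \<bullet> b0) * (b \<bullet> b0)"
      using b0 by (simp add: sum_subtractf euclidean_inner[of a b])
    finally show ?thesis .
  qed
  have "inj L"
  proof (rule linear_injective_0[OF L, THEN iffD2], intro allI impI)
    fix a assume a: "L a = 0"
    have "a \<bullet> b - 2 * (a \<bullet> b0) * (b \<bullet> b0) = 0" for b
      using form[of a b] a bilinear_lzero[OF met_bilinear[OF x]] by simp
    \<comment> \<open>Testing against \<open>a\<close> with its \<open>b0\<close>-component reversed
      turns the form into \<open>a \<bullet> a\<close>.\<close>
    from this[of "a - (2 * (a \<bullet> b0)) *\<^sub>R b0"] this[of b0] b0 show "a = 0"
      by (auto simp: inner_diff_right inner_commute[of b0 a])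
  qed
  then have "surj L" by (rule linear_inj_imp_surj[OF L])
  with L form b0 show ?thesis by blast
qed

lemma met_nondegenerate:
  assumes x: "x \<in> cdom c" and "\<And>w. met c x z w = 0"
  shows "z = 0"
proof -
  obtain L :: "'e \<Rightarrow> 'e" and b0 where L: "b0 \<in> Basis" "linear L" "surj L"
      "\<And>a b. met c x (L a) (L b) = a \<bullet> b - 2 * (a \<bullet> b0) * (b \<bullet> b0)"
    using minkowski_frame[OF x] by blast
  obtain a where a: "z = L a" using L(3) by blast
  have "a \<bullet> b - 2 * (a \<bullet> b0) * (b \<bullet> b0) = 0" for b using assms(2)[of "L b"] L(4) a by simp
  from this[of "a - (2 * (a \<bullet> b0)) *\<^sub>R b0"] this[of b0] L(1) have "a = 0"
    by (auto simp: inner_diff_right inner_commute[of b0 a])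
  then show ?thesis using a linear_0[OF L(2)] by simp
qed

text \<open>A form of the reversed Cauchy--Schwarz inequality.\<close>

lemma met_orthogonal_timelike:
  assumes x: "x \<in> cdom c" and t: "met c x t t < 0" and v: "met c x v v \<le> 0" and vt: "met c x v t = 0"
  shows "v = 0"
proof -
  obtain L :: "'e \<Rightarrow> 'e" and b0 where L: "b0 \<in> Basis" "linear L" "surj L"
      "\<And>a b. met c x (L a) (L b) = a \<bullet> b - 2 * (a \<bullet> b0) * (b \<bullet> b0)"
    using minkowski_frame[OF x] by blast
  obtain a s where a: "v = L a" "t = L s" using L(3) by (meson surjD)
  \<comment> \<open>The spatial parts. Their inner product equals the product of the two time
    components, Cauchy-Schwarz bounds it, and the strict inequality for \<open>s'\<close> leaves no
    room unless the time component of \<open>a\<close> vanishes.\<close>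
  define a' s' where "a' = a - (a \<bullet> b0) *\<^sub>R b0" and "s' = s - (s \<bullet> b0) *\<^sub>R b0"
  have b0: "b0 \<bullet> b0 = 1" using L(1) by simp
  have a': "a' \<bullet> a' \<le> (a \<bullet> b0)\<^sup>2"
    using v b0 unfolding a L(4) a'_def by (simp add: inner_diff_right inner_diff_left inner_commute[of b0 a] inner_commute[of b0 s] power2_eq_square)
  have s': "s' \<bullet> s' < (s \<bullet> b0)\<^sup>2"
    using t b0 unfolding a L(4) s'_def by (simp add: inner_diff_right inner_diff_left inner_commute[of b0 a] inner_commute[of b0 s] power2_eq_square)
  have as: "a' \<bullet> s' = (a \<bullet> b0) * (s \<bullet> b0)"
    using vt b0 unfolding a L(4) s'_def a'_def by (simp add: inner_diff_right inner_diff_left inner_commute[of b0 a] inner_commute[of b0 s])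
  have "((a \<bullet> b0) * (s \<bullet> b0))\<^sup>2 \<le> (a' \<bullet> a') * (s' \<bullet> s')"
    using Cauchy_Schwarz_ineq[of a' s'] as by simp
  also have "\<dots> \<le> (a \<bullet> b0)\<^sup>2 * (s' \<bullet> s')" by (rule mult_right_mono[OF a']) simp
  finally have "(a \<bullet> b0)\<^sup>2 * ((s \<bullet> b0)\<^sup>2 - s' \<bullet> s') \<le> 0" by (simp add: power_mult_distrib algebra_simps)
  then have "(a \<bullet> b0)\<^sup>2 \<le> 0" using s' by (simp add: mult_le_0_iff)
  then have 1: "a \<bullet> b0 = 0" by simp
  then have "a' = 0" using a' inner_ge_zero[of a'] by simp
  then have "a = 0" using 1 by (simp add: a'_def)
  then show ?thesis using a linear_0[OF L(2)] by simp
qed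

end

lemma met_transition:
  assumes c: "c \<in> atlas M" and d: "d \<in> atlas M" and x: "x \<in> overlap c d"
  shows "met c x a b = met d (tmap c d x) (dtrans c d x a) (dtrans c d x b)"
proof -
  obtain p where p: "p \<in> fst c" "p \<in> fst d" "x = snd c p" using x by (auto simp: overlap_def)
  then show ?thesis
    using met_eq_metric[OF c p(1)] met_eq_metric[OF d p(2)] tvec_transition[OF c d p(1,2)]
      transition_chart[OF c p(1)] by simp
qed

subsection \<open>Christoffel symbols\<close>

definition dmet :: "('a, 'e) chart \<Rightarrow> 'e \<Rightarrow> 'e \<Rightarrow> 'e \<Rightarrow> 'e \<Rightarrow> real" where
  "dmet c x a b v = fderiv (\<lambda>y. met c y a b) x v"

definition koszul :: "('a, 'e) chart \<Rightarrow> 'e \<Rightarrow> 'e \<Rightarrow> 'e \<Rightarrow> 'e \<Rightarrow> real" where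
  "koszul c x a b w = dmet c x b w a + dmet c x a w b - dmet c x a b w"

text \<open>Lowering an index: the Euclidean vector that represents the covector
  \<open>met c x z\<close>. It puts the Koszul formula in the form of a linear system with an
  invertible matrix, to which the results on systems with parameters apply.\<close>

definition lower :: "('a, 'e) chart \<Rightarrow> 'e \<Rightarrow> 'e \<Rightarrow> 'e" where
  "lower c x z = (\<Sum>b\<in>Basis. met c x z b *\<^sub>R b)"

context
  fixes c assumes c: "c \<in> atlas M"
begin

lemma dmet_bilinear: "x \<in> cdom c \<Longrightarrow> bilinear (\<lambda>a b. dmet c x a b v)"
  unfolding dmet_def
  by (rule bilinear_family_frechet_bilinear[OF open_cdom[OF c] met_bilinear[OF c] met_smooth[OF c]])

lemma dmet_linear: "x \<in> cdom c \<Longrightarrow> linear (dmet c x a b)"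
  unfolding dmet_def
  using smooth_on_has_derivative[OF open_cdom[OF c] met_smooth[OF c]] has_derivative_linear by blast

lemma dmet_smooth: "smooth_on (cdom c) (\<lambda>x. dmet c x a b v)"
  unfolding dmet_def by (rule smooth_on_frechet[OF met_smooth[OF c]])

lemma koszul_linear: "x \<in> cdom c \<Longrightarrow> linear (koszul c x a b)"
  unfolding koszul_def
  by (intro linear_compose_add linear_compose_sub dmet_linear)
    (use dmet_bilinear in \<open>auto simp: bilinear_def\<close>)

lemma lower_linear: "x \<in> cdom c \<Longrightarrow> linear (lower c x)"
  unfolding lower_def
  by (intro linearI)
    (simp_all add: bilinear_ladd bilinear_lmul met_bilinear[OF c] algebra_simps sum.distrib scaleR_sum_right)

lemma met_lower: "x \<in> cdom c \<Longrightarrow> met c x z w = lower c x z \<bullet> w"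
proof -
  assume x: "x \<in> cdom c"
  have "met c x z w = (\<Sum>b\<in>Basis. (w \<bullet> b) *\<^sub>R met c x z b)"
    by (rule linear_basis_sum) (use met_bilinear[OF c x] in \<open>simp add: bilinear_def\<close>)
  then show ?thesis by (simp add: lower_def inner_sum_right inner_commute[of _ w] mult.commute)
qed

lemma lower_inj: "x \<in> cdom c \<Longrightarrow> inj (lower c x)"
  using linear_injective_0[OF lower_linear] met_nondegenerate[OF c] met_lower by (metis inner_zero_left)

text \<open>Justifies the definite description: a solution exists because \<open>lower c x\<close>
  is injective, hence onto in finite dimension, and it is unique because the metric is
  nondegenerate.\<close>

lemma christoffel_iff:
  assumes x: "x \<in> cdom c"
  shows "z = \<Gamma> c x a b \<longleftrightarrow> (\<forall>w. 2 * met c x z w = koszul c x a b w)"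
proof -
  let ?P = "\<lambda>z. \<forall>w. 2 * met c x z w = koszul c x a b w"
  \<comment> \<open>The left-hand side represents half of the linear functional
    \<open>koszul c x a b\<close> with respect to the Euclidean inner product.\<close>
  obtain z where z: "(\<Sum>w\<in>Basis. (koszul c x a b w / 2) *\<^sub>R w) = lower c x z"
    using surjD[OF linear_inj_imp_surj[OF lower_linear[OF x] lower_inj[OF x]]] by blast
  have 1: "?P z"
  proof
    fix w
    have "koszul c x a b w = (\<Sum>i\<in>Basis. (w \<bullet> i) *\<^sub>R koszul c x a b i)"
      by (rule linear_basis_sum[OF koszul_linear[OF x]])
    then show "2 * met c x z w = koszul c x a b w"
      by (simp add: met_lower[OF x] z[symmetric] inner_sum_right sum_distrib_left inner_commute[of _ w] mult.commute)
  qed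
  have 2: "y = y'" if "?P y" "?P y'" for y y'
  proof -
    have "met c x (y - y') w = 0" for w
      using that by (simp add: bilinear_lsub[OF met_bilinear[OF c x]] algebra_simps) (smt (verit))
    then have "y - y' = 0" using met_nondegenerate[OF c x] by blast
    then show ?thesis by simp
  qed
  have "\<Gamma> c x a b = (THE z. ?P z)"
    by (simp add: christoffel_def koszul_def dmet_def)
  moreover have "?P (THE z. ?P z)" by (rule theI2[of ?P, OF 1 2[OF _ 1]]) auto
  ultimately show ?thesis using 2 by auto
qed

lemma met_christoffel: "x \<in> cdom c \<Longrightarrow> 2 * met c x (\<Gamma> c x a b) w = koszul c x a b w"
  using christoffel_iff by blast

lemma christoffel_zero: "x \<in> cdom c \<Longrightarrow> \<Gamma> c x 0 0 = 0"
proof -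
  assume x: "x \<in> cdom c"
  have "0 = \<Gamma> c x 0 0"
    unfolding christoffel_iff[OF x] koszul_def
    using linear_0[OF dmet_linear[OF x]] bilinear_lzero[OF dmet_bilinear[OF x]] bilinear_lzero[OF met_bilinear[OF c x]]
    by simp
  then show ?thesis by simp
qed

text \<open>The vector \<open>\<Gamma> c x a a\<close> solves a linear system with matrix
  \<open>lower c x\<close> and a right-hand side that is polynomial in \<open>a\<close> with smooth
  coefficients. Only the diagonal enters the geodesic equation, hence the single vector
  argument.\<close>

lemma christoffel_smooth: "smooth_on (cdom c \<times> UNIV) (\<lambda>(x, a). \<Gamma> c x a a)"
  unfolding smooth_on_def
proof
  fix k
  let ?S = "cdom c \<times> (UNIV :: 'e set)"
  have S: "open ?S" using open_cdom[OF c] by (simp add: open_Times)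
  have comp: "Ck_on k ?S (\<lambda>z. f (fst z))" if "smooth_on (cdom c) f" for f :: "'e \<Rightarrow> real"
    using Ck_on_compose[OF S open_cdom[OF c] _ Ck_on_linear[OF bounded_linear_fst S] smooth_onD[OF that]]
    by (auto simp: o_def)
  have snd: "Ck_on k ?S (\<lambda>z. snd z \<bullet> i)" for i
    by (rule Ck_on_linear[OF bounded_linear_compose[OF bounded_linear_inner_left bounded_linear_snd] S])
  have lower: "Ck_on k ?S (\<lambda>z. lower c (fst z) b)" for b
    unfolding lower_def by (intro Ck_on_sum Ck_on_scaleR Ck_on_const comp met_smooth[OF c] S)
  \<comment> \<open>With equal arguments the first two Koszul terms coincide, which gives the factor
    2.\<close>
  let ?K = "\<lambda>z w. 2 * (\<Sum>i\<in>Basis. \<Sum>j\<in>Basis. (snd z \<bullet> i) * ((snd z \<bullet> j) * dmet c (fst z) i w j)) -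
      (\<Sum>i\<in>Basis. \<Sum>j\<in>Basis. (snd z \<bullet> i) * ((snd z \<bullet> j) * dmet c (fst z) i j w))"
  have K: "koszul c (fst z) (snd z) (snd z) w = ?K z w" if z: "z \<in> ?S" for z w
  proof -
    have x: "fst z \<in> cdom c" using z by auto
    let ?a = "snd z"
    have "dmet c (fst z) ?a w ?a = (\<Sum>i\<in>Basis. (?a \<bullet> i) *\<^sub>R dmet c (fst z) i w ?a)"
      by (rule linear_basis_sum[where L="\<lambda>i. dmet c (fst z) i w ?a"])
        (use dmet_bilinear[OF x] in \<open>simp add: bilinear_def\<close>)
    also have "\<dots> = (\<Sum>i\<in>Basis. (?a \<bullet> i) *\<^sub>R (\<Sum>j\<in>Basis. (?a \<bullet> j) *\<^sub>R dmet c (fst z) i w j))"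
      by (intro sum.cong arg_cong2[where f=scaleR] linear_basis_sum dmet_linear x refl)
    finally have 1: "dmet c (fst z) ?a w ?a = (\<Sum>i\<in>Basis. \<Sum>j\<in>Basis. (?a \<bullet> i) * ((?a \<bullet> j) * dmet c (fst z) i w j))"
      by (simp add: sum_distrib_left)
    have 2: "dmet c (fst z) ?a ?a w = (\<Sum>i\<in>Basis. \<Sum>j\<in>Basis. (?a \<bullet> i) * ((?a \<bullet> j) * dmet c (fst z) i j w))"
      using bilinear_basis_sum[OF dmet_bilinear[OF x], of ?a ?a w] by (simp add: mult.assoc)
    show ?thesis unfolding koszul_def 1 2 by simp
  qed
  show "Ck_on k ?S (\<lambda>(x, a). \<Gamma> c x a a)"
  proof (rule Ck_on_linear_solve[OF S, where G="\<lambda>z. lower c (fst z)"])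
    show "Ck_on k ?S (\<lambda>z. \<Sum>w\<in>Basis. (1/2 * ?K z w) *\<^sub>R w)"
      by (intro Ck_on_sum Ck_on_diff Ck_on_scaleR Ck_on_mult Ck_on_const comp dmet_smooth snd S)
    fix z assume z: "z \<in> ?S"
    have x: "fst z \<in> cdom c" using z by auto
    have "lower c (fst z) (\<Gamma> c (fst z) (snd z) (snd z)) =
        (\<Sum>w\<in>Basis. (1/2 * koszul c (fst z) (snd z) (snd z) w) *\<^sub>R w)"
      unfolding lower_def by (intro sum.cong refl) (simp add: met_christoffel[OF x, symmetric])
    then show "lower c (fst z) (case z of (x, a) \<Rightarrow> \<Gamma> c x a a) = (\<Sum>w\<in>Basis. (1/2 * ?K z w) *\<^sub>R w)"
      by (simp only: K[OF z] case_prod_beta)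
  qed (auto intro: lower_linear lower_inj lower)
qed

end

definition hess :: "('a, 'e) chart \<Rightarrow> ('a, 'e) chart \<Rightarrow> 'e \<Rightarrow> 'e \<Rightarrow> 'e \<Rightarrow> 'e" where
  "hess c d x a b = fderiv (\<lambda>x. dtrans c d x a) x b"

context
  fixes c d x assumes c: "c \<in> atlas M" and d: "d \<in> atlas M" and x: "x \<in> overlap c d"
begin

lemma hess_sym: "hess c d x a b = hess c d x b a"
  unfolding hess_def dtrans_def
  by (rule mixed_derivatives_commute[OF open_overlap[OF c d] smooth_onD[OF transition_smooth[OF c d]] x])

lemma dtrans_has_derivative: "((\<lambda>x. dtrans c d x a) has_derivative hess c d x a) (at x)"
  unfolding hess_def
  by (rule smooth_on_has_derivative[OF open_overlap[OF c d] dtrans_smooth[OF c d] x])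

text \<open>The product rule applied to \<open>met_transition\<close>; the two extra terms come from
  differentiating the transition derivative.\<close>

lemma dmet_transition:
  "dmet c x a b v = dmet d (tmap c d x) (dtrans c d x a) (dtrans c d x b) (dtrans c d x v)
     + met d (tmap c d x) (hess c d x a v) (dtrans c d x b)
     + met d (tmap c d x) (dtrans c d x a) (hess c d x b v)"
proof -
  have "fderiv (\<lambda>y. met c y a b) x =
      fderiv (\<lambda>y. met d (tmap c d y) (dtrans c d y a) (dtrans c d y b)) x"
    by (rule frechet_derivative_cong[OF open_overlap[OF c d] x]) (rule met_transition[OF c d])
  also have "\<dots> = (\<lambda>v. dmet d (tmap c d x) (dtrans c d x a) (dtrans c d x b) (dtrans c d x v)
     + met d (tmap c d x) (hess c d x a v) (dtrans c d x b)
     + met d (tmap c d x) (dtrans c d x a) (hess c d x b v))"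
    unfolding dmet_def
    by (rule frechet_derivative_at[symmetric])
      (intro bilinear_family_has_derivative[OF open_cdom[OF d] met_bilinear[OF d] met_smooth[OF d]]
        transition_has_derivative[OF c d x] dtrans_has_derivative transition_dom[OF c d x])
  finally show ?thesis by (simp add: dmet_def)
qed

text \<open>In the Koszul combination the second derivatives of the transition map cancel by
  symmetry, except for twice the product of \<open>hess c d x a b\<close> with the image of
  \<open>w\<close>. Since \<open>dtrans c d x\<close> is onto and the metric nondegenerate, this
  determines the inhomogeneous term.\<close>

lemma christoffel_transition:
  "dtrans c d x (\<Gamma> c x a b) =
    \<Gamma> d (tmap c d x) (dtrans c d x a) (dtrans c d x b) + hess c d x a b"
proof -
  let ?y = "tmap c d x" and ?D = "dtrans c d x"
  have xc: "x \<in> cdom c" using x overlap_iff[OF c] by blast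
  have y: "?y \<in> cdom d" by (rule transition_dom[OF c d x])
  let ?z = "?D (\<Gamma> c x a b) - \<Gamma> d ?y (?D a) (?D b) - hess c d x a b"
  have "met d ?y ?z (?D w) = 0" for w
  proof -
    have "2 * met d ?y (?D (\<Gamma> c x a b)) (?D w) = koszul c x a b w"
      using met_christoffel[OF c xc] met_transition[OF c d x] by simp
    also have "\<dots> = koszul d ?y (?D a) (?D b) (?D w) + 2 * met d ?y (hess c d x a b) (?D w)"
      unfolding koszul_def dmet_transition
      using hess_sym met_sym[OF d y] by (simp add: hess_sym[of b a] hess_sym[of w])
    also have "koszul d ?y (?D a) (?D b) (?D w) = 2 * met d ?y (\<Gamma> d ?y (?D a) (?D b)) (?D w)"
      by (rule met_christoffel[OF d y, symmetric])
    finally show ?thesis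
      by (simp add: bilinear_lsub[OF met_bilinear[OF d y]])
  qed
  then have "met d ?y ?z w = 0" for w
    using dtrans_inverse(2)[OF c d x, of w] by metis
  then have "?z = 0" by (rule met_nondegenerate[OF d y])
  then show ?thesis by (simp add: algebra_simps)
qed

end

section \<open>Geodesics\<close>

definition phase :: "('a, 'e) chart \<Rightarrow> ('e \<times> 'e) set" where "phase c = cdom c \<times> UNIV"

text \<open>The geodesic spray: the geodesic equation as an autonomous first-order equation for
  position and velocity.\<close>

definition spray :: "('a, 'e) chart \<Rightarrow> 'e \<times> 'e \<Rightarrow> 'e \<times> 'e" where
  "spray c = (\<lambda>(x, v). (v, - \<Gamma> c x v v))"

definition tcoord :: "('a, 'e) chart \<Rightarrow> 'a \<times> ('a, 'e) tvec \<Rightarrow> 'e \<times> 'e" where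
  "tcoord c = (\<lambda>(p, v). (snd c p, v c))"

abbreviation "TM \<equiv> tangent_bundle (atlas M)"

lemma in_TM: "(p, v) \<in> TM \<longleftrightarrow> v \<in> tspace p"
  by (simp add: tangent_bundle_def)

lemma open_phase: "c \<in> atlas M \<Longrightarrow> open (phase c)"
  unfolding phase_def using open_cdom by (simp add: open_Times)

lemma spray_smooth: "c \<in> atlas M \<Longrightarrow> smooth_on (phase c) (spray c)"
proof -
  assume c: "c \<in> atlas M"
  have "Ck_on k (phase c) (\<lambda>z. (snd z, - (case z of (x, a) \<Rightarrow> \<Gamma> c x a a)))" for k
    using smooth_onD[OF christoffel_smooth[OF c]] open_phase[OF c]
    by (intro Ck_on_Pair Ck_on_linear[OF bounded_linear_snd] Ck_on_minus) (simp_all add: phase_def)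
  then show ?thesis by (simp add: smooth_on_def spray_def case_prod_beta')
qed

lemma tcoord_inj:
  assumes "c \<in> atlas M" "X \<in> TM" "Y \<in> TM" "fst X \<in> fst c" "fst Y \<in> fst c" "tcoord c X = tcoord c Y"
  shows "X = Y"
proof -
  obtain p v q w where *: "X = (p, v)" "Y = (q, w)" by fastforce
  have "p = q" using assms * chart_inv_chart[OF assms(1)] by (metis fst_conv tcoord_def case_prod_conv)
  moreover have "v = w"
    using tspace_ext[OF assms(1), of p v w] assms * \<open>p = q\<close> by (simp add: in_TM tcoord_def)
  ultimately show ?thesis using * by simp
qed

lemma smooth_curveD:
  assumes "smooth_curve M J \<gamma>"
  shows "open J" "is_interval J" "J \<noteq> {}" "continuous_on J \<gamma>"
    "c \<in> atlas M \<Longrightarrow> smooth_on {t \<in> J. \<gamma> t \<in> fst c} (snd c \<circ> \<gamma>)"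
    "c \<in> atlas M \<Longrightarrow> open {t \<in> J. \<gamma> t \<in> fst c}"
proof -
  show "open J" "is_interval J" "J \<noteq> {}" "continuous_on J \<gamma>"
    using assms by (auto simp: smooth_curve_def)
  show "c \<in> atlas M \<Longrightarrow> smooth_on {t \<in> J. \<gamma> t \<in> fst c} (snd c \<circ> \<gamma>)"
    using assms by (simp add: smooth_curve_def)
  assume "c \<in> atlas M"
  then have "open (J \<inter> \<gamma> -` fst c)"
    using \<open>open J\<close> \<open>continuous_on J \<gamma>\<close> open_chart continuous_open_preimage by blast
  then show "open {t \<in> J. \<gamma> t \<in> fst c}" by (simp add: vimage_def Int_def)
qed

lemma fst_vel: "fst (vel \<gamma> t) = \<gamma> t" by (simp add: velocity_def)

lemma tcoord_vel:
  "c \<in> atlas M \<Longrightarrow> \<gamma> t \<in> fst c \<Longrightarrow>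
    tcoord c (vel \<gamma> t) = ((snd c \<circ> \<gamma>) t, vderiv (snd c \<circ> \<gamma>) t)"
  by (simp add: tcoord_def velocity_def)

lemma velocity_cong:
  assumes "open T" "t \<in> T" "\<And>s. s \<in> T \<Longrightarrow> \<gamma> s = \<gamma>' s"
  shows "vel \<gamma> t = vel \<gamma>' t"
proof -
  have 1: "vderiv (snd c \<circ> \<gamma>) t = vderiv (snd c \<circ> \<gamma>') t" for c :: "('a, 'e) chart"
    by (rule vector_derivative_cong_open[OF assms(1,2)]) (simp add: assms(3))
  show ?thesis unfolding velocity_def 1 assms(3)[OF assms(2)] ..
qed

text \<open>The transformation law of the components is the chain rule for
  \<open>tmap c d \<circ> (snd c \<circ> \<gamma>)\<close>.\<close>

lemma velocity_in_TM:
  assumes \<gamma>: "smooth_curve M J \<gamma>" and t: "t \<in> J"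
  shows "vel \<gamma> t \<in> TM"
proof -
  have key: "vderiv (snd d \<circ> \<gamma>) t = dtrans c d (snd c (\<gamma> t)) (vderiv (snd c \<circ> \<gamma>) t)"
    if c: "c \<in> atlas M" and d: "d \<in> atlas M" and p: "\<gamma> t \<in> fst c" "\<gamma> t \<in> fst d" for c d
  proof -
    let ?T = "{t \<in> J. \<gamma> t \<in> fst c} \<inter> {t \<in> J. \<gamma> t \<in> fst d}"
    have T: "open ?T" "t \<in> ?T" using smooth_curveD(6)[OF \<gamma> c] smooth_curveD(6)[OF \<gamma> d] t p by auto
    have x': "(snd c \<circ> \<gamma> has_vector_derivative vderiv (snd c \<circ> \<gamma>) t) (at t)"
      using smooth_on_vector_derivative(1)[OF smooth_curveD(6)[OF \<gamma> c] smooth_curveD(5)[OF \<gamma> c]] t p by simp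
    have "(tmap c d has_derivative dtrans c d (snd c (\<gamma> t))) (at ((snd c \<circ> \<gamma>) t) within range (snd c \<circ> \<gamma>))"
      using transition_has_derivative[OF c d chart_overlap[OF c p]] by (simp add: has_derivative_at_withinI)
    from vector_derivative_diff_chain_within[OF x' this]
    have "(tmap c d \<circ> (snd c \<circ> \<gamma>) has_vector_derivative
        dtrans c d (snd c (\<gamma> t)) (vderiv (snd c \<circ> \<gamma>) t)) (at t)" .
    then have "(snd d \<circ> \<gamma> has_vector_derivative
        dtrans c d (snd c (\<gamma> t)) (vderiv (snd c \<circ> \<gamma>) t)) (at t)"
      by (rule has_vector_derivative_transform_within_open[OF _ T]) (simp add: transition_chart[OF c])
    then show ?thesis by (rule vector_derivative_at)
  qed
  show ?thesis
    unfolding velocity_def in_TM tangent_space_def transition_deriv_eq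
  proof (intro CollectI conjI ballI allI impI, goal_cases)
    case (1 c d)
    then show ?case using key[OF 1] by simp
  next
    case (2 c)
    then show ?case by auto
  qed
qed

lemma geodesicD: "geo J \<gamma> \<Longrightarrow> smooth_curve M J \<gamma>" by (simp add: geodesic_def)

abbreviation "cvel c \<gamma> t \<equiv> tcoord c (vel \<gamma> t)"

lemmas geo_curve = smooth_curveD[OF geodesicD]
lemmas geo_TM = velocity_in_TM[OF geodesicD]

lemma geodesic_spray:
  assumes \<gamma>: "geo J \<gamma>" and t: "t \<in> J" and c: "c \<in> atlas M" and p: "\<gamma> t \<in> fst c"
  shows "((\<lambda>s. cvel c \<gamma> s) has_vector_derivative spray c (cvel c \<gamma> t)) (at t)"
proof -
  note sc = geo_curve[OF \<gamma>]
  let ?T = "{t \<in> J. \<gamma> t \<in> fst c}" and ?x = "snd c \<circ> \<gamma>"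
  let ?x' = "\<lambda>s. vderiv ?x s"
  have T: "open ?T" "t \<in> ?T" using sc(6)[OF c] t p by auto
  have x: "(?x has_vector_derivative ?x' t) (at t)"
    using smooth_on_vector_derivative(1)[OF T(1) sc(5)[OF c] T(2)] .
  have x': "(?x' has_vector_derivative vderiv ?x' t) (at t)"
    using smooth_on_vector_derivative(1)[OF T(1) smooth_on_vector_derivative(2)[OF T(1) sc(5)[OF c]] T(2)] .
  have "vderiv ?x' t = - \<Gamma> c (?x t) (?x' t) (?x' t)"
    using \<gamma> t c p unfolding geodesic_def Let_def by (metis eq_neg_iff_add_eq_0)
  then have "((\<lambda>s. (?x s, ?x' s)) has_vector_derivative spray c (?x t, ?x' t)) (at t)"
    using has_vector_derivative_Pair[OF x x'] by (simp add: spray_def)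
  then have "((\<lambda>s. cvel c \<gamma> s) has_vector_derivative spray c (?x t, ?x' t)) (at t)"
    by (rule has_vector_derivative_transform_within_open[OF _ T]) (simp add: tcoord_vel[OF c])
  then show ?thesis by (simp add: tcoord_vel[where \<gamma>=\<gamma> and t=t, OF c p])
qed

lemma tcoord_vel_phase: "c \<in> atlas M \<Longrightarrow> \<gamma> t \<in> fst c \<Longrightarrow> cvel c \<gamma> t \<in> phase c"
  by (simp add: phase_def tcoord_def velocity_def chart_in)

lemma hess_linear_left:
  assumes "c \<in> atlas M" "d \<in> atlas M" "x \<in> overlap c d"
  shows "linear (\<lambda>a. hess c d x a b)"
proof -
  have "hess c d x b = (\<lambda>a. hess c d x a b)" by (rule ext) (rule hess_sym[OF assms])
  then show ?thesis using has_derivative_linear[OF dtrans_has_derivative[OF assms, of b]] by metis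
qed

text \<open>A second-order chain rule: the velocity components are transformed by a matrix that
  moves along the curve, and its derivative contributes the \<open>hess\<close> term.\<close>

lemma dtrans_curve_derivative:
  assumes c: "c \<in> atlas M" and d: "d \<in> atlas M" and o: "x t \<in> overlap c d"
    and x: "(x has_vector_derivative x') (at t)" and v: "(v has_vector_derivative v') (at t)"
  shows "((\<lambda>s. dtrans c d (x s) (v s)) has_vector_derivative
    dtrans c d (x t) v' + hess c d (x t) (v t) x') (at t)"
proof -
  have D: "((\<lambda>s. dtrans c d (x s) i) has_vector_derivative hess c d (x t) i x') (at t)" for i
    using vector_derivative_diff_chain_within[OF x has_derivative_at_withinI[OF dtrans_has_derivative[OF c d o]]]
    by (simp add: o_def)
  have v_i: "((\<lambda>s. v s \<bullet> i) has_vector_derivative v' \<bullet> i) (at t)" for i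
    by (rule bounded_linear.has_vector_derivative[OF bounded_linear_inner_left v])
  have "((\<lambda>s. \<Sum>i\<in>Basis. (v s \<bullet> i) *\<^sub>R dtrans c d (x s) i) has_vector_derivative
      (\<Sum>i\<in>Basis. (v t \<bullet> i) *\<^sub>R hess c d (x t) i x' + (v' \<bullet> i) *\<^sub>R dtrans c d (x t) i)) (at t)"
    by (intro has_vector_derivative_sum has_vector_derivative_scaleR D)
      (use v_i in \<open>simp add: has_real_derivative_iff_has_vector_derivative\<close>)
  moreover have "(\<Sum>i\<in>Basis. (v t \<bullet> i) *\<^sub>R hess c d (x t) i x' + (v' \<bullet> i) *\<^sub>R dtrans c d (x t) i) =
      dtrans c d (x t) v' + hess c d (x t) (v t) x'"
    using linear_basis_sum[OF dtrans_linear[OF c d o], of v'] linear_basis_sum[OF hess_linear_left[OF c d o, of x'], of "v t"]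
    by (simp add: sum.distrib)
  ultimately have 1: "((\<lambda>s. \<Sum>i\<in>Basis. (v s \<bullet> i) *\<^sub>R dtrans c d (x s) i) has_vector_derivative
      dtrans c d (x t) v' + hess c d (x t) (v t) x') (at t)" by simp
  have "isCont x t" using x has_vector_derivative_continuous by blast
  then obtain T where T: "open T" "t \<in> T" "\<And>s. s \<in> T \<Longrightarrow> x s \<in> overlap c d"
    using open_overlap[OF c d] o unfolding continuous_at_open by meson
  show ?thesis
    by (rule has_vector_derivative_transform_within_open[OF 1 T(1,2)])
      (rule linear_basis_sum[OF dtrans_linear[OF c d T(3)], symmetric])
qed

text \<open>The solution lives in one chart, but \<open>geodesic\<close> demands the equation in all
  of them. In another chart the \<open>hess\<close> term of the second derivative is cancelled by
  the one in the transformation law of the Christoffel symbols.\<close>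

lemma spray_geodesic:
  assumes I: "open I" "is_interval I" "I \<noteq> {}" and c: "c \<in> atlas M"
    and u: "\<And>t. t \<in> I \<Longrightarrow> (u has_vector_derivative spray c (u t)) (at t) \<and> u t \<in> phase c"
    and \<gamma>: "\<And>t. t \<in> I \<Longrightarrow> \<gamma> t = chart_inv c (fst (u t))"
  shows "geo I \<gamma>" and "t \<in> I \<Longrightarrow> cvel c \<gamma> t = u t"
proof -
  have us: "smooth_on I u"
    by (rule ode_solution_smooth[OF open_phase[OF c] spray_smooth[OF c] I(1) u])
  define x v where "x = fst \<circ> u" and "v = snd \<circ> u"
  have xs: "smooth_on I x" "smooth_on I v"
    using us Ck_on_bounded_linear[OF bounded_linear_fst I(1), where f=u]
      Ck_on_bounded_linear[OF bounded_linear_snd I(1), where f=u]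
    by (auto simp: smooth_on_def x_def v_def o_def)
  have xdom: "x t \<in> cdom c" if "t \<in> I" for t
    using u[OF that] by (auto simp: phase_def x_def mem_Times_iff)
  have x': "(x has_vector_derivative v t) (at t)" if "t \<in> I" for t
    using bounded_linear.has_vector_derivative[OF bounded_linear_fst conjunct1[OF u[OF that]]]
    by (simp add: x_def v_def spray_def o_def case_prod_beta)
  have v': "(v has_vector_derivative - \<Gamma> c (x t) (v t) (v t)) (at t)" if "t \<in> I" for t
    using bounded_linear.has_vector_derivative[OF bounded_linear_snd conjunct1[OF u[OF that]]]
    by (simp add: x_def v_def spray_def o_def case_prod_beta)
  have \<gamma>x: "\<gamma> t = chart_inv c (x t)" if "t \<in> I" for t using \<gamma>[OF that] by (simp add: x_def)
  have \<gamma>dom: "\<gamma> t \<in> fst c" if "t \<in> I" for t using \<gamma>x[OF that] chart_inv_in[OF c xdom[OF that]] by simp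
  have cont: "continuous_on I \<gamma>"
  proof -
    have "continuous_on I (\<lambda>t. chart_inv c (x t))"
      by (rule continuous_on_compose2[OF chart_inv_continuous[OF c] smooth_on_continuous[OF xs(1)]]) (use xdom in auto)
    then show ?thesis by (rule continuous_on_eq) (simp add: \<gamma>x)
  qed
  let ?T = "\<lambda>d. {t \<in> I. \<gamma> t \<in> fst d}"
  have T: "open (?T d)" if "d \<in> atlas M" for d
    using continuous_open_preimage[OF cont I(1) open_chart[OF that]] by (simp add: vimage_def Int_def)
  have xo: "x t \<in> overlap c d" if "t \<in> ?T d" for t d
    using that overlap_iff[OF c] xdom \<gamma>x by auto
  have yx: "(tmap c d \<circ> x) t = (snd d \<circ> \<gamma>) t" if "t \<in> I" for t and d :: "('a, 'e) chart"
    using that \<gamma>x by (simp add: tmap_def)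
  have ysm: "smooth_on (?T d) (snd d \<circ> \<gamma>)" if d: "d \<in> atlas M" for d
  proof -
    have "smooth_on (?T d) (tmap c d \<circ> x)"
      by (rule smooth_on_compose[OF T[OF d] open_overlap[OF c d] _ _ transition_smooth[OF c d]])
        (use xo[of _ d] smooth_on_subset[OF xs(1)] in auto)
    then show ?thesis by (rule smooth_on_cong[OF T[OF d], rotated]) (use yx[of _ d] in simp)
  qed
  have sc: "smooth_curve M I \<gamma>" unfolding smooth_curve_def using I cont ysm by blast
  have y': "vderiv (snd d \<circ> \<gamma>) t = dtrans c d (x t) (v t)" if d: "d \<in> atlas M" and t: "t \<in> ?T d" for d t
  proof -
    have "(tmap c d \<circ> x has_vector_derivative dtrans c d (x t) (v t)) (at t)"
      using vector_derivative_diff_chain_within[OF x' has_derivative_at_withinI[OF transition_has_derivative[OF c d xo[OF t]]]] t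
      by simp
    then have "(snd d \<circ> \<gamma> has_vector_derivative dtrans c d (x t) (v t)) (at t)"
      by (rule has_vector_derivative_transform_within_open[OF _ T[OF d] t]) (use yx[of _ d] in simp)
    then show ?thesis by (rule vector_derivative_at)
  qed
  have ode: "vderiv (\<lambda>s. vderiv (snd d \<circ> \<gamma>) s) t +
      \<Gamma> d ((snd d \<circ> \<gamma>) t) (vderiv (snd d \<circ> \<gamma>) t) (vderiv (snd d \<circ> \<gamma>) t) = 0"
    if d: "d \<in> atlas M" and t: "t \<in> ?T d" for d t
  proof -
    have tI: "t \<in> I" using t by simp
    let ?a = "dtrans c d (x t) (- \<Gamma> c (x t) (v t) (v t)) + hess c d (x t) (v t) (v t)"
    have "((\<lambda>s. dtrans c d (x s) (v s)) has_vector_derivative ?a) (at t)"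
      by (rule dtrans_curve_derivative[OF c d xo[OF t] x'[OF tI] v'[OF tI]])
    then have "((\<lambda>s. vderiv (snd d \<circ> \<gamma>) s) has_vector_derivative ?a) (at t)"
      by (rule has_vector_derivative_transform_within_open[OF _ T[OF d] t]) (simp add: y'[OF d])
    then have "vderiv (\<lambda>s. vderiv (snd d \<circ> \<gamma>) s) t = ?a"
      by (rule vector_derivative_at)
    moreover have "(snd d \<circ> \<gamma>) t = tmap c d (x t)" using yx[OF tI, of d] by simp
    ultimately show ?thesis
      using christoffel_transition[OF c d xo[OF t], of "v t" "v t"] linear_neg[OF dtrans_linear[OF c d xo[OF t]]]
      by (simp add: y'[OF d t])
  qed
  show "geo I \<gamma>" unfolding geodesic_def Let_def using sc ode by blast
  show "cvel c \<gamma> t = u t" if t: "t \<in> I" for t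
  proof -
    have "snd c (\<gamma> t) = x t" using \<gamma>x[OF t] chart_chart_inv[OF c xdom[OF t]] by simp
    moreover have "vderiv (snd c \<circ> \<gamma>) t = v t"
      using y'[OF c, of t] t \<gamma>dom[OF t] dtrans_self[OF c xdom[OF t]] by simp
    ultimately show ?thesis using tcoord_vel[where \<gamma>=\<gamma> and t=t, OF c \<gamma>dom[OF t]] by (simp add: x_def v_def)
  qed
qed

section \<open>Gluing and uniqueness of geodesics\<close>

lemma geodesic_local:
  assumes J: "open J" "is_interval J" "J \<noteq> {}"
    and loc: "\<And>t. t \<in> J \<Longrightarrow> \<exists>I \<gamma>'. geo I \<gamma>' \<and> t \<in> I \<and> (\<forall>s\<in>I \<inter> J. \<gamma> s = \<gamma>' s)"
  shows "geo J \<gamma>"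
proof -
  have ex: "\<exists>I \<gamma>'. geo I \<gamma>' \<and> t \<in> I \<and> open (I \<inter> J) \<and> (\<forall>s\<in>I \<inter> J. \<gamma> s = \<gamma>' s)" if "t \<in> J" for t
    using loc[OF that] smooth_curveD(1) geodesicD J(1) by (metis open_Int)
  have cont: "continuous_on J \<gamma>"
  proof (rule continuous_at_imp_continuous_on, rule ballI)
    fix t assume t: "t \<in> J"
    obtain I \<gamma>' where I: "geo I \<gamma>'" "t \<in> I" "open (I \<inter> J)" "\<forall>s\<in>I \<inter> J. \<gamma> s = \<gamma>' s"
      using ex[OF t] by blast
    have "continuous_on (I \<inter> J) \<gamma>'"
      using geo_curve(4)[OF I(1)] continuous_on_subset by blast
    then have "continuous_on (I \<inter> J) \<gamma>" by (rule continuous_on_eq) (simp add: I(4))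
    then show "isCont \<gamma> t" using I(2,3) t continuous_on_eq_continuous_at by blast
  qed
  have T: "open {t \<in> J. \<gamma> t \<in> fst c}" if "c \<in> atlas M" for c
    using continuous_open_preimage[OF cont J(1) open_chart[OF that]] by (simp add: vimage_def Int_def)
  have sm: "smooth_on {t \<in> J. \<gamma> t \<in> fst c} (snd c \<circ> \<gamma>)" if c: "c \<in> atlas M" for c
  proof (rule smooth_on_local[OF T[OF c]])
    fix t assume t: "t \<in> {t \<in> J. \<gamma> t \<in> fst c}"
    then obtain I \<gamma>' where I: "geo I \<gamma>'" "t \<in> I" "open (I \<inter> J)" "\<forall>s\<in>I \<inter> J. \<gamma> s = \<gamma>' s"
      using ex by blast
    let ?S = "(I \<inter> J) \<inter> {t \<in> J. \<gamma> t \<in> fst c}"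
    have "smooth_on {t \<in> I. \<gamma>' t \<in> fst c} (snd c \<circ> \<gamma>')"
      using geo_curve(5)[OF I(1) c] .
    then have "smooth_on ?S (snd c \<circ> \<gamma>')" by (rule smooth_on_subset) (use I(4) in auto)
    then have "smooth_on ?S (snd c \<circ> \<gamma>)"
      by (rule smooth_on_cong[rotated 2]) (use I(3,4) T[OF c] in auto)
    then show "\<exists>T. open T \<and> t \<in> T \<and> smooth_on (T \<inter> {t \<in> J. \<gamma> t \<in> fst c}) (snd c \<circ> \<gamma>)"
      using I(2,3) t by blast
  qed
  have ode: "vderiv (\<lambda>s. vderiv (snd c \<circ> \<gamma>) s) t +
      \<Gamma> c ((snd c \<circ> \<gamma>) t) (vderiv (snd c \<circ> \<gamma>) t) (vderiv (snd c \<circ> \<gamma>) t) = 0"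
    if c: "c \<in> atlas M" and t: "t \<in> J" "\<gamma> t \<in> fst c" for c t
  proof -
    obtain I \<gamma>' where I: "geo I \<gamma>'" "t \<in> I" "open (I \<inter> J)" "\<forall>s\<in>I \<inter> J. \<gamma> s = \<gamma>' s"
      using ex t by blast
    have 1: "vderiv (snd c \<circ> \<gamma>) s = vderiv (snd c \<circ> \<gamma>') s" if "s \<in> I \<inter> J" for s
      by (rule vector_derivative_cong_open[OF I(3) that]) (use I(4) in simp)
    have tI: "t \<in> I \<inter> J" using I(2) t by simp
    have "vderiv (\<lambda>s. vderiv (snd c \<circ> \<gamma>) s) t =
        vderiv (\<lambda>s. vderiv (snd c \<circ> \<gamma>') s) t"
      by (rule vector_derivative_cong_open[OF I(3) tI]) (rule 1)
    moreover have "\<gamma>' t = \<gamma> t" using I(4) tI by simp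
    ultimately show ?thesis
      using I(1) c I(2) t(2) unfolding geodesic_def Let_def o_apply 1[OF tI] by metis
  qed
  show ?thesis unfolding geodesic_def Let_def smooth_curve_def using J cont sm ode by blast
qed

lemma velocity_continuous_chart:
  assumes \<gamma>: "geo J \<gamma>" and t: "t \<in> J" and c: "c \<in> atlas M" and p: "\<gamma> t \<in> fst c"
  shows "isCont (\<lambda>s. cvel c \<gamma> s) t"
  using geodesic_spray[OF assms] has_vector_derivative_continuous by blast

lemma geodesic_unique_local:
  assumes \<gamma>1: "geo J1 \<gamma>1" and \<gamma>2: "geo J2 \<gamma>2" and a: "a \<in> J1" "a \<in> J2"
    and eq: "vel \<gamma>1 a = vel \<gamma>2 a"
  shows "\<exists>e>0. \<forall>t. \<bar>t - a\<bar> < e \<longrightarrow> vel \<gamma>1 t = vel \<gamma>2 t"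
proof -
  obtain c where c: "c \<in> atlas M" "\<gamma>1 a \<in> fst c" by (rule chartE)
  have eq_a: "\<gamma>1 a = \<gamma>2 a" using eq by (metis fst_vel)
  let ?J = "{t \<in> J1. \<gamma>1 t \<in> fst c} \<inter> {t \<in> J2. \<gamma>2 t \<in> fst c}"
  have J: "open ?J" "a \<in> ?J"
    using geo_curve(6)[OF \<gamma>1 c(1)] geo_curve(6)[OF \<gamma>2 c(1)] a c(2) eq_a by auto
  have "\<exists>e>0. \<forall>t. \<bar>t - a\<bar> < e \<longrightarrow> cvel c \<gamma>1 t = cvel c \<gamma>2 t"
  proof (rule ode_unique_local[OF open_phase[OF c(1)] smooth_onD[OF spray_smooth[OF c(1)]] J])
    show "cvel c \<gamma>1 a \<in> phase c" by (rule tcoord_vel_phase) (use c in auto)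
    fix s assume "s \<in> ?J"
    then show "((\<lambda>t. cvel c \<gamma>1 t) has_vector_derivative spray c (cvel c \<gamma>1 s)) (at s)"
      "((\<lambda>t. cvel c \<gamma>2 t) has_vector_derivative spray c (cvel c \<gamma>2 s)) (at s)"
      using geodesic_spray[OF \<gamma>1 _ c(1)] geodesic_spray[OF \<gamma>2 _ c(1)] by blast+
  qed (simp add: eq)
  then obtain e where e: "e > 0" "\<And>t. \<bar>t - a\<bar> < e \<Longrightarrow> cvel c \<gamma>1 t = cvel c \<gamma>2 t"
    by blast
  obtain e' where e': "e' > 0" "ball a e' \<subseteq> ?J" using J openE by blast
  have "vel \<gamma>1 t = vel \<gamma>2 t" if t: "\<bar>t - a\<bar> < min e e'" for t
  proof (rule tcoord_inj[OF c(1)])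
    have "t \<in> ball a e'" using t by (simp add: dist_real_def abs_minus_commute)
    then have tJ: "t \<in> ?J" using e'(2) by blast
    then show "vel \<gamma>1 t \<in> TM" "vel \<gamma>2 t \<in> TM"
      using velocity_in_TM geodesicD \<gamma>1 \<gamma>2 by blast+
    show "fst (vel \<gamma>1 t) \<in> fst c" "fst (vel \<gamma>2 t) \<in> fst c"
      using tJ by (auto simp: fst_vel)
    show "cvel c \<gamma>1 t = cvel c \<gamma>2 t" using e(2) t by simp
  qed
  then show ?thesis using e(1) e'(1) by (intro exI[of _ "min e e'"]) auto
qed

text \<open>On the connected set \<open>J1 \<inter> J2\<close> agreement of the velocities is
  locally constant: agreement persists nearby by local uniqueness, disagreement by
  continuity.\<close>

lemma geodesic_unique:
  assumes \<gamma>1: "geo J1 \<gamma>1" and \<gamma>2: "geo J2 \<gamma>2" and a: "a \<in> J1" "a \<in> J2"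
    and eq: "vel \<gamma>1 a = vel \<gamma>2 a" and b: "b \<in> J1" "b \<in> J2"
  shows "vel \<gamma>1 b = vel \<gamma>2 b"
proof -
  note sc1 = geo_curve[OF \<gamma>1] and sc2 = geo_curve[OF \<gamma>2]
  let ?S = "J1 \<inter> J2" and ?P = "\<lambda>t. vel \<gamma>1 t = vel \<gamma>2 t"
  have conn: "connected ?S" using sc1(2) sc2(2) is_interval_connected is_interval_Int by blast
  have S: "open ?S" using sc1(1) sc2(1) by blast
  show ?thesis
  proof (rule connected_induction_simple[OF conn, of a b ?P])
    fix t assume t: "t \<in> ?S"
    have "\<exists>T. open T \<and> t \<in> T \<and> ((\<forall>s\<in>T. ?P s) \<or> (\<forall>s\<in>T. \<not> ?P s))"
    proof (cases "?P t")
      case True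
      then obtain e where "e > 0" "\<forall>s. \<bar>s - t\<bar> < e \<longrightarrow> ?P s"
        using geodesic_unique_local[OF \<gamma>1 \<gamma>2] t by blast
      then show ?thesis by (intro exI[of _ "ball t e"]) (auto simp: dist_real_def abs_minus_commute)
    next
      case False
      have c12: "isCont \<gamma>1 t" "isCont \<gamma>2 t"
        using sc1(1,4) sc2(1,4) t continuous_on_eq_continuous_at by blast+
      show ?thesis
      proof (cases "\<gamma>1 t = \<gamma>2 t")
        case eq: True
        obtain c where c: "c \<in> atlas M" "\<gamma>1 t \<in> fst c" by (rule chartE)
        have ne: "cvel c \<gamma>1 t \<noteq> cvel c \<gamma>2 t"
          using False tcoord_inj[OF c(1), of "vel \<gamma>1 t" "vel \<gamma>2 t"] c(2) eq t
            geo_TM[OF \<gamma>1] geo_TM[OF \<gamma>2]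
          by (auto simp: fst_vel)
        let ?h = "\<lambda>s. cvel c \<gamma>1 s - cvel c \<gamma>2 s"
        have cont: "isCont ?h t"
          using velocity_continuous_chart[OF \<gamma>1 _ c] velocity_continuous_chart[OF \<gamma>2 _ c(1)] c(2) eq t
          by (intro continuous_diff) auto
        have "\<exists>T. open T \<and> t \<in> T \<and> (\<forall>s\<in>T. ?h s \<in> - {0})"
          by (rule continuous_at_open[THEN iffD1, rule_format, OF cont]) (use ne in auto)
        then obtain T where "open T" "t \<in> T" "\<forall>s\<in>T. ?h s \<in> - {0}" by blast
        then show ?thesis by (intro exI[of _ T]) auto
      next
        \<comment> \<open>Different base points need not share a chart, so the Hausdorff property
          separates them here instead of coordinates.\<close>
        case False
        obtain U V where UV: "open U" "open V" "\<gamma>1 t \<in> U" "\<gamma>2 t \<in> V" "U \<inter> V = {}"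
          using hausdorff[OF False] by blast
        obtain T1 where T1: "open T1" "t \<in> T1" "\<forall>s\<in>T1. \<gamma>1 s \<in> U"
          using c12(1) UV(1,3) unfolding continuous_at_open by blast
        obtain T2 where T2: "open T2" "t \<in> T2" "\<forall>s\<in>T2. \<gamma>2 s \<in> V"
          using c12(2) UV(2,4) unfolding continuous_at_open by blast
        have "\<not> ?P s" if "s \<in> T1 \<inter> T2" for s
          using that T1(3) T2(3) UV(5) fst_vel by (metis IntE disjoint_iff)
        then show ?thesis using T1 T2 by (intro exI[of _ "T1 \<inter> T2"]) auto
      qed
    qed
    then obtain T where "open T" "t \<in> T" "(\<forall>s\<in>T. ?P s) \<or> (\<forall>s\<in>T. \<not> ?P s)" by blast
    then show "\<exists>T. openin (top_of_set ?S) T \<and> t \<in> T \<and> (\<forall>x\<in>T. \<forall>y\<in>T. ?P x \<longrightarrow> ?P y)"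
      using t by (intro exI[of _ "?S \<inter> T"]) (auto simp: openin_open_Int)
  qed (use a b eq in auto)
qed

section \<open>Affine reparametrization\<close>

lemma christoffel_scale:
  assumes c: "c \<in> atlas M" and x: "x \<in> cdom c"
  shows "\<Gamma> c x (r *\<^sub>R a) (r *\<^sub>R a) = (r * r) *\<^sub>R \<Gamma> c x a a"
proof -
  have "(r * r) *\<^sub>R \<Gamma> c x a a = \<Gamma> c x (r *\<^sub>R a) (r *\<^sub>R a)"
    unfolding christoffel_iff[OF c x]
  proof
    fix w
    have "2 * met c x ((r * r) *\<^sub>R \<Gamma> c x a a) w = (r * r) * koszul c x a a w"
      using met_christoffel[OF c x, of a a w] by (simp add: bilinear_lmul[OF met_bilinear[OF c x]])
    then show "2 * met c x ((r * r) *\<^sub>R \<Gamma> c x a a) w = koszul c x (r *\<^sub>R a) (r *\<^sub>R a) w"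
      by (simp add: koszul_def linear_cmul[OF dmet_linear[OF c x]]
        bilinear_lmul[OF dmet_bilinear[OF c x]] bilinear_rmul[OF dmet_bilinear[OF c x]] algebra_simps)
  qed
  then show ?thesis by simp
qed

text \<open>\<open>\<Gamma>\<close> is quadratic in the velocity, so rescaling the parameter by
  \<open>a\<close> multiplies both the acceleration and the Christoffel term by
  \<open>a * a\<close>. This is checked in a chart around each point, where the coordinate pair
  \<open>?u\<close> solves the spray equation; the pieces are then glued.\<close>

lemma geodesic_affine:
  assumes \<gamma>: "geo J \<gamma>" and a: "a \<noteq> 0"
  shows "geo {t. a * t + b \<in> J} (\<lambda>t. \<gamma> (a * t + b))" (is "geo ?J ?\<gamma>")
    and "a * t + b \<in> J \<Longrightarrow> vel (\<lambda>t. \<gamma> (a * t + b)) t =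
      (\<gamma> (a * t + b), tv_scale a (snd (vel \<gamma> (a * t + b))))"
proof -
  note sc = geo_curve[OF \<gamma>]
  let ?u = "\<lambda>c t. (snd c (\<gamma> (a * t + b)), a *\<^sub>R snd (cvel c \<gamma> (a * t + b)))"
  have openJ: "open ?J" using continuous_open_vimage[OF sc(1), of "\<lambda>t. a * t + b"]
    by (auto simp: vimage_def intro!: continuous_intros)
  have img: "?J = (\<lambda>s. (s - b) / a) ` J"
  proof -
    have "t \<in> (\<lambda>s. (s - b) / a) ` J" if "t \<in> ?J" for t
      using that a by (intro image_eqI[of _ _ "a * t + b"]) auto
    then show ?thesis using a by auto
  qed
  have intJ: "is_interval ?J" unfolding img is_interval_connected_1
    using sc(2) unfolding is_interval_connected_1 by (intro connected_continuous_image continuous_intros) (use a in auto)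
  have local: "\<exists>e>0. ball t e \<subseteq> ?J \<and> geo (ball t e) ?\<gamma> \<and> cvel c ?\<gamma> t = ?u c t"
    if t: "t \<in> ?J" and c: "c \<in> atlas M" "?\<gamma> t \<in> fst c" for t c
  proof -
    let ?T = "(\<lambda>t. a * t + b) -` {t \<in> J. \<gamma> t \<in> fst c}"
    have "open ?T" using sc(6)[OF c(1)] by (intro continuous_open_vimage) (auto intro!: continuous_intros)
    moreover have "t \<in> ?T" using t c by simp
    ultimately obtain e where e: "e > 0" "ball t e \<subseteq> ?T" using openE by blast
    have sub: "a * s + b \<in> J" "\<gamma> (a * s + b) \<in> fst c" if "s \<in> ball t e" for s using e(2) that by auto
    have u: "(?u c has_vector_derivative spray c (?u c s)) (at s) \<and> ?u c s \<in> phase c" if s: "s \<in> ball t e" for s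
    proof
      let ?s = "a * s + b"
      let ?f = "\<lambda>r. cvel c \<gamma> r"
      have dom: "snd c (\<gamma> ?s) \<in> cdom c" using chart_in[OF c(1) sub(2)[OF s]] .
      have "(?f \<circ> (\<lambda>r. a * r + b) has_vector_derivative a *\<^sub>R spray c (?f ?s)) (at s)"
        by (rule vector_diff_chain_at[where f="\<lambda>r. a * r + b" and g="?f", OF _ geodesic_spray[OF \<gamma> sub(1)[OF s] c(1) sub(2)[OF s]]])
          (auto intro!: derivative_eq_intros simp: has_real_derivative_iff_has_vector_derivative[symmetric])
      then have f: "((\<lambda>r. ?f (a * r + b)) has_vector_derivative a *\<^sub>R spray c (?f ?s)) (at s)" by (simp add: o_def)
      let ?x = "snd c (\<gamma> ?s)" and ?v = "snd (?f ?s)"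
      have fs: "?f r = (snd c (\<gamma> r), snd (?f r))" for r by (simp add: tcoord_def velocity_def)
      have "((\<lambda>r. snd c (\<gamma> (a * r + b))) has_vector_derivative a *\<^sub>R ?v) (at s)"
        using bounded_linear.has_vector_derivative[OF bounded_linear_fst f]
        by (simp add: spray_def case_prod_beta) (simp add: tcoord_def velocity_def)
      moreover have "((\<lambda>r. a *\<^sub>R snd (?f (a * r + b))) has_vector_derivative a *\<^sub>R a *\<^sub>R - \<Gamma> c ?x ?v ?v) (at s)"
        using bounded_linear.has_vector_derivative[OF bounded_linear_compose[OF bounded_linear_scaleR_right[of a] bounded_linear_snd] f]
        by (simp add: spray_def case_prod_beta) (simp add: tcoord_def velocity_def)
      ultimately have "(?u c has_vector_derivative (a *\<^sub>R ?v, a *\<^sub>R a *\<^sub>R - \<Gamma> c ?x ?v ?v)) (at s)"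
        by (rule has_vector_derivative_Pair)
      then show "(?u c has_vector_derivative spray c (?u c s)) (at s)"
        using christoffel_scale[OF c(1) dom, of a ?v] by (simp add: spray_def)
      show "?u c s \<in> phase c" using dom by (simp add: phase_def)
    qed
    have g: "?\<gamma> s = chart_inv c (fst (?u c s))" if "s \<in> ball t e" for s
      using chart_inv_chart[OF c(1) sub(2)[OF that]] by simp
    have ne: "ball t e \<noteq> {}" using e by simp
    show ?thesis
      using e spray_geodesic[OF open_ball is_interval_ball_real ne c(1) u g] by (intro exI[of _ e]) auto
  qed
  show g: "geo ?J ?\<gamma>"
  proof (rule geodesic_local[OF openJ intJ])
    show "?J \<noteq> {}" using img sc(3) by simp
    fix t assume t: "t \<in> ?J"
    obtain c where "c \<in> atlas M" "?\<gamma> t \<in> fst c" by (rule chartE)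
    from local[OF t this] obtain e where "e > 0" "geo (ball t e) ?\<gamma>" by blast
    then show "\<exists>I \<gamma>'. geo I \<gamma>' \<and> t \<in> I \<and> (\<forall>s\<in>I \<inter> ?J. ?\<gamma> s = \<gamma>' s)"
      by (intro exI[of _ "ball t e"] exI[of _ ?\<gamma>]) auto
  qed
  show "vel ?\<gamma> t = (\<gamma> (a * t + b), tv_scale a (snd (vel \<gamma> (a * t + b))))"
    if t: "a * t + b \<in> J" for t
  proof -
    obtain c where c: "c \<in> atlas M" "?\<gamma> t \<in> fst c" by (rule chartE)
    have V: "vel \<gamma> (a * t + b) \<in> TM" by (rule geo_TM[OF \<gamma> t])
    have "cvel c ?\<gamma> t = ?u c t" using local[OF _ c] t by blast
    then show ?thesis
    proof (intro tcoord_inj[OF c(1)])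
      show "vel ?\<gamma> t \<in> TM" using geo_TM[OF g] t by simp
      show "(\<gamma> (a * t + b), tv_scale a (snd (vel \<gamma> (a * t + b)))) \<in> TM"
        using V tv_scale_in by (metis fst_vel in_TM prod.collapse)
    qed (use c in \<open>auto simp: fst_vel tcoord_def velocity_def tv_scale_def\<close>)
  qed
qed

section \<open>Conservation of the square of the velocity\<close>

abbreviation "energy \<gamma> t \<equiv> metric M (\<gamma> t) (snd (vel \<gamma> t)) (snd (vel \<gamma> t))"

lemma metric_vel_coord:
  assumes \<gamma>: "geo J \<gamma>" and t: "t \<in> J" and c: "c \<in> atlas M" and p: "\<gamma> t \<in> fst c"
  shows "energy \<gamma> t =
    met c (fst (cvel c \<gamma> t)) (snd (cvel c \<gamma> t)) (snd (cvel c \<gamma> t))"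
proof -
  have "snd (vel \<gamma> t) \<in> tspace (\<gamma> t)"
    using geo_TM[OF \<gamma> t] by (metis fst_vel in_TM prod.collapse)
  from metric_eq_met[OF c p this this] show ?thesis
    by (simp add: tcoord_def velocity_def)
qed

text \<open>The Koszul formula with three equal arguments reads
  \<open>2 * met c x (\<Gamma> c x v v) v = dmet c x v v v\<close>, so the change of the metric
  along the curve is cancelled by the acceleration.\<close>

lemma geodesic_energy_derivative:
  assumes \<gamma>: "geo J \<gamma>" and t: "t \<in> J"
  shows "((\<lambda>s. energy \<gamma> s) has_real_derivative 0) (at t)"
proof -
  obtain c where c: "c \<in> atlas M" "\<gamma> t \<in> fst c" by (rule chartE)
  note sc = geo_curve[OF \<gamma>]
  let ?T = "{t \<in> J. \<gamma> t \<in> fst c}"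
  have T: "open ?T" "t \<in> ?T" using sc(6)[OF c(1)] t c by auto
  define u where "u s = cvel c \<gamma> s" for s
  define x v where "x = fst (u t)" and "v = snd (u t)"
  have u: "(u has_vector_derivative spray c (u t)) (at t)"
    unfolding u_def by (rule geodesic_spray[OF \<gamma> t c])
  have x: "x \<in> cdom c" unfolding x_def u_def
    using tcoord_vel_phase[of c \<gamma> t] c by (auto simp: phase_def mem_Times_iff)
  have sp: "spray c (u t) = (v, - \<Gamma> c x v v)"
    by (simp add: x_def v_def spray_def case_prod_beta)
  have d1: "((\<lambda>s. fst (u s)) has_derivative (\<lambda>h. h *\<^sub>R v)) (at t)"
    and d2: "((\<lambda>s. snd (u s)) has_derivative (\<lambda>h. h *\<^sub>R - \<Gamma> c x v v)) (at t)"
    using has_derivative_fst[OF u[unfolded has_vector_derivative_def]]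
      has_derivative_snd[OF u[unfolded has_vector_derivative_def]] by (simp_all add: sp)
  have "((\<lambda>s. met c (fst (u s)) (snd (u s)) (snd (u s))) has_derivative
      (\<lambda>h. fderiv (\<lambda>y. met c y v v) x (h *\<^sub>R v) +
        met c x (h *\<^sub>R - \<Gamma> c x v v) v + met c x v (h *\<^sub>R - \<Gamma> c x v v))) (at t)"
    using bilinear_family_has_derivative[OF open_cdom[OF c(1)] met_bilinear[OF c(1)] met_smooth[OF c(1)] d1 d2 d2]
      x by (simp add: x_def v_def)
  moreover have "fderiv (\<lambda>y. met c y v v) x (h *\<^sub>R v) +
      met c x (h *\<^sub>R - \<Gamma> c x v v) v + met c x v (h *\<^sub>R - \<Gamma> c x v v) = 0" for h
  proof -
    have "2 * met c x (\<Gamma> c x v v) v = dmet c x v v v"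
      using met_christoffel[OF c(1) x, of v v v] by (simp add: koszul_def)
    moreover have "fderiv (\<lambda>y. met c y v v) x (h *\<^sub>R v) = h * dmet c x v v v"
      using linear_cmul[OF dmet_linear[OF c(1) x], of v v h v] by (simp add: dmet_def)
    moreover have "met c x (h *\<^sub>R - \<Gamma> c x v v) v = - h * met c x (\<Gamma> c x v v) v"
      by (simp add: bilinear_lmul[OF met_bilinear[OF c(1) x]] bilinear_lneg[OF met_bilinear[OF c(1) x]])
    ultimately show ?thesis using met_sym[OF c(1) x, of v "h *\<^sub>R - \<Gamma> c x v v"]
      by (simp add: algebra_simps)
  qed
  ultimately have "((\<lambda>s. met c (fst (u s)) (snd (u s)) (snd (u s))) has_derivative (\<lambda>_. 0)) (at t)"
    by simp
  then have "((\<lambda>s. energy \<gamma> s) has_derivative (\<lambda>_. 0)) (at t)"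
    by (rule has_derivative_transform_within_open[OF _ T])
      (use metric_vel_coord[OF \<gamma> _ c(1)] in \<open>auto simp: u_def\<close>)
  moreover have "(*) 0 = (\<lambda>_. 0 :: real)" by auto
  ultimately show ?thesis unfolding has_field_derivative_def by metis
qed

lemma geodesic_energy_constant:
  assumes \<gamma>: "geo J \<gamma>" and s: "s \<in> J" and t: "t \<in> J"
  shows "energy \<gamma> s =
    energy \<gamma> t"
proof -
  have "convex J" using geo_curve(2)[OF \<gamma>] by (simp add: is_interval_convex_1)
  then obtain k where "\<And>x. x \<in> J \<Longrightarrow> energy \<gamma> x = k"
    using has_field_derivative_zero_constant[OF _ has_field_derivative_at_within[OF geodesic_energy_derivative[OF \<gamma>]]]
    by meson
  then show ?thesis using s t by simp
qed

text \<open>Serves as a comparison curve: by uniqueness, a geodesic whose velocity vanishes at one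
  instant has zero velocity throughout.\<close>

lemma constant_geodesic:
  assumes J: "open J" "is_interval J" "J \<noteq> {}"
  shows "geo J (\<lambda>_. p)"
    and "t \<in> J \<Longrightarrow> vel (\<lambda>_. p) t = (p, \<lambda>_. 0)"
proof -
  obtain c where c: "c \<in> atlas M" "p \<in> fst c" by (rule chartE)
  have "((\<lambda>_. (snd c p, 0)) has_vector_derivative spray c (snd c p, 0)) (at t) \<and> (snd c p, 0) \<in> phase c" for t :: real
    using christoffel_zero[OF c(1) chart_in[OF c]] chart_in[OF c]
    by (auto simp: spray_def phase_def zero_prod_def[symmetric] intro!: derivative_eq_intros)
  note * = spray_geodesic(1)[OF J c(1) this]
  show "geo J (\<lambda>_. p)" by (rule *) (simp add: chart_inv_chart[OF c])
  show "vel (\<lambda>_. p) t = (p, \<lambda>_. 0)"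
    by (auto simp: velocity_def o_def)
qed

lemma null_vec_iff: "null_vec M X \<longleftrightarrow> X \<in> TM \<and> snd X \<noteq> (\<lambda>_. 0) \<and> metric M (fst X) (snd X) (snd X) = 0"
  by (auto simp: null_vec_def nonzero_vec_def in_TM split: prod.splits)

text \<open>Constancy of the energy keeps the square of the velocity at 0; comparison with a
  constant geodesic excludes a zero velocity.\<close>

lemma geodesic_null:
  assumes \<gamma>: "geo J \<gamma>" and s: "s \<in> J" "null_vec M (vel \<gamma> s)" and t: "t \<in> J"
  shows "null_vec M (vel \<gamma> t)"
  unfolding null_vec_iff
proof (intro conjI)
  show "vel \<gamma> t \<in> TM" by (rule geo_TM[OF \<gamma> t])
  show "metric M (fst (vel \<gamma> t)) (snd (vel \<gamma> t)) (snd (vel \<gamma> t)) = 0"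
    using geodesic_energy_constant[OF \<gamma> s(1) t] s(2) by (simp add: null_vec_iff fst_vel)
  show "snd (vel \<gamma> t) \<noteq> (\<lambda>_. 0)"
  proof
    assume 0: "snd (vel \<gamma> t) = (\<lambda>_. 0)"
    note sc = geo_curve[OF \<gamma>]
    have "vel \<gamma> t = vel (\<lambda>_. \<gamma> t) t"
      using 0 constant_geodesic(2)[OF sc(1-3) t] by (metis fst_vel prod.collapse)
    then have "vel \<gamma> s = vel (\<lambda>_. \<gamma> t) s"
      using geodesic_unique[OF \<gamma> constant_geodesic(1)[OF sc(1-3)] t t _ s(1) s(1)] by simp
    then show False using s(2) constant_geodesic(2)[OF sc(1-3) s(1)] by (simp add: null_vec_iff)
  qed
qed

section \<open>Local flow and maximal geodesics\<close>

text \<open>The geodesic form of \<open>flow_box\<close>. The Lipschitz constant 2 in bundle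
  coordinates is all the continuous dependence that is used later.\<close>

lemma geodesic_flow_box:
  assumes c: "c \<in> atlas M" and u0: "u0 \<in> phase c"
  obtains d \<rho> \<sigma> where "d > 0" "\<rho> > 0"
    "\<And>w. w \<in> ball u0 \<rho> \<Longrightarrow> geo {-d<..<d} (\<sigma> w)"
    "\<And>w t. w \<in> ball u0 \<rho> \<Longrightarrow> \<bar>t\<bar> < d \<Longrightarrow> \<sigma> w t \<in> fst c"
    "\<And>w. w \<in> ball u0 \<rho> \<Longrightarrow> cvel c (\<sigma> w) 0 = w"
    "\<And>w w' t. w \<in> ball u0 \<rho> \<Longrightarrow> w' \<in> ball u0 \<rho> \<Longrightarrow> \<bar>t\<bar> < d \<Longrightarrow>
      dist (cvel c (\<sigma> w) t) (cvel c (\<sigma> w') t) \<le> 2 * dist w w'"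
proof -
  show thesis
  proof (rule flow_box[OF open_phase[OF c] smooth_onD[OF spray_smooth[OF c]] u0])
    fix d \<rho> \<phi> assume fb: "d > 0" "\<rho> > 0"
      "\<And>w. w \<in> ball u0 \<rho> \<Longrightarrow> \<phi> w 0 = w"
      "\<And>w t. w \<in> ball u0 \<rho> \<Longrightarrow> \<bar>t\<bar> < d \<Longrightarrow> (\<phi> w has_vector_derivative spray c (\<phi> w t)) (at t)"
      "\<And>w t. w \<in> ball u0 \<rho> \<Longrightarrow> \<bar>t\<bar> < d \<Longrightarrow> \<phi> w t \<in> phase c"
      "\<And>w w' t. w \<in> ball u0 \<rho> \<Longrightarrow> w' \<in> ball u0 \<rho> \<Longrightarrow> \<bar>t\<bar> < d \<Longrightarrow> norm (\<phi> w t - \<phi> w' t) \<le> 2 * norm (w - w')"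
    let ?\<sigma> = "\<lambda>w t. chart_inv c (fst (\<phi> w t))"
    have I: "open {-d<..<d}" "is_interval {-d<..<d}" "{-d<..<d} \<noteq> {}" using fb(1) by (auto simp: is_interval_oo)
    have sol: "(\<phi> w has_vector_derivative spray c (\<phi> w t)) (at t) \<and> \<phi> w t \<in> phase c"
      if "w \<in> ball u0 \<rho>" "t \<in> {-d<..<d}" for w t
      using fb(4,5)[OF that(1)] that(2) by auto
    have g: "geo {-d<..<d} (?\<sigma> w)" if "w \<in> ball u0 \<rho>" for w
      by (rule spray_geodesic(1)[OF I c sol[OF that] refl])
    have v: "cvel c (?\<sigma> w) t = \<phi> w t" if "w \<in> ball u0 \<rho>" "\<bar>t\<bar> < d" for w t
      by (rule spray_geodesic(2)[OF I c sol[OF that(1)] refl]) (use that in auto)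
    show thesis
    proof (rule that[of d \<rho> ?\<sigma>])
      show "?\<sigma> w t \<in> fst c" if "w \<in> ball u0 \<rho>" "\<bar>t\<bar> < d" for w t
        using fb(5)[OF that] by (auto simp: phase_def mem_Times_iff intro: chart_inv_in[OF c])
      show "cvel c (?\<sigma> w) 0 = w" if "w \<in> ball u0 \<rho>" for w
        using v[OF that, of 0] fb(1) fb(3)[OF that] by simp
      show "dist (cvel c (?\<sigma> w) t) (cvel c (?\<sigma> w') t) \<le> 2 * dist w w'"
        if "w \<in> ball u0 \<rho>" "w' \<in> ball u0 \<rho>" "\<bar>t\<bar> < d" for w w' t
        using fb(6)[OF that] v that by (simp add: dist_norm)
    qed (use fb(1,2) g in auto)
  qed
qed

lemma tcoord_in_phase: "c \<in> atlas M \<Longrightarrow> fst X \<in> fst c \<Longrightarrow> tcoord c X \<in> phase c"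
  by (cases X) (simp add: tcoord_def phase_def chart_in)

lemma geodesic_exists_local:
  assumes X: "X \<in> TM"
  shows "\<exists>J \<gamma>. geo J \<gamma> \<and> 0 \<in> J \<and> vel \<gamma> 0 = X"
proof -
  obtain c where c: "c \<in> atlas M" "fst X \<in> fst c" by (rule chartE)
  let ?w = "tcoord c X"
  show ?thesis
  proof (rule geodesic_flow_box[OF c(1) tcoord_in_phase[OF c]])
    fix d \<rho> :: real and \<sigma>
    assume fb: "d > 0" "\<rho> > 0" "\<And>w. w \<in> ball ?w \<rho> \<Longrightarrow> geo {-d<..<d} (\<sigma> w)"
      "\<And>w t. w \<in> ball ?w \<rho> \<Longrightarrow> \<bar>t\<bar> < d \<Longrightarrow> \<sigma> w t \<in> fst c"
      "\<And>w. w \<in> ball ?w \<rho> \<Longrightarrow> cvel c (\<sigma> w) 0 = w"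
    have w: "?w \<in> ball ?w \<rho>" "0 \<in> {-d<..<d}" using fb(1,2) by simp_all
    have "vel (\<sigma> ?w) 0 = X"
      by (rule tcoord_inj[OF c(1) geo_TM[OF fb(3)[OF w(1)] w(2)] X])
        (use fb(1) fb(4)[OF w(1), of 0] fb(5)[OF w(1)] c(2) in \<open>auto simp: fst_vel\<close>)
    then show ?thesis using fb(3) w by blast
  qed
qed

text \<open>The domain is the union of the domains of all geodesics with the given initial velocity.
  Any two of them agree where both are defined, so the value at \<open>t\<close> may be taken from
  any one of them.\<close>

lemma geodesic_exists_maximal:
  assumes X: "X \<in> TM"
  shows "\<exists>J \<gamma>. geo J \<gamma> \<and> 0 \<in> J \<and> vel \<gamma> 0 = X \<and>
    (\<forall>J' \<gamma>'. geo J' \<gamma>' \<and> 0 \<in> J' \<and> vel \<gamma>' 0 = X \<longrightarrow> J' \<subseteq> J)"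
proof -
  let ?F = "\<lambda>J \<gamma>. geo J \<gamma> \<and> 0 \<in> J \<and> vel \<gamma> 0 = X"
  define J where "J = \<Union>{J. \<exists>\<gamma>. ?F J \<gamma>}"
  obtain J0 \<gamma>0 where J0: "?F J0 \<gamma>0" using geodesic_exists_local[OF X] by blast
  have "\<forall>t\<in>J. \<exists>\<gamma>. \<exists>I. t \<in> I \<and> ?F I \<gamma>" unfolding J_def by blast
  from bchoice[OF this] obtain g where g: "\<forall>t\<in>J. \<exists>I. t \<in> I \<and> ?F I (g t)" ..
  \<comment> \<open>The geodesic chosen for the time \<open>t\<close> is evaluated at that same
    time; \<open>eq\<close> shows that the choice does not matter.\<close>
  define \<gamma> where "\<gamma> t = g t t" for t
  have eq: "\<gamma> t = \<gamma>' t" if "?F I \<gamma>'" "t \<in> I" for I \<gamma>' t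
  proof -
    have "t \<in> J" using that by (auto simp: J_def)
    then obtain I' where I': "t \<in> I'" "?F I' (g t)" using g by blast
    have "vel (g t) t = vel \<gamma>' t"
      by (rule geodesic_unique[of I' _ I _ 0]) (use I' that in auto)
    then show ?thesis unfolding \<gamma>_def by (metis fst_vel)
  qed
  have J: "open J" "is_interval J" "J \<noteq> {}"
  proof -
    show "open J" unfolding J_def using smooth_curveD(1) geodesicD by blast
    have "connected J" unfolding J_def
      by (rule connected_Union) (use smooth_curveD(2)[OF geodesicD] is_interval_connected in blast)+
    then show "is_interval J" by (simp add: is_interval_connected_1)
    show "J \<noteq> {}" using J0 unfolding J_def by blast
  qed
  have geo: "geo J \<gamma>"
  proof (rule geodesic_local[OF J])
    fix t assume "t \<in> J"
    then obtain I \<gamma>' where "?F I \<gamma>'" "t \<in> I" unfolding J_def by blast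
    then show "\<exists>I \<gamma>'. geo I \<gamma>' \<and> t \<in> I \<and> (\<forall>s\<in>I \<inter> J. \<gamma> s = \<gamma>' s)" using eq by blast
  qed
  have "vel \<gamma> 0 = vel \<gamma>0 0"
    by (rule velocity_cong[of J0]) (use J0 eq smooth_curveD(1)[OF geodesicD] in blast)+
  then have "vel \<gamma> 0 = X" using J0 by simp
  moreover have "0 \<in> J" using J0 unfolding J_def by blast
  moreover have "J' \<subseteq> J" if "?F J' \<gamma>'" for J' \<gamma>' using that unfolding J_def by blast
  ultimately show ?thesis using geo by blast
qed

subsection \<open>Null-geodesics\<close>

lemma null_geoD:
  assumes "null_geo J \<gamma>"
  shows "geo J \<gamma>" "t \<in> J \<Longrightarrow> null_vec M (vel \<gamma> t)"
    "geo J' \<gamma>' \<Longrightarrow> J \<subseteq> J' \<Longrightarrow> (\<And>t. t \<in> J \<Longrightarrow> \<gamma>' t = \<gamma> t) \<Longrightarrow> J' = J"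
  using assms unfolding null_geodesic_def by blast+

lemma null_geodesic_exists:
  assumes X: "null_vec M X"
  shows "\<exists>J \<gamma>. null_geo J \<gamma> \<and> 0 \<in> J \<and> vel \<gamma> 0 = X"
proof -
  have "X \<in> TM" using X by (simp add: null_vec_iff)
  from geodesic_exists_maximal[OF this] obtain J \<gamma> where *: "geo J \<gamma> \<and> 0 \<in> J \<and> vel \<gamma> 0 = X \<and>
      (\<forall>J' \<gamma>'. geo J' \<gamma>' \<and> 0 \<in> J' \<and> vel \<gamma>' 0 = X \<longrightarrow> J' \<subseteq> J)" by (elim exE)
  then have J: "geo J \<gamma>" "0 \<in> J" "vel \<gamma> 0 = X" by simp_all
  have max: "J' \<subseteq> J" if "geo J' \<gamma>'" "0 \<in> J'" "vel \<gamma>' 0 = X" for J' \<gamma>'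
    using * that by blast
  have "J' = J" if J': "geo J' \<gamma>'" "J \<subseteq> J'" "\<forall>t\<in>J. \<gamma>' t = \<gamma> t" for J' \<gamma>'
  proof -
    have "vel \<gamma>' 0 = vel \<gamma> 0"
      by (rule velocity_cong[OF geo_curve(1)[OF J(1)] J(2)]) (use J'(3) in simp)
    then show ?thesis using max[OF J'(1)] J'(2) J(2,3) by blast
  qed
  moreover have "null_vec M (vel \<gamma> t)" if "t \<in> J" for t
    using geodesic_null[OF J(1,2) _ that] X J(3) by simp
  ultimately show ?thesis using J unfolding null_geodesic_def by blast
qed

text \<open>Gluing \<open>\<gamma>2\<close> onto \<open>\<gamma>1\<close> gives a geodesic on
  \<open>J1 \<union> J2\<close>; as \<open>\<gamma>1\<close> is inextendible, this adds nothing to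
  \<open>J1\<close>.\<close>

lemma null_geodesic_maximal:
  assumes \<gamma>1: "null_geo J1 \<gamma>1" and \<gamma>2: "geo J2 \<gamma>2" and a: "a \<in> J1" "a \<in> J2"
    and eq: "vel \<gamma>1 a = vel \<gamma>2 a"
  shows "J2 \<subseteq> J1" and "t \<in> J2 \<Longrightarrow> vel \<gamma>1 t = vel \<gamma>2 t"
proof -
  note g1 = null_geoD(1)[OF \<gamma>1]
  note sc1 = geo_curve[OF g1] and sc2 = geo_curve[OF \<gamma>2]
  define \<gamma> where "\<gamma> t = (if t \<in> J1 then \<gamma>1 t else \<gamma>2 t)" for t
  have agree: "vel \<gamma>1 t = vel \<gamma>2 t" if "t \<in> J1" "t \<in> J2" for t
    by (rule geodesic_unique[OF g1 \<gamma>2 a eq that])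
  have "connected (J1 \<union> J2)"
    by (rule connected_Un) (use sc1(2) sc2(2) a in \<open>auto simp: is_interval_connected_1\<close>)
  then have "geo (J1 \<union> J2) \<gamma>"
  proof (intro geodesic_local)
    show "open (J1 \<union> J2)" using sc1(1) sc2(1) by blast
    fix t assume "t \<in> J1 \<union> J2"
    moreover have "\<gamma> s = \<gamma>2 s" if "s \<in> J2" for s
      using agree[OF _ that] by (auto simp: \<gamma>_def) (metis fst_vel)
    ultimately show "\<exists>I \<gamma>'. geo I \<gamma>' \<and> t \<in> I \<and> (\<forall>s\<in>I \<inter> (J1 \<union> J2). \<gamma> s = \<gamma>' s)"
      using g1 \<gamma>2 by (metis IntD1 Un_iff \<gamma>_def)
  qed (use a in \<open>auto simp: is_interval_connected_1\<close>)
  from null_geoD(3)[OF \<gamma>1 this] show J21: "J2 \<subseteq> J1" by (auto simp: \<gamma>_def)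
  show "vel \<gamma>1 t = vel \<gamma>2 t" if "t \<in> J2" using agree that J21 by blast
qed

lemma null_geodesic_affine:
  assumes \<gamma>: "null_geo J \<gamma>" and a: "a \<noteq> 0"
  shows "null_geo {t. a * t + b \<in> J} (\<lambda>t. \<gamma> (a * t + b))"
proof -
  note g = null_geoD(1)[OF \<gamma>]
  let ?J = "{t. a * t + b \<in> J}" and ?\<gamma> = "\<lambda>t. \<gamma> (a * t + b)"
  note ga = geodesic_affine[OF g a]
  have "null_vec M (vel ?\<gamma> t)" if "t \<in> ?J" for t
  proof -
    have tJ: "a * t + b \<in> J" using that by simp
    let ?v = "snd (vel \<gamma> (a * t + b))" and ?p = "\<gamma> (a * t + b)"
    have n: "null_vec M (?p, ?v)" using null_geoD(2)[OF \<gamma> tJ] by (metis fst_vel prod.collapse)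
    obtain c where c: "c \<in> atlas M" "?p \<in> fst c" by (rule chartE)
    have v: "?v \<in> tspace ?p" using n by (simp add: null_vec_iff in_TM)
    have "metric M ?p (tv_scale a ?v) (tv_scale a ?v) = a * a * metric M ?p ?v ?v"
      unfolding metric_eq_met[OF c tv_scale_in[OF v] tv_scale_in[OF v]] metric_eq_met[OF c v v]
      using met_bilinear[OF c(1) chart_in[OF c]] by (simp add: tv_scale_def bilinear_lmul bilinear_rmul)
    moreover have "tv_scale a ?v \<noteq> (\<lambda>_. 0)"
    proof
      assume "tv_scale a ?v = (\<lambda>_. 0)"
      then have "?v = (\<lambda>_. 0)" using a by (auto simp: tv_scale_def fun_eq_iff)
      then show False using n by (simp add: null_vec_iff)
    qed
    ultimately show ?thesis unfolding ga(2)[OF tJ] using n tv_scale_in[OF v] by (simp add: null_vec_iff in_TM)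
  qed
  moreover have "J' = ?J" if J': "geo J' \<gamma>'" "?J \<subseteq> J'" "\<forall>t\<in>?J. \<gamma>' t = ?\<gamma> t" for J' \<gamma>'
  proof -
    \<comment> \<open>The inverse affine map: an extension of the reparametrized curve, composed
      with it, extends \<open>\<gamma>\<close>.\<close>
    let ?s = "\<lambda>s. (1/a) * s + (- b/a)"
    have s: "a * ?s s + b = s" for s using a by (simp add: field_simps)
    have s': "?s (a * t + b) = t" for t using a by (simp add: field_simps)
    have "{s. ?s s \<in> J'} = J"
    proof (rule null_geoD(3)[OF \<gamma>])
      show "geo {s. ?s s \<in> J'} (\<lambda>s. \<gamma>' (?s s))" by (rule geodesic_affine(1)[OF J'(1)]) (use a in simp)
      show "J \<subseteq> {s. ?s s \<in> J'}" using J'(2) s by auto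
      show "\<gamma>' (?s t) = \<gamma> t" if "t \<in> J" for t using J'(3)[rule_format, of "?s t"] s[of t] that by simp
    qed
    moreover have "a * t + b \<in> {s. ?s s \<in> J'}" if "t \<in> J'" for t unfolding mem_Collect_eq s' by (rule that)
    ultimately show ?thesis using J'(2) by blast
  qed
  ultimately show ?thesis using ga(1) unfolding null_geodesic_def by blast
qed

lemma null_geodesic_same_direction:
  assumes \<gamma>1: "null_geo J1 \<gamma>1" and \<gamma>2: "null_geo J2 \<gamma>2" and t: "t1 \<in> J1" "t2 \<in> J2"
    and a: "a \<noteq> 0" and eq: "vel \<gamma>2 t2 = (\<gamma>1 t1, tv_scale a (snd (vel \<gamma>1 t1)))"
    and s: "s \<in> J2"
  shows "a * s + (t1 - a * t2) \<in> J1"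
    and "vel \<gamma>2 s = (\<gamma>1 (a * s + (t1 - a * t2)), tv_scale a (snd (vel \<gamma>1 (a * s + (t1 - a * t2)))))"
proof -
  \<comment> \<open>The shift for which the affine map with slope \<open>a\<close> sends
    \<open>t2\<close> to \<open>t1\<close>, so that the reparametrized \<open>\<gamma>1\<close> and
    \<open>\<gamma>2\<close> have the same velocity at \<open>t2\<close>.\<close>
  let ?b = "t1 - a * t2"
  let ?\<gamma> = "\<lambda>t. \<gamma>1 (a * t + ?b)"
  have n: "null_geo {t. a * t + ?b \<in> J1} ?\<gamma>" by (rule null_geodesic_affine[OF \<gamma>1 a])
  have "vel ?\<gamma> t2 = vel \<gamma>2 t2"
    using geodesic_affine(2)[OF null_geoD(1)[OF \<gamma>1] a, of t2 ?b] t(1) eq by simp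
  note m = null_geodesic_maximal[OF n null_geoD(1)[OF \<gamma>2] _ t(2) this]
  show sJ: "a * s + ?b \<in> J1" using m(1) t(1) s by auto
  show "vel \<gamma>2 s = (\<gamma>1 (a * s + ?b), tv_scale a (snd (vel \<gamma>1 (a * s + ?b))))"
    using m(2)[OF _ s] t(1) geodesic_affine(2)[OF null_geoD(1)[OF \<gamma>1] a sJ] by simp
qed

subsection \<open>Time orientation along null curves\<close>

lemma tfield_in: "tfield M p \<in> tspace p" and tfield_timelike: "metric M p (tfield M p) (tfield M p) < 0"
  and tfield_continuous: "c \<in> atlas M \<Longrightarrow> continuous_on (fst c) (\<lambda>p. tfield M p c)"
  using orient by (auto simp: time_orientation_def)

lemma null_not_orthogonal:
  assumes "null_vec M (p, v)" shows "metric M p v (tfield M p) \<noteq> 0"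
proof
  assume 0: "metric M p v (tfield M p) = 0"
  obtain c where c: "c \<in> atlas M" "p \<in> fst c" by (rule chartE)
  have v: "v \<in> tspace p" "v \<noteq> (\<lambda>_. 0)" "metric M p v v = 0" using assms by (auto simp: null_vec_iff in_TM)
  have "v c = 0"
  proof (rule met_orthogonal_timelike[OF c(1) chart_in[OF c]])
    show "met c (snd c p) (tfield M p c) (tfield M p c) < 0"
      using tfield_timelike metric_eq_met[OF c tfield_in tfield_in] by metis
    show "met c (snd c p) (v c) (v c) \<le> 0" using v(3) metric_eq_met[OF c v(1) v(1)] by simp
    show "met c (snd c p) (v c) (tfield M p c) = 0" using 0 metric_eq_met[OF c v(1) tfield_in] by simp
  qed
  then show False using component_zero_iff[OF c v(1)] v(2) by simp
qed

lemma time_component_continuous: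
  assumes c: "c \<in> atlas M"
  shows "continuous_on (phase c) (\<lambda>(x, a). met c x a (tfield M (chart_inv c x) c))"
proof -
  have "continuous_on (cdom c) (\<lambda>x. tfield M (chart_inv c x) c)"
    by (rule continuous_on_compose2[OF tfield_continuous[OF c] chart_inv_continuous[OF c]])
      (use chart_inv_in[OF c] in auto)
  then have "continuous_on (phase c) (\<lambda>z. tfield M (chart_inv c (fst z)) c)"
    by (rule continuous_on_compose2) (auto simp: phase_def intro: continuous_intros)
  then have "continuous_on (phase c) (\<lambda>z. (fst z, snd z, tfield M (chart_inv c (fst z)) c))"
    by (intro continuous_intros)
  from continuous_on_compose2[OF bilinear_family_continuous[OF met_bilinear[OF c] smooth_on_continuous[OF met_smooth[OF c]]] this]
  show ?thesis by (simp add: phase_def case_prod_beta' image_subset_iff)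
qed

lemma energy_continuous:
  assumes c: "c \<in> atlas M"
  shows "continuous_on (phase c) (\<lambda>(x, a). met c x a a)"
proof -
  have "continuous_on (phase c) (\<lambda>z. (fst z, snd z, snd z))" by (intro continuous_intros)
  from continuous_on_compose2[OF bilinear_family_continuous[OF met_bilinear[OF c] smooth_on_continuous[OF met_smooth[OF c]]] this]
  show ?thesis by (simp add: phase_def case_prod_beta' image_subset_iff)
qed

lemma time_component_coord:
  assumes "c \<in> atlas M" "p \<in> fst c" "v \<in> tspace p"
  shows "metric M p v (tfield M p) = (\<lambda>(x, a). met c x a (tfield M (chart_inv c x) c)) (tcoord c (p, v))"
  using metric_eq_met[OF assms tfield_in] chart_inv_chart[OF assms(1,2)] by (simp add: tcoord_def)

text \<open>The product of the velocity with the time orientation is continuous along the curve and,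
  on null vectors, never 0; its sign is therefore constant on the interval.\<close>

lemma null_geodesic_future:
  assumes \<gamma>: "geo J \<gamma>" and n: "\<And>t. t \<in> J \<Longrightarrow> null_vec M (vel \<gamma> t)"
    and s: "s \<in> J" "future_directed M (vel \<gamma> s)" and t: "t \<in> J"
  shows "future_directed M (vel \<gamma> t)"
proof -
  define h where "h t = metric M (\<gamma> t) (snd (vel \<gamma> t)) (tfield M (\<gamma> t))" for t
  have fut: "future_directed M (vel \<gamma> t) \<longleftrightarrow> h t < 0" for t
    unfolding h_def future_directed_def velocity_def by simp
  note sc = geo_curve[OF \<gamma>]
  have "continuous_on J h"
  proof (rule continuous_at_imp_continuous_on, rule ballI)
    fix r assume r: "r \<in> J"
    obtain c where c: "c \<in> atlas M" "\<gamma> r \<in> fst c" by (rule chartE)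
    let ?T = "{t \<in> J. \<gamma> t \<in> fst c}"
    have T: "open ?T" "r \<in> ?T" using sc(6)[OF c(1)] r c by auto
    let ?g = "\<lambda>(x, a). met c x a (tfield M (chart_inv c x) c)"
    have "continuous_on ?T (\<lambda>t. cvel c \<gamma> t)"
      using velocity_continuous_chart[OF \<gamma> _ c(1)] by (intro continuous_at_imp_continuous_on) auto
    then have "continuous_on ?T (\<lambda>t. ?g (cvel c \<gamma> t))"
      by (rule continuous_on_compose2[OF time_component_continuous[OF c(1)]])
        (intro image_subsetI tcoord_in_phase[OF c(1)], simp add: fst_vel)
    moreover have "?g (cvel c \<gamma> t) = h t" if "t \<in> ?T" for t
    proof -
      have "snd (vel \<gamma> t) \<in> tspace (\<gamma> t)"
        using geo_TM[OF \<gamma>, of t] that by (metis (mono_tags, lifting) fst_vel in_TM mem_Collect_eq prod.collapse)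
      from time_component_coord[OF c(1) _ this] that show ?thesis
        unfolding h_def by (metis (mono_tags, lifting) fst_vel mem_Collect_eq prod.collapse)
    qed
    ultimately have "continuous_on ?T h" by (rule continuous_on_eq)
    then show "isCont h r" using T continuous_on_eq_continuous_at by blast
  qed
  moreover have "h r \<noteq> 0" if "r \<in> J" for r
    using null_not_orthogonal n[OF that] unfolding h_def by (metis fst_vel prod.collapse)
  moreover have "connected J" using sc(2) is_interval_connected by blast
  ultimately have "is_interval (h ` J)" "0 \<notin> h ` J"
    by (auto simp: is_interval_connected_1 intro: connected_continuous_image)
  then have "h t < 0"
    using s t fut mem_is_interval_1_I[of "h ` J" "h s" "h t" 0] by (smt (verit) imageI)
  then show ?thesis by (simp add: fut)
qed

section \<open>Future null directions\<close>

abbreviation "FNT \<equiv> future_null_topology M"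
definition FN :: "('a \<times> ('a, 'e) tvec) set" where "FN = {X. null_vec M X \<and> future_directed M X}"

abbreviation "cyl c S \<equiv> {(p, v). (p, v) \<in> TM \<and> p \<in> fst c \<and> (snd c p, v c) \<in> S}"

lemma topspace_tangent: "topspace (tangent_topology (atlas M)) = TM"
proof -
  let ?S = "{(cyl c O') | c O'. c \<in> atlas M \<and> open O'}"
  have "X \<in> \<Union>?S" if X: "X \<in> TM" for X
  proof -
    obtain c where c: "c \<in> atlas M" "fst X \<in> fst c" by (rule chartE)
    let ?U = "(cyl c UNIV)"
    have "X \<in> ?U" using X c(2) by (auto split: prod.splits)
    moreover have "?U \<in> ?S" using c(1) open_UNIV by blast
    ultimately show ?thesis by (rule UnionI[rotated])
  qed
  moreover have "\<Union>?S \<subseteq> TM" by blast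
  ultimately have "\<Union>?S = TM" by blast
  then show ?thesis unfolding tangent_topology_def topology_generated_by_topspace .
qed

lemma topspace_FNT: "topspace FNT = FN"
  unfolding future_null_topology_def topspace_subtopology topspace_tangent
  by (auto simp: FN_def null_vec_iff)

lemma FN_TM: "X \<in> FN \<Longrightarrow> X \<in> TM" by (simp add: FN_def null_vec_iff)

lemma openin_FNT_chart:
  assumes c: "c \<in> atlas M" and S: "open S"
  shows "openin FNT {X \<in> FN. fst X \<in> fst c \<and> tcoord c X \<in> S}"
proof -
  have "openin (tangent_topology (atlas M)) (cyl c S)"
    unfolding tangent_topology_def by (rule topology_generated_by_Basis) (use c S in blast)
  moreover have "{X \<in> FN. fst X \<in> fst c \<and> tcoord c X \<in> S} =
      cyl c S \<inter> {X. null_vec M X \<and> future_directed M X}"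
    by (auto simp: FN_def null_vec_iff tcoord_def)
  ultimately show ?thesis
    unfolding future_null_topology_def openin_subtopology by (intro exI conjI)
qed

text \<open>The inverse of the bundle chart \<open>tcoord c\<close>; meaningful on
  \<open>phase c\<close>.\<close>

definition lift :: "('a, 'e) chart \<Rightarrow> 'e \<times> 'e \<Rightarrow> 'a \<times> ('a, 'e) tvec" where
  "lift c = (\<lambda>(x, a). (chart_inv c x, tvec c (chart_inv c x) a))"

lemma lift_in_TM: "c \<in> atlas M \<Longrightarrow> z \<in> phase c \<Longrightarrow> lift c z \<in> TM"
  by (auto simp: lift_def phase_def in_TM intro!: tvec_in chart_inv_in)

lemma lift_tcoord: "c \<in> atlas M \<Longrightarrow> X \<in> TM \<Longrightarrow> fst X \<in> fst c \<Longrightarrow> lift c (tcoord c X) = X"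
  by (cases X) (simp add: lift_def tcoord_def chart_inv_chart in_TM tvec_component)

lemma tcoord_lift:
  assumes c: "c \<in> atlas M" and d: "d \<in> atlas M" and x: "x \<in> overlap c d"
  shows "tcoord d (lift c (x, a)) = (tmap c d x, dtrans c d x a)"
proof -
  obtain p where p: "p \<in> fst c" "p \<in> fst d" "x = snd c p" using x by (auto simp: overlap_def)
  show ?thesis
    using tspace_transition[OF tvec_in[OF c p(1)] c d p(1,2), of a] tvec_self[OF c p(1)]
    by (simp add: tcoord_def lift_def p(3) chart_inv_chart[OF c p(1)] transition_chart[OF c p(1)])
qed

text \<open>The topology is generated by the cylinders over all charts, so those over another chart
  \<open>d\<close> have to be pulled back as well. On the overlap the change of bundle coordinates,
  formed from \<open>tmap c d\<close> and \<open>dtrans c d\<close>, is continuous.\<close>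

lemma lift_continuous:
  assumes c: "c \<in> atlas M"
  shows "continuous_map (top_of_set (phase c)) (tangent_topology (atlas M)) (lift c)"
  unfolding tangent_topology_def
proof (rule continuous_on_generated_topo)
  show "lift c ` topspace (top_of_set (phase c)) \<subseteq>
      \<Union> {(cyl c O') |c O'. c \<in> atlas M \<and> open O'}"
    using lift_in_TM[OF c] topspace_tangent
    unfolding tangent_topology_def topology_generated_by_topspace by auto
  fix U assume "U \<in> {(cyl c O') |c O'. c \<in> atlas M \<and> open O'}"
  then obtain d S where d: "d \<in> atlas M" and S: "open S"
    and U: "U = (cyl d S)" by blast
  let ?O = "overlap c d \<times> (UNIV :: 'e set)"
  let ?f = "\<lambda>z. (tmap c d (fst z), dtrans c d (fst z) (snd z))"
  have O: "open ?O" using open_overlap[OF c d] by (simp add: open_Times)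
  have 1: "continuous_on ?O (\<lambda>z. tmap c d (fst z))"
    by (rule continuous_on_compose2[OF smooth_on_continuous[OF transition_smooth[OF c d]]]) (auto intro: continuous_intros)
  have "continuous_on ?O (\<lambda>z. dtrans c d (fst z) i)" for i
    by (rule continuous_on_compose2[OF smooth_on_continuous[OF dtrans_smooth[OF c d]]]) (auto intro: continuous_intros)
  then have "continuous_on ?O (\<lambda>z. \<Sum>i\<in>Basis. (snd z \<bullet> i) *\<^sub>R dtrans c d (fst z) i)"
    by (intro continuous_intros)
  then have 2: "continuous_on ?O (\<lambda>z. dtrans c d (fst z) (snd z))"
    by (rule continuous_on_eq) (auto intro!: linear_basis_sum[symmetric] dtrans_linear[OF c d])
  have "open (?O \<inter> ?f -` S)"
    by (rule continuous_open_preimage[OF continuous_on_Pair[OF 1 2] O S])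
  moreover have "lift c -` U \<inter> phase c = ?O \<inter> ?f -` S"
  proof -
    have "(x, a) \<in> lift c -` U \<inter> phase c \<longleftrightarrow> (x, a) \<in> ?O \<inter> ?f -` S" for x a
    proof (cases "x \<in> overlap c d")
      case True
      have "(snd d (fst X), snd X d) = tcoord d X" for X by (simp add: tcoord_def case_prod_beta)
      then have "(x, a) \<in> lift c -` U \<longleftrightarrow> lift c (x, a) \<in> TM \<and> fst (lift c (x, a)) \<in> fst d \<and> tcoord d (lift c (x, a)) \<in> S"
        by (simp add: U case_prod_beta)
      then show ?thesis
        using True overlap_iff[OF c] lift_in_TM[OF c, of "(x, a)"] tcoord_lift[OF c d True]
        by (auto simp: phase_def lift_def)
    next
      case False
      then show ?thesis using overlap_iff[OF c] by (auto simp: U phase_def lift_def)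
    qed
    then show ?thesis unfolding set_eq_iff split_paired_All by blast
  qed
  ultimately show "openin (top_of_set (phase c)) (lift c -` U \<inter> topspace (top_of_set (phase c)))"
    by (auto simp: openin_open Int_commute)
qed

text \<open>Converts openness in the generated topology into an epsilon condition in a single chart,
  the form needed for limits of vectors and for the estimate on the geodesic flow.\<close>

lemma openin_FNT_ball:
  assumes P: "openin FNT P" and X: "X \<in> P" and c: "c \<in> atlas M" "fst X \<in> fst c"
  shows "\<exists>e>0. \<forall>Y\<in>FN. fst Y \<in> fst c \<and> dist (tcoord c Y) (tcoord c X) < e \<longrightarrow> Y \<in> P"
proof -
  obtain Q where Q: "openin (tangent_topology (atlas M)) Q" "P = Q \<inter> {X. null_vec M X \<and> future_directed M X}"
    using P unfolding future_null_topology_def openin_subtopology by blast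
  have XT: "X \<in> TM" using openin_subset[OF P] X topspace_FNT FN_TM by blast
  have "openin (top_of_set (phase c)) {z \<in> topspace (top_of_set (phase c)). lift c z \<in> Q}"
    by (rule openin_continuous_map_preimage[OF lift_continuous[OF c(1)] Q(1)])
  then have "open {z \<in> phase c. lift c z \<in> Q}" using open_phase[OF c(1)] by (simp add: openin_open_eq)
  moreover have "tcoord c X \<in> {z \<in> phase c. lift c z \<in> Q}"
    using tcoord_in_phase[OF c] lift_tcoord[OF c(1) XT c(2)] X Q(2) by simp
  ultimately obtain e where e: "e > 0" "ball (tcoord c X) e \<subseteq> {z \<in> phase c. lift c z \<in> Q}" using openE by blast
  have "Y \<in> P" if Y: "Y \<in> FN" "fst Y \<in> fst c" "dist (tcoord c Y) (tcoord c X) < e" for Y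
  proof -
    have "tcoord c Y \<in> ball (tcoord c X) e" using Y(3) by (simp add: dist_commute)
    then have "lift c (tcoord c Y) \<in> Q" using e(2) by blast
    then show ?thesis using lift_tcoord[OF c(1) FN_TM[OF Y(1)] Y(2)] Y(1) Q(2) by (simp add: FN_def)
  qed
  then show ?thesis using e(1) by blast
qed

lemma metric_scale_left: "v \<in> tspace p \<Longrightarrow> w \<in> tspace p \<Longrightarrow> metric M p (tv_scale a v) w = a * metric M p v w"
  using metric_linear_left[of v p v w a 0] by (simp add: tv_lin_def tv_scale_def)

lemma null_vec_scale: "null_vec M (p, v) \<Longrightarrow> a \<noteq> 0 \<Longrightarrow> null_vec M (p, tv_scale a v)"
proof -
  assume n: "null_vec M (p, v)" and a: "a \<noteq> 0"
  have v: "v \<in> tspace p" "v \<noteq> (\<lambda>_. 0)" "metric M p v v = 0" using n by (auto simp: null_vec_iff in_TM)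
  have "metric M p (tv_scale a v) (tv_scale a v) = 0"
    using metric_scale_left[OF v(1) tv_scale_in[OF v(1)]] metric_scale_left[OF v(1) v(1)]
      metric_sym[OF v(1) tv_scale_in[OF v(1)]] v(3) by simp
  moreover have "tv_scale a v \<noteq> (\<lambda>_. 0)" using v(2) a by (auto simp: tv_scale_def fun_eq_iff)
  ultimately show ?thesis using tv_scale_in[OF v(1)] by (simp add: null_vec_iff in_TM)
qed

lemma FN_scale: "(p, v) \<in> FN \<Longrightarrow> a > 0 \<Longrightarrow> (p, tv_scale a v) \<in> FN"
  using null_vec_scale[of p v a] metric_scale_left[OF _ tfield_in, of v p a]
  by (auto simp: FN_def future_directed_def null_vec_iff in_TM mult_pos_neg)

lemma null_vec_future_or_past:
  assumes "null_vec M (p, v)" "(p, v) \<notin> FN" shows "(p, tv_scale (-1) v) \<in> FN"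
proof -
  have v: "v \<in> tspace p" using assms(1) by (simp add: null_vec_iff in_TM)
  have "metric M p v (tfield M p) > 0"
    using assms null_not_orthogonal[OF assms(1)] by (simp add: FN_def future_directed_def)
  then show ?thesis
    using null_vec_scale[OF assms(1), of "-1"] metric_scale_left[OF v tfield_in, of "-1"]
    by (simp add: FN_def future_directed_def)
qed

lemma tv_scale_scale: "tv_scale a (tv_scale b v) = tv_scale (a * b) v" by (simp add: tv_scale_def)
lemma tv_scale_one: "tv_scale 1 v = v" by (simp add: tv_scale_def)

definition ray :: "'a \<times> ('a, 'e) tvec \<Rightarrow> ('a \<times> ('a, 'e) tvec) set" where
  "ray X = ray_rel M `` {X}"

lemma in_ray: "X \<in> FN \<Longrightarrow> Y \<in> ray X \<longleftrightarrow> (\<exists>a>0. Y = (fst X, tv_scale a (snd X)))"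
  unfolding ray_def ray_rel_def topspace_FNT using FN_scale by (cases X) auto

lemma ray_self: "X \<in> FN \<Longrightarrow> X \<in> ray X"
  using in_ray[of X X] tv_scale_one by (metis prod.collapse zero_less_one)

lemma ray_scale: "X \<in> FN \<Longrightarrow> a > 0 \<Longrightarrow> ray (fst X, tv_scale a (snd X)) = ray X"
proof -
  assume X: "X \<in> FN" and a: "a > 0"
  have Xa: "(fst X, tv_scale a (snd X)) \<in> FN" using FN_scale[of "fst X" "snd X"] X a by simp
  have "(\<exists>b>0. Y = (fst X, tv_scale (b * a) (snd X))) \<longleftrightarrow> (\<exists>b>0. Y = (fst X, tv_scale b (snd X)))" for Y
  proof
    assume "\<exists>b>0. Y = (fst X, tv_scale b (snd X))"
    then obtain b where "b > 0" "Y = (fst X, tv_scale b (snd X))" by blast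
    then show "\<exists>b>0. Y = (fst X, tv_scale (b * a) (snd X))" using a by (intro exI[of _ "b / a"]) auto
  next
    assume "\<exists>b>0. Y = (fst X, tv_scale (b * a) (snd X))"
    then show "\<exists>b>0. Y = (fst X, tv_scale b (snd X))" using a by (metis mult_pos_pos)
  qed
  then show ?thesis by (simp add: set_eq_iff in_ray[OF X] in_ray[OF Xa] tv_scale_scale)
qed

lemma ray_subset_FN: "X \<in> FN \<Longrightarrow> Y \<in> ray X \<Longrightarrow> Y \<in> FN"
  unfolding ray_def ray_rel_def topspace_FNT by blast

abbreviation "SNT \<equiv> null_direction_topology M"
definition SN :: "('a \<times> ('a, 'e) tvec) set set" where "SN = ray ` FN"

lemma topspace_SNT: "topspace SNT = SN"
  unfolding null_direction_topology_def topspace_quotient_topology topspace_FNT SN_def ray_def quotient_def by blast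

section \<open>The space of null-geodesics and the skies\<close>

lemma null_geodesic_through_direction: "X \<in> FN \<Longrightarrow> \<exists>J \<gamma>. null_geo J \<gamma> \<and> 0 \<in> J \<and> vel \<gamma> 0 = X \<and> tangent (ray X) J \<gamma>"
  using null_geodesic_exists[of X] ray_self[of X] unfolding tangent_to_def FN_def by (metis mem_Collect_eq)

text \<open>At suitable times the two velocities are positive multiples of the same vector, so the
  curves differ by an increasing affine change of parameter. This is what makes
  \<open>common_geodesic_rel\<close> behave as an equivalence relation.\<close>

lemma common_direction:
  assumes \<gamma>1: "null_geo J1 \<gamma>1" and \<gamma>2: "null_geo J2 \<gamma>2" and d: "d \<in> SN"
    and t: "tangent d J1 \<gamma>1" "tangent d J2 \<gamma>2"
  shows "\<gamma>2 ` J2 \<subseteq> \<gamma>1 ` J1" and "e \<in> SN \<Longrightarrow> tangent e J2 \<gamma>2 \<Longrightarrow> tangent e J1 \<gamma>1"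
proof -
  obtain X where X: "X \<in> FN" "d = ray X" using d by (auto simp: SN_def)
  obtain t1 where t1: "t1 \<in> J1" "vel \<gamma>1 t1 \<in> ray X" using t(1) X by (auto simp: tangent_to_def)
  obtain t2 where t2: "t2 \<in> J2" "vel \<gamma>2 t2 \<in> ray X" using t(2) X by (auto simp: tangent_to_def)
  obtain a1 where a1: "a1 > 0" "vel \<gamma>1 t1 = (fst X, tv_scale a1 (snd X))" using t1(2) in_ray[OF X(1)] by blast
  obtain a2 where a2: "a2 > 0" "vel \<gamma>2 t2 = (fst X, tv_scale a2 (snd X))" using t2(2) in_ray[OF X(1)] by blast
  define a where "a = a2 / a1"
  have a: "a > 0" using a1 a2 by (simp add: a_def)
  have "fst X = \<gamma>1 t1" using a1(2) fst_vel by (metis fst_conv)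
  then have eq: "vel \<gamma>2 t2 = (\<gamma>1 t1, tv_scale a (snd (vel \<gamma>1 t1)))"
    using a1 a2 by (simp add: tv_scale_scale a_def)
  let ?s = "\<lambda>s. a * s + (t1 - a * t2)"
  have s: "?s s \<in> J1" "vel \<gamma>2 s = (\<gamma>1 (?s s), tv_scale a (snd (vel \<gamma>1 (?s s))))" if "s \<in> J2" for s
    using null_geodesic_same_direction[OF \<gamma>1 \<gamma>2 t1(1) t2(1) _ eq that] a by auto
  show "\<gamma>2 ` J2 \<subseteq> \<gamma>1 ` J1"
  proof
    fix p assume "p \<in> \<gamma>2 ` J2"
    then obtain r where r: "r \<in> J2" "p = \<gamma>2 r" by blast
    have "p = \<gamma>1 (?s r)" using s(2)[OF r(1)] r(2) fst_vel by (metis fst_conv)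
    then show "p \<in> \<gamma>1 ` J1" using s(1)[OF r(1)] by blast
  qed
  show "tangent e J1 \<gamma>1" if e: "e \<in> SN" "tangent e J2 \<gamma>2"
  proof -
    obtain Y where Y: "Y \<in> FN" "e = ray Y" using e(1) by (auto simp: SN_def)
    obtain r where r: "r \<in> J2" "vel \<gamma>2 r \<in> ray Y" using e(2) Y(2) by (auto simp: tangent_to_def)
    obtain b where b: "b > 0" "vel \<gamma>2 r = (fst Y, tv_scale b (snd Y))" using r(2) in_ray[OF Y(1)] by blast
    let ?V = "vel \<gamma>1 (?s r)"
    have fst: "fst Y = fst ?V" and "tv_scale b (snd Y) = tv_scale a (snd ?V)"
      using s(2)[OF r(1)] b(2) by (auto simp: fst_vel)
    then have "tv_scale (1/a) (tv_scale b (snd Y)) = snd ?V"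
      using a by (simp add: tv_scale_scale tv_scale_one)
    then have "?V = (fst Y, tv_scale (b/a) (snd Y))" using fst by (simp add: tv_scale_scale prod_eq_iff)
    then have "?V \<in> ray Y" using in_ray[OF Y(1)] a b(1) by (metis divide_pos_pos)
    then show ?thesis using s(1)[OF r(1)] Y(2) by (auto simp: tangent_to_def)
  qed
qed

definition geod :: "('a \<times> ('a, 'e) tvec) set \<Rightarrow> ('a \<times> ('a, 'e) tvec) set set" where
  "geod d = common_geodesic_rel M `` {d}"

text \<open>The relation allows a different geodesic for every pair of directions; by
  \<open>common_direction\<close> one geodesic tangent to \<open>d\<close> serves for the whole
  class.\<close>

lemma geod_eq:
  assumes "null_geo J \<gamma>" "d \<in> SN" "tangent d J \<gamma>"
  shows "geod d = {e \<in> SN. tangent e J \<gamma>}"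
  unfolding geod_def common_geodesic_rel_def topspace_SNT
  using assms common_direction(2)[OF assms(1) _ assms(2,3)] by blast

abbreviation "NT \<equiv> null_geodesic_topology M"

lemma topspace_NT: "topspace NT = geod ` SN"
  unfolding null_geodesic_topology_def topspace_quotient_topology topspace_SNT geod_def quotient_def by blast

text \<open>The two successive quotients compose, so openness is tested directly on future null
  vectors, where bundle coordinates are at hand.\<close>

lemma openin_NT:
  "openin NT W \<longleftrightarrow> W \<subseteq> geod ` SN \<and> openin FNT {X \<in> FN. geod (ray X) \<in> W}"
proof -
  have "{X \<in> FN. ray X \<in> {d \<in> SN. geod d \<in> W}} = {X \<in> FN. geod (ray X) \<in> W}"
    by (auto simp: SN_def)
  moreover have "openin SNT {d \<in> SN. geod d \<in> W} \<longleftrightarrow> openin FNT {X \<in> FN. ray X \<in> {d \<in> SN. geod d \<in> W}}"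
    unfolding null_direction_topology_def openin_quotient_topology topspace_FNT ray_def[symmetric]
    by (auto simp: SN_def quotient_def ray_def)
  moreover have "openin NT W \<longleftrightarrow> W \<subseteq> geod ` SN \<and> openin SNT {d \<in> SN. geod d \<in> W}"
    unfolding null_geodesic_topology_def openin_quotient_topology topspace_SNT geod_def[symmetric]
    by (auto simp: quotient_def geod_def)
  ultimately show ?thesis by simp
qed

lemma null_geodesic_vel_FN:
  assumes \<gamma>: "null_geo J \<gamma>" and s: "s \<in> J" "vel \<gamma> s \<in> FN" and t: "t \<in> J"
  shows "vel \<gamma> t \<in> FN"
  using null_geodesic_future[OF null_geoD(1)[OF \<gamma>] null_geoD(2)[OF \<gamma>] s(1) _ t] s(2)
    null_geoD(2)[OF \<gamma> t] by (simp add: FN_def)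

text \<open>By definition a member of the sky is tangent to a null-geodesic that passes through
  \<open>x\<close>, possibly at another time. Time orientation is preserved along the curve, so its
  velocity at \<open>x\<close> is a future null vector of the same class.\<close>

lemma sky_eq: "sky M x = {geod (ray X) | X. X \<in> FN \<and> fst X = x}"
proof (intro equalityI subsetI)
  fix n assume "n \<in> {geod (ray X) | X. X \<in> FN \<and> fst X = x}"
  then obtain X where X: "X \<in> FN" "fst X = x" "n = geod (ray X)" by blast
  obtain J \<gamma> where g: "null_geo J \<gamma>" "0 \<in> J" "vel \<gamma> 0 = X" "tangent (ray X) J \<gamma>"
    using null_geodesic_through_direction[OF X(1)] by blast
  have d: "ray X \<in> SN" using X by (simp add: SN_def)
  have "ray X \<in> n" using geod_eq[OF g(1) d g(4)] d g(4) X(3) by simp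
  moreover have "x = \<gamma> 0" using g(3) X(2) fst_vel by metis
  ultimately show "n \<in> sky M x" unfolding sky_def topspace_NT using g d X(3) by blast
next
  fix n assume "n \<in> sky M x"
  then obtain d0 J \<gamma> d t where d0: "d0 \<in> SN" "n = geod d0" and g: "null_geo J \<gamma>"
    and d: "d \<in> n" "tangent d J \<gamma>" and t: "t \<in> J" "x = \<gamma> t"
    unfolding sky_def topspace_NT by blast
  obtain J0 \<gamma>0 where g0: "null_geo J0 \<gamma>0" "tangent d0 J0 \<gamma>0"
    using null_geodesic_through_direction d0(1) unfolding SN_def by blast
  have n0: "n = {e \<in> SN. tangent e J0 \<gamma>0}" using geod_eq[OF g0(1) d0(1) g0(2)] d0(2) by simp
  then have dS: "d \<in> SN" "tangent d J0 \<gamma>0" using d(1) by auto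
  have n: "n = {e \<in> SN. tangent e J \<gamma>}"
    unfolding n0 using common_direction(2)[OF g g0(1) dS(1) d(2) dS(2)] common_direction(2)[OF g0(1) g dS d(2)] by blast
  obtain s where s: "s \<in> J" "vel \<gamma> s \<in> FN"
    using d(2) dS(1) ray_subset_FN unfolding tangent_to_def SN_def by blast
  let ?X = "vel \<gamma> t"
  have X: "?X \<in> FN" by (rule null_geodesic_vel_FN[OF g s t(1)])
  then have "tangent (ray ?X) J \<gamma>" using ray_self t(1) unfolding tangent_to_def by blast
  then have "n = geod (ray ?X)" using geod_eq[OF g _ \<open>tangent (ray ?X) J \<gamma>\<close>] X n by (simp add: SN_def)
  moreover have "fst ?X = x" using t(2) by (simp add: fst_vel)
  ultimately show "n \<in> {geod (ray X) | X. X \<in> FN \<and> fst X = x}" using X by blast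
qed

text \<open>
  Null directions over a compact set form a compact set: normalised null vectors at points tending
  to \<open>x\<close> accumulate at a nonzero null vector at \<open>x\<close>.
\<close>

lemma sky_upper_semicontinuous:
  assumes W: "openin NT W" and x: "sky M x \<subseteq> W"
  shows "\<exists>U. open U \<and> x \<in> U \<and> (\<forall>y\<in>U. sky M y \<subseteq> W)"
proof (rule ccontr)
  assume no: "\<not> ?thesis"
  define P where "P = {X \<in> FN. geod (ray X) \<in> W}"
  have P: "openin FNT P" using W unfolding openin_NT P_def by blast
  obtain c where c: "c \<in> atlas M" "x \<in> fst c" by (rule chartE)
  define x0 where "x0 = snd c x"
  have x0: "x0 \<in> cdom c" unfolding x0_def by (rule chart_in[OF c])
  have bad: "\<exists>Z. Z \<in> FN \<and> Z \<notin> P \<and> fst Z \<in> fst c \<and> dist (fst (tcoord c Z)) x0 < e \<and> norm (snd (tcoord c Z)) = 1"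
    if e: "e > 0" for e
  proof -
    let ?U = "fst c \<inter> snd c -` ball x0 e"
    have "open ?U" by (rule continuous_open_preimage[OF chart_continuous[OF c(1)] open_chart[OF c(1)] open_ball])
    moreover have "x \<in> ?U" using c(2) e by (simp add: x0_def)
    ultimately obtain y where y: "y \<in> ?U" "\<not> sky M y \<subseteq> W" using no by blast
    obtain X where X: "X \<in> FN" "fst X = y" "geod (ray X) \<notin> W" using y(2) unfolding sky_eq by blast
    let ?v = "snd X"
    have v: "?v \<in> tspace y" "?v \<noteq> (\<lambda>_. 0)" using X by (auto simp: FN_def null_vec_iff in_TM tangent_bundle_def)
    have vc: "norm (?v c) > 0" using component_zero_iff[OF c(1) _ v(1)] v(2) y by simp
    \<comment> \<open>Normalisation in the chart keeps the ray, hence the geodesic, and places the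
      components in the compact unit sphere.\<close>
    let ?Z = "(fst X, tv_scale (1 / norm (?v c)) ?v)"
    have "?Z \<in> FN" using FN_scale[of "fst X" ?v] X(1) vc by simp
    moreover have "ray ?Z = ray X" by (rule ray_scale) (use X(1) vc in auto)
    ultimately show ?thesis using X y vc
      by (intro exI[of _ ?Z]) (auto simp: P_def tcoord_def tv_scale_def dist_commute)
  qed
  have "\<exists>Z. \<forall>n::nat. Z n \<in> FN \<and> Z n \<notin> P \<and> fst (Z n) \<in> fst c \<and>
      dist (fst (tcoord c (Z n))) x0 < inverse (real (Suc n)) \<and> norm (snd (tcoord c (Z n))) = 1"
    by (rule choice) (use bad in simp)
  then obtain Z where Z: "\<And>n::nat. Z n \<in> FN" "\<And>n. Z n \<notin> P" "\<And>n. fst (Z n) \<in> fst c"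
      "\<And>n. dist (fst (tcoord c (Z n))) x0 < inverse (real (Suc n))" "\<And>n. norm (snd (tcoord c (Z n))) = 1"
    by blast
  have "compact (sphere (0::'e) 1)" by simp
  then obtain w r where w: "w \<in> sphere (0::'e) 1" and r: "strict_mono r"
      and lim_w: "((\<lambda>n. snd (tcoord c (Z n))) \<circ> r) \<longlonglongrightarrow> w"
    unfolding compact_def using Z(5) by (metis (mono_tags, lifting) dist_0_norm mem_sphere)
  have "(\<lambda>n. fst (tcoord c (Z n))) \<longlonglongrightarrow> x0"
    unfolding tendsto_dist_iff[of _ x0]
    by (rule tendsto_sandwich[OF _ _ tendsto_const LIMSEQ_inverse_real_of_nat])
      (use Z(4) in \<open>auto intro!: always_eventually less_imp_le\<close>)
  then have lim_x: "((\<lambda>n. fst (tcoord c (Z n))) \<circ> r) \<longlonglongrightarrow> x0" using r by (rule LIMSEQ_subseq_LIMSEQ)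
  let ?z = "\<lambda>n. tcoord c (Z (r n))"
  have lim: "?z \<longlonglongrightarrow> (x0, w)" using tendsto_Pair[OF lim_x lim_w] by (simp add: o_def)
  have zph: "?z n \<in> phase c" for n by (rule tcoord_in_phase[OF c(1) Z(3)])
  have wph: "(x0, w) \<in> phase c" using x0 by (simp add: phase_def)
  define X where "X = lift c (x0, w)"
  have X_x: "fst X = x" by (simp add: X_def lift_def x0_def chart_inv_chart[OF c])
  have XT: "X \<in> TM" unfolding X_def by (rule lift_in_TM[OF c(1) wph])
  have X_tc: "tcoord c X = (x0, w)" unfolding X_def
    using tcoord_lift[OF c(1) c(1), of x0 w] x0 overlap_self[OF c(1)] dtrans_self[OF c(1) x0]
    by (simp add: tmap_def chart_chart_inv[OF c(1) x0])
  have X_v: "snd X \<in> tspace x" using XT X_x by (metis in_TM prod.collapse)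
  have Xc: "snd X c = w" using X_tc by (simp add: tcoord_def case_prod_beta)
  let ?E = "\<lambda>(x, a). met c x a a" and ?T = "\<lambda>(x, a). met c x a (tfield M (chart_inv c x) c)"
  have Zv: "snd (Z n) \<in> tspace (fst (Z n))" for n using FN_TM[OF Z(1)] by (metis in_TM prod.collapse)
  have "?E (?z n) = 0" for n
    using Z(1)[of "r n"] metric_eq_met[OF c(1) Z(3) Zv Zv] by (simp add: FN_def null_vec_iff tcoord_def case_prod_beta)
  moreover have "(\<lambda>n. ?E (?z n)) \<longlonglongrightarrow> ?E (x0, w)"
    by (rule continuous_on_tendsto_compose[OF energy_continuous[OF c(1)] lim wph]) (simp add: zph)
  ultimately have "?E (x0, w) = 0" by (simp add: LIMSEQ_const_iff)
  then have E: "metric M x (snd X) (snd X) = 0"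
    using metric_eq_met[OF c X_v X_v] Xc by (simp add: x0_def)
  have "?T (?z n) < 0" for n
    using Z(1)[of "r n"] time_component_coord[OF c(1) Z(3) Zv, of "r n"]
    by (simp add: FN_def future_directed_def case_prod_beta)
  moreover have "(\<lambda>n. ?T (?z n)) \<longlonglongrightarrow> ?T (x0, w)"
    by (rule continuous_on_tendsto_compose[OF time_component_continuous[OF c(1)] lim wph]) (simp add: zph)
  \<comment> \<open>The strict inequality weakens in the limit; it is recovered below because a null
    vector is never orthogonal to the time orientation.\<close>
  ultimately have "?T (x0, w) \<le> 0" by (meson LIMSEQ_le_const2 less_imp_le)
  then have T: "metric M x (snd X) (tfield M x) \<le> 0"
    using time_component_coord[OF c X_v] X_tc X_x by (metis prod.collapse)
  have "snd X \<noteq> (\<lambda>_. 0)" using Xc w by auto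
  then have nv: "null_vec M X" using XT E X_x by (simp add: null_vec_iff)
  then have "X \<in> FN" using T null_not_orthogonal[of x "snd X"] X_x
    by (cases X) (auto simp: FN_def future_directed_def)
  then have XP: "X \<in> P" unfolding P_def using x X_x unfolding sky_eq by blast
  obtain e where e: "e > 0" "\<And>Y. Y \<in> FN \<Longrightarrow> fst Y \<in> fst c \<Longrightarrow> dist (tcoord c Y) (tcoord c X) < e \<Longrightarrow> Y \<in> P"
    using openin_FNT_ball[OF P XP c(1)] c(2) X_x by metis
  obtain n where "dist (?z n) (x0, w) < e" using metric_LIMSEQ_D[OF lim e(1)] by blast
  then show False using e(2)[OF Z(1) Z(3), of "r n"] Z(2)[of "r n"] X_tc by simp
qed

section \<open>Null-geodesics entering an open set\<close>

text \<open>A set of vectors rather than of directions or geodesics, since openness in the space of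
  null-geodesics is tested on future null vectors.\<close>

definition entering :: "'a set \<Rightarrow> ('a \<times> ('a, 'e) tvec) set" where
  "entering U = {X \<in> FN. \<exists>J \<gamma>. null_geo J \<gamma> \<and> (\<exists>t\<in>J. vel \<gamma> t = X) \<and> \<gamma> ` J \<inter> U \<noteq> {}}"

lemma enteringI:
  "X \<in> FN \<Longrightarrow> null_geo J \<gamma> \<Longrightarrow> t \<in> J \<Longrightarrow> vel \<gamma> t = X \<Longrightarrow> \<gamma> ` J \<inter> U \<noteq> {} \<Longrightarrow> X \<in> entering U"
  unfolding entering_def by blast

lemma velocity_common_image:
  assumes "null_geo J1 \<gamma>1" "null_geo J2 \<gamma>2" "t1 \<in> J1" "t2 \<in> J2"
    "vel \<gamma>1 t1 = vel \<gamma>2 t2" "vel \<gamma>1 t1 \<in> FN"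
  shows "\<gamma>2 ` J2 \<subseteq> \<gamma>1 ` J1"
proof (rule common_direction(1)[OF assms(1,2), of "ray (vel \<gamma>1 t1)"])
  show "ray (vel \<gamma>1 t1) \<in> SN" using assms(6) by (simp add: SN_def)
  show "tangent (ray (vel \<gamma>1 t1)) J1 \<gamma>1" "tangent (ray (vel \<gamma>1 t1)) J2 \<gamma>2"
    using ray_self[OF assms(6)] assms(3-5) unfolding tangent_to_def by metis+
qed

text \<open>
  Along a null-geodesic, having a neighbourhood of directions that enter \<open>U\<close> is locally constant by
  continuous dependence on the initial velocity.
\<close>

lemma openin_entering:
  assumes U: "open U"
  shows "openin FNT (entering U)"
proof (subst openin_subopen, rule ballI)
  fix X assume "X \<in> entering U"
  then obtain J \<gamma> t0 t1 where X: "X \<in> FN" and \<gamma>: "null_geo J \<gamma>" and t0: "t0 \<in> J" "vel \<gamma> t0 = X"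
    and t1: "t1 \<in> J" "\<gamma> t1 \<in> U" unfolding entering_def by blast
  note g = null_geoD(1)[OF \<gamma>] and sc = geo_curve[OF null_geoD(1)[OF \<gamma>]]
  have vFN: "vel \<gamma> t \<in> FN" if "t \<in> J" for t
    by (rule null_geodesic_vel_FN[OF \<gamma> t0(1) _ that]) (use X t0 in simp)
  let ?P = "\<lambda>s. \<exists>Q. openin FNT Q \<and> vel \<gamma> s \<in> Q \<and> Q \<subseteq> entering U"
  \<comment> \<open>At \<open>t1\<close> the base point lies in \<open>U\<close>, so nearby vectors
    have base points in \<open>U\<close> and their geodesics meet \<open>U\<close> at time
    0.\<close>
  have start: "?P t1"
  proof -
    obtain c where c: "c \<in> atlas M" "\<gamma> t1 \<in> fst c" by (rule chartE)
    let ?S = "(cdom c \<inter> chart_inv c -` U) \<times> (UNIV :: 'e set)"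
    let ?Q = "{X \<in> FN. fst X \<in> fst c \<and> tcoord c X \<in> ?S}"
    have "open ?S"
      using continuous_open_preimage[OF chart_inv_continuous[OF c(1)] open_cdom[OF c(1)] U] by (simp add: open_Times)
    then have "openin FNT ?Q" by (rule openin_FNT_chart[OF c(1)])
    moreover have "vel \<gamma> t1 \<in> ?Q"
      using vFN[OF t1(1)] c t1(2) by (simp add: fst_vel tcoord_def velocity_def chart_in chart_inv_chart)
    moreover have "?Q \<subseteq> entering U"
    proof
      fix Y assume Y: "Y \<in> ?Q"
      obtain J' \<gamma>' where g': "null_geo J' \<gamma>'" "0 \<in> J'" "vel \<gamma>' 0 = Y"
        using null_geodesic_exists[of Y] Y by (auto simp: FN_def)
      have "\<gamma>' 0 = fst Y" using g'(3) by (metis fst_vel)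
      moreover have "fst Y \<in> fst c" "fst (tcoord c Y) \<in> chart_inv c -` U" using Y by auto
      ultimately have "\<gamma>' 0 \<in> U" using chart_inv_chart[OF c(1)] by (simp add: tcoord_def case_prod_beta)
      then have "\<gamma>' ` J' \<inter> U \<noteq> {}" using g'(2) by blast
      moreover have "Y \<in> FN" using Y by simp
      ultimately show "Y \<in> entering U" using enteringI[OF _ g'] by blast
    qed
    ultimately show ?thesis by (intro exI[of _ ?Q] conjI)
  qed
  have conn: "connected J" using sc(2) is_interval_connected by blast
  have "?P t0"
  proof (rule connected_induction_simple[where P="?P", OF conn t1(1) t0(1) start])
    fix s0 assume s0: "s0 \<in> J"
    obtain c where c: "c \<in> atlas M" "\<gamma> s0 \<in> fst c" by (rule chartE)
    let ?u = "\<lambda>s. cvel c \<gamma> s"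
    have "?u s0 \<in> phase c" by (rule tcoord_in_phase[OF c(1)]) (simp add: fst_vel c(2))
    then obtain d \<rho> \<sigma> where fb: "d > 0" "\<rho> > 0"
      "\<And>w. w \<in> ball (?u s0) \<rho> \<Longrightarrow> geo {-d<..<d} (\<sigma> w)"
      "\<And>w t. w \<in> ball (?u s0) \<rho> \<Longrightarrow> \<bar>t\<bar> < d \<Longrightarrow> \<sigma> w t \<in> fst c"
      "\<And>w. w \<in> ball (?u s0) \<rho> \<Longrightarrow> cvel c (\<sigma> w) 0 = w"
      "\<And>w w' t. w \<in> ball (?u s0) \<rho> \<Longrightarrow> w' \<in> ball (?u s0) \<rho> \<Longrightarrow> \<bar>t\<bar> < d \<Longrightarrow>
        dist (cvel c (\<sigma> w) t) (cvel c (\<sigma> w') t) \<le> 2 * dist w w'"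
      by (rule geodesic_flow_box[OF c(1)]) blast
    have \<sigma>0: "vel (\<sigma> (tcoord c Y)) 0 = Y"
      if Y: "Y \<in> TM" "fst Y \<in> fst c" "tcoord c Y \<in> ball (?u s0) \<rho>" for Y
    proof (rule tcoord_inj[OF c(1) geo_TM[OF fb(3)[OF Y(3)]] Y(1)])
      show "fst (vel (\<sigma> (tcoord c Y)) 0) \<in> fst c" using fb(4)[OF Y(3), of 0] fb(1) by (simp add: fst_vel)
    qed (use fb(1) fb(5) Y in auto)
    have "isCont ?u s0" by (rule velocity_continuous_chart[OF g s0 c])
    then obtain e1 where e1: "e1 > 0" "\<And>s. dist s s0 < e1 \<Longrightarrow> dist (?u s) (?u s0) < \<rho>"
      unfolding continuous_at_eps_delta using fb(2) by blast
    obtain e2 where e2: "e2 > 0" "ball s0 e2 \<subseteq> {t \<in> J. \<gamma> t \<in> fst c}"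
      using sc(6)[OF c(1)] s0 c(2) openE by blast
    \<comment> \<open>Half of \<open>d\<close>, because two times in \<open>ball s0 e\<close> then
      differ by less than \<open>d\<close> and are joined by the same flow box.\<close>
    define e where "e = min (min e1 e2) (d / 2)"
    have e: "e > 0" using e1 e2 fb(1) by (simp add: e_def)
    have inT: "s \<in> J" "\<gamma> s \<in> fst c" "?u s \<in> ball (?u s0) \<rho>" if "s \<in> ball s0 e" for s
    proof -
      have "s \<in> ball s0 e2" using that by (simp add: e_def)
      then show "s \<in> J" "\<gamma> s \<in> fst c" using e2(2) by auto
      show "?u s \<in> ball (?u s0) \<rho>" using e1(2)[of s] that by (simp add: e_def dist_commute)
    qed
    have step: "?P s'" if s: "s \<in> ball s0 e" and s': "s' \<in> ball s0 e" and Ps: "?P s" for s s'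
    proof -
      obtain Q where Q: "openin FNT Q" "vel \<gamma> s \<in> Q" "Q \<subseteq> entering U" using Ps by blast
      obtain \<epsilon> where \<epsilon>: "\<epsilon> > 0" "\<And>Y. Y \<in> FN \<Longrightarrow> fst Y \<in> fst c \<Longrightarrow> dist (tcoord c Y) (?u s) < \<epsilon> \<Longrightarrow> Y \<in> Q"
        using openin_FNT_ball[OF Q(1,2) c(1)] inT(2)[OF s] by (metis fst_vel)
      \<comment> \<open>The flow time from \<open>s'\<close> to \<open>s\<close>; it may be
        negative.\<close>
      define \<tau> where "\<tau> = s - s'"
      have "\<bar>s - s0\<bar> < d / 2" "\<bar>s' - s0\<bar> < d / 2" using s s' by (auto simp: e_def dist_real_def abs_minus_commute[of s0])
      then have \<tau>: "\<bar>\<tau>\<bar> < d" unfolding \<tau>_def by linarith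
      have \<gamma>\<sigma>: "vel (\<sigma> (?u s')) \<tau> = vel \<gamma> s"
      proof -
        let ?\<gamma> = "\<lambda>t. \<gamma> (1 * t + s')"
        have sh: "vel ?\<gamma> t = vel \<gamma> (t + s')" if "t + s' \<in> J" for t
          using geodesic_affine(2)[OF g, of 1 t s'] that
          by (simp add: tv_scale_one) (metis fst_vel prod.collapse)
        have "vel (\<sigma> (?u s')) \<tau> = vel ?\<gamma> \<tau>"
        proof (rule geodesic_unique[OF fb(3)[OF inT(3)[OF s']] geodesic_affine(1)[OF g, of 1 s']])
          show "vel (\<sigma> (?u s')) 0 = vel ?\<gamma> 0"
            using sh[of 0] inT[OF s'] \<sigma>0[OF geo_TM[OF g], of s'] by (simp add: fst_vel)
        qed (use \<tau> fb(1) inT(1)[OF s] inT(1)[OF s'] in \<open>auto simp: \<tau>_def\<close>)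
        then show ?thesis using sh[of \<tau>] inT(1)[OF s] by (simp add: \<tau>_def)
      qed
      \<comment> \<open>The radius is halved because the flow is Lipschitz with constant 2.\<close>
      let ?S = "ball (?u s0) \<rho> \<inter> ball (?u s') (\<epsilon> / 2)"
      let ?Q = "{Y \<in> FN. fst Y \<in> fst c \<and> tcoord c Y \<in> ?S}"
      have "openin FNT ?Q" by (rule openin_FNT_chart[OF c(1)]) auto
      moreover have "vel \<gamma> s' \<in> ?Q"
        using vFN[OF inT(1)[OF s']] inT(2,3)[OF s'] \<epsilon>(1) by (simp add: fst_vel)
      moreover have "?Q \<subseteq> entering U"
      proof
        fix Y assume Y: "Y \<in> ?Q"
        let ?w = "tcoord c Y"
        have w: "?w \<in> ball (?u s0) \<rho>" "dist ?w (?u s') < \<epsilon> / 2" using Y by (auto simp: dist_commute)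
        have I: "0 \<in> {-d<..<d}" "\<tau> \<in> {-d<..<d}" using fb(1) \<tau> by auto
        have v0: "vel (\<sigma> ?w) 0 = Y" using \<sigma>0[of Y] Y w(1) FN_TM by blast
        obtain J3 \<gamma>3 where g3: "null_geo J3 \<gamma>3" "0 \<in> J3" "vel \<gamma>3 0 = Y"
          using null_geodesic_exists[of Y] Y by (auto simp: FN_def)
        have "vel \<gamma>3 0 = vel (\<sigma> ?w) 0" using g3(3) v0 by simp
        \<comment> \<open>The inextendible geodesic with initial velocity \<open>Y\<close> contains
          the flow-box curve, so it still exists at time \<open>\<tau>\<close> and has the same
          velocity there.\<close>
        note max = null_geodesic_maximal[OF g3(1) fb(3)[OF w(1)] g3(2) I(1) this]
        define Z where "Z = vel (\<sigma> ?w) \<tau>"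
        have \<tau>3: "\<tau> \<in> J3" "vel \<gamma>3 \<tau> = Z" using max I(2) by (auto simp: Z_def)
        have Z: "Z \<in> FN" using null_geodesic_vel_FN[OF g3(1,2) _ \<tau>3(1)] g3(3) \<tau>3(2) Y by simp
        have "dist (tcoord c Z) (?u s) \<le> 2 * dist ?w (?u s')"
          using fb(6)[OF w(1) inT(3)[OF s'] \<tau>] \<gamma>\<sigma> by (simp add: Z_def)
        moreover have "fst Z \<in> fst c" using fb(4)[OF w(1) \<tau>] by (simp add: Z_def fst_vel)
        ultimately have "Z \<in> Q" using \<epsilon>(2)[OF Z] w(2) by linarith
        then have "Z \<in> entering U" using Q(3) by blast
        \<comment> \<open>Membership of \<open>Z\<close> only supplies some null-geodesic with this
          velocity; comparison of images transfers its entry into \<open>U\<close> to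
          \<open>\<gamma>3\<close>.\<close>
        then obtain J2 \<gamma>2 t2 where g2: "null_geo J2 \<gamma>2" "t2 \<in> J2" "vel \<gamma>2 t2 = Z" "\<gamma>2 ` J2 \<inter> U \<noteq> {}"
          unfolding entering_def by blast
        have "\<gamma>2 ` J2 \<subseteq> \<gamma>3 ` J3"
          by (rule velocity_common_image[OF g3(1) g2(1) \<tau>3(1) g2(2)]) (simp_all only: \<tau>3(2) g2(3) Z)
        then have "\<gamma>3 ` J3 \<inter> U \<noteq> {}" using g2(4) by blast
        then show "Y \<in> entering U" by (rule enteringI[OF _ g3, rotated]) (use Y in simp)
      qed
      ultimately show ?thesis by (intro exI[of _ ?Q] conjI)
    qed
    have "ball s0 e \<subseteq> J" using inT(1) by blast
    then show "\<exists>T. openin (top_of_set J) T \<and> s0 \<in> T \<and> (\<forall>s\<in>T. \<forall>s'\<in>T. ?P s \<longrightarrow> ?P s')"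
    proof (intro exI[of _ "ball s0 e"] conjI ballI impI)
      show "openin (top_of_set J) (ball s0 e)" using \<open>ball s0 e \<subseteq> J\<close> by (simp add: open_subset)
      show "s0 \<in> ball s0 e" using e by simp
      show "?P s'" if "s \<in> ball s0 e" "s' \<in> ball s0 e" "?P s" for s s' by (rule step[OF that])
    qed
  qed
  then show "\<exists>T. openin FNT T \<and> X \<in> T \<and> T \<subseteq> entering U" using t0(2) by blast
qed

definition entering_geod :: "'a set \<Rightarrow> ('a \<times> ('a, 'e) tvec) set set set" where
  "entering_geod U = {geod (ray X) | X. X \<in> entering U}"

text \<open>Entering \<open>U\<close> depends only on the class: a geodesic that witnesses entry is
  tangent to every direction of its class, and null-geodesics with a common direction have the same
  image. Hence \<open>entering U\<close> is the full preimage of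
  \<open>entering_geod U\<close>.\<close>

lemma geod_entering_iff:
  assumes "X \<in> FN" shows "geod (ray X) \<in> entering_geod U \<longleftrightarrow> X \<in> entering U"
proof
  assume "geod (ray X) \<in> entering_geod U"
  then obtain Y where Y: "Y \<in> entering U" "geod (ray X) = geod (ray Y)" unfolding entering_geod_def by blast
  then obtain J \<gamma> t where g: "null_geo J \<gamma>" "t \<in> J" "vel \<gamma> t = Y" "\<gamma> ` J \<inter> U \<noteq> {}" and YF: "Y \<in> FN"
    unfolding entering_def by blast
  obtain J' \<gamma>' where g': "null_geo J' \<gamma>'" "0 \<in> J'" "vel \<gamma>' 0 = X" "tangent (ray X) J' \<gamma>'"
    using null_geodesic_through_direction[OF assms] by blast
  have S: "ray X \<in> SN" "ray Y \<in> SN" using assms YF by (auto simp: SN_def)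
  have tY: "tangent (ray Y) J \<gamma>" using g(2,3) ray_self[OF YF] by (auto simp: tangent_to_def)
  have "ray X \<in> geod (ray Y)" using geod_eq[OF g'(1) S(1) g'(4)] S(1) g'(4) Y(2) by simp
  then have "tangent (ray X) J \<gamma>" using geod_eq[OF g(1) S(2) tY] by simp
  then have "\<gamma> ` J \<subseteq> \<gamma>' ` J'" by (rule common_direction(1)[OF g'(1) g(1) S(1) g'(4)])
  then have "\<gamma>' ` J' \<inter> U \<noteq> {}" using g(4) by blast
  then show "X \<in> entering U" by (rule enteringI[OF assms g'(1-3)])
next
  show "geod (ray X) \<in> entering_geod U" if "X \<in> entering U"
    using that unfolding entering_geod_def by blast
qed

lemma openin_entering_geod:
  assumes "open U" shows "openin NT (entering_geod U)"
proof -
  have "{X \<in> FN. geod (ray X) \<in> entering_geod U} = entering U"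
    using geod_entering_iff entering_def by blast
  moreover have "entering_geod U \<subseteq> geod ` SN" by (auto simp: entering_geod_def entering_def SN_def)
  ultimately show ?thesis using openin_entering[OF assms] unfolding openin_NT by simp
qed

lemma sky_subset_entering: "x \<in> U \<Longrightarrow> sky M x \<subseteq> entering_geod U"
proof
  fix n assume x: "x \<in> U" and "n \<in> sky M x"
  then obtain X where X: "X \<in> FN" "fst X = x" "n = geod (ray X)" unfolding sky_eq by blast
  obtain J \<gamma> where g: "null_geo J \<gamma>" "0 \<in> J" "vel \<gamma> 0 = X"
    using null_geodesic_through_direction[OF X(1)] by blast
  have "\<gamma> 0 = x" using g(3) X(2) by (metis fst_vel)
  then have "\<gamma> ` J \<inter> U \<noteq> {}" using g(2) x by blast
  then have "X \<in> entering U" by (rule enteringI[OF X(1) g])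
  then show "n \<in> entering_geod U" using X(3) unfolding entering_geod_def by blast
qed

text \<open>Refocusing quantifies over null-geodesics of either time orientation, while skies are
  described by future directions. If the velocity at \<open>y\<close> is past-directed, the
  parameter is reversed, which keeps the image.\<close>

lemma null_geodesic_future_version:
  assumes \<gamma>: "null_geo J \<gamma>" and y: "y \<in> \<gamma> ` J"
  shows "\<exists>J' \<gamma>' t. null_geo J' \<gamma>' \<and> t \<in> J' \<and> \<gamma>' t = y \<and> vel \<gamma>' t \<in> FN \<and> \<gamma>' ` J' = \<gamma> ` J"
proof -
  obtain t where t: "t \<in> J" "\<gamma> t = y" using y by blast
  let ?v = "snd (vel \<gamma> t)"
  have V: "vel \<gamma> t = (y, ?v)" using t(2) by (metis fst_vel prod.collapse)
  show ?thesis
  proof (cases "vel \<gamma> t \<in> FN")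
    case True then show ?thesis using \<gamma> t by blast
  next
    case False
    let ?\<gamma> = "\<lambda>t. \<gamma> (-1 * t + 0)" and ?J = "{t. -1 * t + 0 \<in> J}"
    have "null_geo ?J ?\<gamma>" by (rule null_geodesic_affine[OF \<gamma>]) simp
    moreover have "vel ?\<gamma> (-t) = (y, tv_scale (-1) ?v)"
      using geodesic_affine(2)[OF null_geoD(1)[OF \<gamma>], of "-1" "-t" 0] t by simp
    moreover have "(y, tv_scale (-1) ?v) \<in> FN"
      using null_vec_future_or_past[of y ?v] null_geoD(2)[OF \<gamma> t(1)] False V by metis
    moreover have "?\<gamma> ` ?J = \<gamma> ` J"
    proof (intro equalityI subsetI)
      fix p assume "p \<in> \<gamma> ` J"
      then obtain s where "s \<in> J" "p = \<gamma> s" by blast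
      then show "p \<in> ?\<gamma> ` ?J" by (intro image_eqI[of _ _ "-s"]) auto
    qed auto
    ultimately show ?thesis using t
      by (intro exI[of _ ?J] exI[of _ ?\<gamma>] exI[of _ "-t"]) auto
  qed
qed

section \<open>Separation of skies and the homeomorphism\<close>

lemma sky_separation:
  assumes nr: "\<not> refocusing_at M x" and V: "open V" "x \<in> V"
  shows "\<exists>W. openin NT W \<and> sky M x \<subseteq> W \<and> (\<forall>y. sky M y \<subseteq> W \<longrightarrow> y \<in> V)"
proof -
  have "\<not> (\<forall>U. open U \<and> x \<in> U \<and> U \<subseteq> V \<longrightarrow> (\<exists>y. y \<notin> V \<and> all_null_geodesics_enter M y U))"
    using nr V unfolding refocusing_at_def by metis
  then obtain U where U: "open U" "x \<in> U" "U \<subseteq> V" "\<And>y. y \<notin> V \<Longrightarrow> \<not> all_null_geodesics_enter M y U"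
    by metis
  have "y \<in> V" if y: "sky M y \<subseteq> entering_geod U" for y
  proof (rule ccontr)
    assume "y \<notin> V"
    then obtain J \<gamma> where g: "null_geo J \<gamma>" "y \<in> \<gamma> ` J" "\<gamma> ` J \<inter> U = {}"
      using U(4) unfolding all_null_geodesics_enter_def by blast
    obtain J' \<gamma>' t where g': "null_geo J' \<gamma>'" "t \<in> J'" "\<gamma>' t = y" "vel \<gamma>' t \<in> FN" "\<gamma>' ` J' = \<gamma> ` J"
      using null_geodesic_future_version[OF g(1,2)] by blast
    let ?X = "vel \<gamma>' t"
    have "geod (ray ?X) \<in> entering_geod U" using y g'(3,4) fst_vel[of \<gamma>' t] unfolding sky_eq by blast
    then have "?X \<in> entering U" using geod_entering_iff[OF g'(4)] by blast
    then obtain J2 \<gamma>2 t2 where g2: "null_geo J2 \<gamma>2" "t2 \<in> J2" "vel \<gamma>2 t2 = ?X" "\<gamma>2 ` J2 \<inter> U \<noteq> {}"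
      unfolding entering_def by blast
    have "\<gamma>2 ` J2 \<subseteq> \<gamma>' ` J'"
      by (rule velocity_common_image[OF g'(1) g2(1) g'(2) g2(2)]) (use g'(4) g2(3) in auto)
    then show False using g2(4) g'(5) g(3) by blast
  qed
  then show ?thesis using openin_entering_geod[OF U(1)] sky_subset_entering[OF U(2)] by blast
qed

lemma topspace_sky_topology: "topspace (sky_topology M) = range (sky M)"
proof
  show "topspace (sky_topology M) \<subseteq> range (sky M)"
    using openin_topspace[of "sky_topology M"] unfolding openin_sky_topology sky_open_def by blast
  have "sky M x \<subseteq> topspace NT" for x by (auto simp: sky_def)
  then have "sky_open M (range (sky M))" unfolding sky_open_def by (blast intro: openin_topspace)
  then show "range (sky M) \<subseteq> topspace (sky_topology M)" using openin_subset openin_sky_topology by blast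
qed

lemma sky_homeomorphic_map:
  assumes "\<not> refocusing M"
  shows "homeomorphic_map (euclidean :: 'a topology) (sky_topology M) (sky M)"
proof (rule bijective_open_imp_homeomorphic_map)
  have sep: "\<exists>W. openin NT W \<and> sky M x \<subseteq> W \<and> (\<forall>y. sky M y \<subseteq> W \<longrightarrow> y \<in> V)" if "open V" "x \<in> V" for x V
    using sky_separation[OF _ that] assms unfolding refocusing_def by blast
  show "continuous_map euclidean (sky_topology M) (sky M)"
    unfolding continuous_map_def
  proof (intro conjI allI impI)
    fix S assume S: "openin (sky_topology M) S"
    have "\<exists>U. open U \<and> x \<in> U \<and> U \<subseteq> {x. sky M x \<in> S}" if x: "sky M x \<in> S" for x
    proof -
      obtain W where W: "openin NT W" "sky M x \<subseteq> W" "{sky M y | y. sky M y \<subseteq> W} \<subseteq> S"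
        using conjunct2[OF S[unfolded openin_sky_topology sky_open_def]] x by meson
      obtain U where U: "open U" "x \<in> U" "\<forall>y\<in>U. sky M y \<subseteq> W"
        using sky_upper_semicontinuous[OF W(1,2)] by (elim exE conjE)
      have "sky M y \<in> S" if "y \<in> U" for y
        by (rule subsetD[OF W(3)]) (use U(3) that in blast)
      then show ?thesis using U(1,2) by (intro exI[of _ U]) auto
    qed
    then have "open {x. sky M x \<in> S}" by (subst open_subopen) blast
    then show "openin euclidean {x \<in> topspace euclidean. sky M x \<in> S}" by simp
  qed (simp add: topspace_sky_topology)
  show "open_map euclidean (sky_topology M) (sky M)"
    unfolding open_map_def openin_sky_topology sky_open_def
  proof (intro allI impI conjI ballI)
    fix V :: "'a set" and P assume V: "openin euclidean V" and "P \<in> sky M ` V"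
    then obtain x where x: "x \<in> V" "P = sky M x" by blast
    obtain W where "openin NT W" "sky M x \<subseteq> W" "\<forall>y. sky M y \<subseteq> W \<longrightarrow> y \<in> V"
      using sep[of V x] V x(1) by auto
    then show "\<exists>W. openin NT W \<and> P \<subseteq> W \<and> {sky M y | y. sky M y \<subseteq> W} \<subseteq> sky M ` V" using x(2) by blast
  qed auto
  show "sky M ` topspace euclidean = topspace (sky_topology M)" by (simp add: topspace_sky_topology)
  show "inj_on (sky M) (topspace euclidean)"
  proof (rule inj_onI, rule ccontr)
    fix x y assume eq: "sky M x = sky M y" and "x \<noteq> y"
    \<comment> \<open>Equal skies would force \<open>y\<close> into every open set around
      \<open>x\<close>.\<close>
    then obtain V where V: "open V" "x \<in> V" "y \<notin> V" using t1_space by blast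
    then show False using sep[OF V(1,2)] eq by auto
  qed
qed

end

theorem theorem4p3:
  fixes M :: "('a::{t2_space, second_countable_topology}, 'e::euclidean_space) st"
  assumes "spacetime M"
    and "strongly_causal M"
    and "\<not> refocusing M"
  shows "homeomorphic_map (euclidean :: 'a topology) (sky_topology M) (sky M)"
proof -
  interpret space_time M by unfold_locales (rule assms(1))
  show ?thesis by (rule sky_homeomorphic_map[OF assms(3)])
qed

end
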